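(* Let $\hbar,m,\tau>0$, let $V\in W^{1,\infty}(\mathbb R^d)$ be real-valued, and let $\psi\in C([0,\tau);H^2(\mathbb R^d))$ be a solution of the Schrödinger equation \[ i\hbar\,\partial_t\psi(t,x)=-\tfrac{\hbar^2}{2m}\Delta_x\psi(t,x)+V(x)\psi(t,x). \] Assume that, for all $t>0$ (in the interval $[0,\tau)$ of existence), $\psi(t,x)\ne0$ for a.e. $x\in\mathbb R^d$. Set $\tilde R(t,x,y):=\psi(t,x+\tfrac\hbar2y)\overline{\psi(t,x-\tfrac\hbar2y)}$. Then the density function $\rho:=|\psi|^2$ and the velocity field \[ u(t,x):=\mathbf 1_{\rho(t,x)>0}\,\frac{-i\nabla_y\tilde R(t,x,0)}{m\,\tilde R(t,x,0)} \] satisfy Madelung's system of quantum hydrodynamics on $[0,\tau)\times\mathbb R^d$ (in the sense of distributions): \[ \begin{cases} \partial_t\rho+\nabla_x\cdot(\rho u)=0,\\[4pt] \partial_t(\rho u)+\nabla_x\cdot(\rho u^{\otimes2})=\tfrac{\hbar^2}{4m^2}\,\nabla_x\cdot\left(\nabla_x^2\rho-4(\nabla_x\sqrt\rho)^{\otimes2}\right)-\tfrac1m\,\rho\,\nabla_xV . \end{cases} \]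
   Context: $\nabla_x^2\rho$ denotes the Hessian matrix of $\rho$; for a vector $a\in\mathbb R^d$, $a^{\otimes2}$ is the matrix with entries $a_ja_k$; the divergence of a symmetric matrix field $M$ is the vector field with components $(\nabla_x\cdot M)_k=\sum_j\partial_{x_j}M_{jk}$. $\nabla_y\tilde R(t,x,0)$ is the gradient in $y$ of $\tilde R(t,x,y)$ evaluated at $y=0$, i.e. $\nabla_y\tilde R(t,x,0)=\tfrac\hbar2\left(\overline\psi\nabla_x\psi-\psi\nabla_x\overline\psi\right)(t,x)$, and $\tilde R(t,x,0)=\rho(t,x)$. *)

theory Defs
  imports "HOL-Analysis.Analysis"
begin

section \<open>Test functions\<close>

definition dir_deriv :: "'a::real_normed_vector \<Rightarrow> ('a \<Rightarrow> real) \<Rightarrow> 'a \<Rightarrow> real" where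
  "dir_deriv v f x = frechet_derivative f (at x) v"

fun Ck :: "nat \<Rightarrow> ('a::euclidean_space \<Rightarrow> real) \<Rightarrow> bool" where
  "Ck 0 f \<longleftrightarrow> continuous_on UNIV f"
| "Ck (Suc k) f \<longleftrightarrow> (\<forall>x. f differentiable (at x)) \<and> (\<forall>b\<in>Basis. Ck k (dir_deriv b f))"

definition test_fun :: "'a::euclidean_space set \<Rightarrow> ('a \<Rightarrow> real) \<Rightarrow> bool" where
  "test_fun \<Omega> \<phi> \<longleftrightarrow>
     (\<forall>k. Ck k \<phi>) \<and> compact (closure {x. \<phi> x \<noteq> 0}) \<and> closure {x. \<phi> x \<noteq> 0} \<subseteq> \<Omega>"


section \<open>Weak derivatives and Sobolev spaces\<close>

text \<open>
  Elements of Lebesgue and Sobolev spaces are represented by Lebesgue measurable functions;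
  every notion below depends only on the class of a function modulo null sets.
\<close>

definition loc_integrable :: "('a::euclidean_space \<Rightarrow> 'b::{banach, second_countable_topology}) \<Rightarrow> bool" where
  "loc_integrable f \<longleftrightarrow> (\<forall>K. compact K \<longrightarrow> set_integrable lebesgue K f)"

definition has_weak_deriv ::
    "'n::finite \<Rightarrow> (real^'n \<Rightarrow> 'b::{banach, second_countable_topology}) \<Rightarrow> (real^'n \<Rightarrow> 'b) \<Rightarrow> bool" where
  "has_weak_deriv j f g \<longleftrightarrow> loc_integrable f \<and> loc_integrable g \<and>
     (\<forall>\<phi>. test_fun UNIV \<phi> \<longrightarrow>
        (LINT x|lebesgue. dir_deriv (axis j 1) \<phi> x *\<^sub>R f x) = - (LINT x|lebesgue. \<phi> x *\<^sub>R g x))"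

definition weakly_diff :: "'n::finite \<Rightarrow> (real^'n \<Rightarrow> 'b::{banach, second_countable_topology}) \<Rightarrow> bool" where
  "weakly_diff j f \<longleftrightarrow> (\<exists>g. has_weak_deriv j f g)"

text \<open>A choice of representative; meaningful only for \<^prop>\<open>weakly_diff j f\<close>.\<close>

definition weak_deriv ::
    "'n::finite \<Rightarrow> (real^'n \<Rightarrow> 'b::{banach, second_countable_topology}) \<Rightarrow> real^'n \<Rightarrow> 'b" where
  "weak_deriv j f = (SOME g. has_weak_deriv j f g)"

definition in_L2 :: "(real^'n::finite \<Rightarrow> complex) \<Rightarrow> bool" where
  "in_L2 f \<longleftrightarrow> f \<in> borel_measurable lebesgue \<and> integrable lebesgue (\<lambda>x. (norm (f x))\<^sup>2)"

fun in_H :: "nat \<Rightarrow> (real^'n::finite \<Rightarrow> complex) \<Rightarrow> bool" where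
  "in_H 0 f \<longleftrightarrow> in_L2 f"
| "in_H (Suc k) f \<longleftrightarrow> in_L2 f \<and> (\<forall>j. weakly_diff j f \<and> in_H k (weak_deriv j f))"

fun H_norm_sq :: "nat \<Rightarrow> (real^'n::finite \<Rightarrow> complex) \<Rightarrow> real" where
  "H_norm_sq 0 f = (LINT x|lebesgue. (norm (f x))\<^sup>2)"
| "H_norm_sq (Suc k) f =
     (LINT x|lebesgue. (norm (f x))\<^sup>2) + (\<Sum>j\<in>UNIV. H_norm_sq k (weak_deriv j f))"

definition continuous_curve_H :: "nat \<Rightarrow> real \<Rightarrow> (real \<Rightarrow> real^'n::finite \<Rightarrow> complex) \<Rightarrow> bool" where
  "continuous_curve_H k \<tau> \<psi> \<longleftrightarrow> (\<forall>t\<in>{0..<\<tau>}. in_H k (\<psi> t) \<and>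
     ((\<lambda>s. sqrt (H_norm_sq k (\<lambda>x. \<psi> s x - \<psi> t x))) \<longlongrightarrow> 0) (at t within {0..<\<tau>}))"

definition in_Linf :: "(real^'n::finite \<Rightarrow> real) \<Rightarrow> bool" where
  "in_Linf f \<longleftrightarrow> f \<in> borel_measurable lebesgue \<and> (\<exists>C. AE x in lebesgue. \<bar>f x\<bar> \<le> C)"

definition in_W1inf :: "(real^'n::finite \<Rightarrow> real) \<Rightarrow> bool" where
  "in_W1inf V \<longleftrightarrow> in_Linf V \<and> (\<forall>j. weakly_diff j V \<and> in_Linf (weak_deriv j V))"


section \<open>Distributions in space-time\<close>

text \<open>
  A family \<open>f t\<close> (\<open>0 \<le> t < \<tau>\<close>) of locally integrable functions of \<open>x\<close> acts on test functions
  \<open>\<phi>(t,x)\<close> by the iterated integral. The inner integral only depends on the class of \<open>f t\<close>, so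
  no joint measurability of the chosen representatives is needed.
\<close>

type_synonym ('n, 'b) distr = "(real \<times> (real^'n) \<Rightarrow> real) \<Rightarrow> 'b"

definition distr_of ::
    "real \<Rightarrow> (real \<Rightarrow> real^'n::finite \<Rightarrow> 'b::{banach, second_countable_topology}) \<Rightarrow> ('n, 'b) distr" where
  "distr_of \<tau> f \<phi> = (LINT t:{0..<\<tau>}|lebesgue. (LINT x|lebesgue. \<phi> (t, x) *\<^sub>R f t x))"

text \<open>All the integrals that define the distribution exist (up to and including time \<open>0\<close>).\<close>

definition distr_defined ::
    "real \<Rightarrow> (real \<Rightarrow> real^'n::finite \<Rightarrow> 'b::{banach, second_countable_topology}) \<Rightarrow> bool" where
  "distr_defined \<tau> f \<longleftrightarrow> (\<forall>t\<in>{0..<\<tau>}. loc_integrable (f t)) \<and>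
     (\<forall>\<phi>. test_fun ({..<\<tau>} \<times> UNIV) \<phi> \<longrightarrow>
        set_integrable lebesgue {0..<\<tau>} (\<lambda>t. LINT x|lebesgue. \<phi> (t, x) *\<^sub>R f t x))"

definition D_x :: "'n::finite \<Rightarrow> ('n, 'b::real_normed_vector) distr \<Rightarrow> ('n, 'b) distr" where
  "D_x j T \<phi> = - T (dir_deriv (0, axis j 1) \<phi>)"

text \<open>
  Time derivative on the half-open interval \<open>[0,\<tau>)\<close>. Test functions supported in
  \<open>{..<\<tau>} \<times> UNIV\<close> restrict to those with compact support in \<open>[0,\<tau>) \<times> \<real>\<^sup>d\<close>; they need not
  vanish at \<open>t = 0\<close>, which is why the initial value enters. For test functions supported in
  \<open>{0<..<\<tau>} \<times> UNIV\<close> this term is zero and \<open>D_t\<close> is the usual distributional derivative.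
\<close>

definition D_t ::
    "real \<Rightarrow> (real \<Rightarrow> real^'n::finite \<Rightarrow> 'b::{banach, second_countable_topology}) \<Rightarrow> ('n, 'b) distr" where
  "D_t \<tau> f \<phi> = - distr_of \<tau> f (dir_deriv (1, 0) \<phi>) - (LINT x|lebesgue. \<phi> (0, x) *\<^sub>R f 0 x)"


section \<open>The Schroedinger equation\<close>

text \<open>
  The equation is only required in the interior of the time interval. For continuous curves in
  \<open>H\<^sup>2\<close> this is equivalent to the equation holding in \<open>L\<^sup>2\<close> for every \<open>t\<close>.
\<close>

definition schroedinger_solution ::
    "real \<Rightarrow> real \<Rightarrow> real \<Rightarrow> (real^'n::finite \<Rightarrow> real) \<Rightarrow> (real \<Rightarrow> real^'n \<Rightarrow> complex) \<Rightarrow> bool" where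
  "schroedinger_solution hbar m \<tau> V \<psi> \<longleftrightarrow>
     (\<forall>\<phi>. test_fun ({0<..<\<tau>} \<times> UNIV) \<phi> \<longrightarrow>
        \<i> * of_real hbar * D_t \<tau> \<psi> \<phi> =
          - of_real (hbar\<^sup>2 / (2 * m)) * (\<Sum>j\<in>UNIV. D_x j (D_x j (distr_of \<tau> \<psi>)) \<phi>)
          + distr_of \<tau> (\<lambda>t x. of_real (V x) * \<psi> t x) \<phi>)"


section \<open>Density and velocity\<close>

definition mass_density :: "(real \<Rightarrow> real^'n::finite \<Rightarrow> complex) \<Rightarrow> real \<Rightarrow> real^'n \<Rightarrow> real" where
  "mass_density \<psi> t x = (norm (\<psi> t x))\<^sup>2"

definition R_tilde :: "real \<Rightarrow> (real \<Rightarrow> real^'n::finite \<Rightarrow> complex) \<Rightarrow> real \<Rightarrow> real^'n \<Rightarrow> real^'n \<Rightarrow> complex" where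
  "R_tilde hbar \<psi> t x y = \<psi> t (x + (hbar / 2) *\<^sub>R y) * cnj (\<psi> t (x - (hbar / 2) *\<^sub>R y))"

text \<open>
  The \<open>y\<close>-gradient of \<open>R_tilde hbar \<psi> t x y\<close> at \<open>y = 0\<close>. Since \<open>\<psi> t\<close> need not be
  differentiable at any point, its derivatives are the weak ones; the lemma below shows that the
  formula is the product rule.
\<close>

definition grad_y_R_tilde_0 ::
    "real \<Rightarrow> (real \<Rightarrow> real^'n::finite \<Rightarrow> complex) \<Rightarrow> real \<Rightarrow> real^'n \<Rightarrow> complex^'n" where
  "grad_y_R_tilde_0 hbar \<psi> t x =
     (\<chi> j. of_real (hbar / 2) *
        (cnj (\<psi> t x) * weak_deriv j (\<psi> t) x - \<psi> t x * weak_deriv j (\<lambda>z. cnj (\<psi> t z)) x))"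

lemma R_tilde_has_derivative_0:
  assumes "(\<psi> t has_derivative D) (at x)"
  shows "(R_tilde hbar \<psi> t x has_derivative
           (\<lambda>y. of_real (hbar / 2) * (cnj (\<psi> t x) * D y - \<psi> t x * cnj (D y)))) (at 0)"
proof -
  have lin: "linear D"
    using assms by (rule has_derivative_linear)
  have p: "((\<lambda>y. \<psi> t (x + (hbar / 2) *\<^sub>R y)) has_derivative (\<lambda>y. D ((hbar / 2) *\<^sub>R y))) (at 0)"
    by (rule has_derivative_compose[where g = "\<psi> t" and g' = D and f = "\<lambda>y. x + (hbar / 2) *\<^sub>R y"])
       (use assms in \<open>auto intro!: derivative_eq_intros\<close>)
  have q: "((\<lambda>y. \<psi> t (x - (hbar / 2) *\<^sub>R y)) has_derivative (\<lambda>y. D (- ((hbar / 2) *\<^sub>R y)))) (at 0)"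
    by (rule has_derivative_compose[where g = "\<psi> t" and g' = D and f = "\<lambda>y. x - (hbar / 2) *\<^sub>R y"])
       (use assms in \<open>auto intro!: derivative_eq_intros\<close>)
  have D: "D ((hbar / 2) *\<^sub>R y) = of_real (hbar / 2) * D y"
          "D (- ((hbar / 2) *\<^sub>R y)) = - (of_real (hbar / 2) * D y)" for y
    by (simp_all only: linear_cmul[OF lin] linear_neg[OF lin] scaleR_conv_of_real[where 'a = complex])
  show ?thesis
    unfolding R_tilde_def
    using has_derivative_mult[OF p[unfolded D] has_derivative_cnj[OF q[unfolded D]]]
    by (rule has_derivative_eq_rhs) (auto simp: algebra_simps)
qed

text \<open>The quotient below is real almost everywhere, so taking real parts loses nothing.\<close>

definition velocity ::
    "real \<Rightarrow> real \<Rightarrow> (real \<Rightarrow> real^'n::finite \<Rightarrow> complex) \<Rightarrow> real \<Rightarrow> real^'n \<Rightarrow> real^'n" where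
  "velocity hbar m \<psi> t x =
     (if mass_density \<psi> t x > 0
      then (\<chi> j. Re (- \<i> * (grad_y_R_tilde_0 hbar \<psi> t x $ j) / (of_real m * R_tilde hbar \<psi> t x 0)))
      else 0)"


section \<open>Madelung's system\<close>

text \<open>
  The conjuncts before the two equations say that the square root of the density has a weak
  gradient and that all products occurring in the equations define distributions.
\<close>

definition madelung_system ::
    "real \<Rightarrow> real \<Rightarrow> real \<Rightarrow> (real^'n::finite \<Rightarrow> real) \<Rightarrow> (real \<Rightarrow> real^'n \<Rightarrow> real)
      \<Rightarrow> (real \<Rightarrow> real^'n \<Rightarrow> real^'n) \<Rightarrow> bool" where
  "madelung_system hbar m \<tau> V \<rho> u \<longleftrightarrow>
    (let dsqrt = (\<lambda>j t. weak_deriv j (\<lambda>x. sqrt (\<rho> t x)));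
         \<rho>u = (\<lambda>k t x. \<rho> t x * u t x $ k);
         \<rho>uu = (\<lambda>j k t x. \<rho> t x * (u t x $ j * u t x $ k));
         dsqrt2 = (\<lambda>j k t x. dsqrt j t x * dsqrt k t x);
         force = (\<lambda>k t x. \<rho> t x * weak_deriv k V x)
     in (\<forall>t\<in>{0..<\<tau>}. \<forall>j. weakly_diff j (\<lambda>x. sqrt (\<rho> t x)))
      \<and> distr_defined \<tau> \<rho>
      \<and> (\<forall>k. distr_defined \<tau> (\<rho>u k) \<and> distr_defined \<tau> (force k))
      \<and> (\<forall>j k. distr_defined \<tau> (\<rho>uu j k) \<and> distr_defined \<tau> (dsqrt2 j k))
      \<and> (\<forall>\<phi>. test_fun ({..<\<tau>} \<times> UNIV) \<phi> \<longrightarrow>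
           D_t \<tau> \<rho> \<phi> + (\<Sum>j\<in>UNIV. D_x j (distr_of \<tau> (\<rho>u j)) \<phi>) = 0)
      \<and> (\<forall>k. \<forall>\<phi>. test_fun ({..<\<tau>} \<times> UNIV) \<phi> \<longrightarrow>
           D_t \<tau> (\<rho>u k) \<phi> + (\<Sum>j\<in>UNIV. D_x j (distr_of \<tau> (\<rho>uu j k)) \<phi>) =
             hbar\<^sup>2 / (4 * m\<^sup>2) *
               (\<Sum>j\<in>UNIV. D_x j (\<lambda>\<eta>. D_x j (D_x k (distr_of \<tau> \<rho>)) \<eta>
                                     - 4 * distr_of \<tau> (dsqrt2 j k) \<eta>) \<phi>)
             - 1 / m * distr_of \<tau> (force k) \<phi>))"

end

theory Submission
  imports Defs "HOL-Computational_Algebra.Polynomial"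
begin

text \<open>
  Write \<open>\<psi> = a + \<i> b\<close> with \<open>a\<close>, \<open>b\<close> real. Then \<open>\<rho> = a\<^sup>2 + b\<^sup>2\<close>, and the momentum
  \<open>\<rho> u\<^sub>k = (hbar / m) (a b\<^sub>k - b a\<^sub>k)\<close> makes sense without dividing by \<open>\<rho>\<close>; indices denote weak partial
  derivatives. With \<open>r\<^sub>j = \<partial>\<^sub>j sqrt \<rho>\<close>, wherever \<open>\<psi> \<noteq> 0\<close>,

    \<open>\<rho> u\<^sub>j u\<^sub>k + (hbar / m)\<^sup>2 r\<^sub>j r\<^sub>k = (hbar / m)\<^sup>2 (a\<^sub>j a\<^sub>k + b\<^sub>j b\<^sub>k)\<close>,

  so that both equations become statements about products of two square integrable functions.

  The Schroedinger equation says \<open>a\<^sub>t = - (hbar / 2 m) \<Delta> b + V b / hbar\<close> and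
  \<open>b\<^sub>t = (hbar / 2 m) \<Delta> a - V a / hbar\<close>. Its right-hand sides are continuous curves in \<open>L\<^sup>2\<close>, hence
  \<open>a\<close> and \<open>b\<close> are differentiable curves in \<open>L\<^sup>2\<close> (\<open>weak_derivative_imp_derivative\<close>,
  \<open>weak_imp_strong_vector_derivative\<close>, \<open>time_derivatives\<close>). For a test function \<open>\<phi>\<close> the functions
  \<open>\<integral> \<phi> \<rho> dx\<close> and \<open>\<integral> \<phi> \<rho> u\<^sub>k dx\<close> of time are then differentiable. In the second one the derivative that
  falls on \<open>b\<^sub>k\<close> or \<open>a\<^sub>k\<close> is first moved away by integration by parts
  (\<open>wip_weak_deriv_has_real_derivative\<close>). The time derivatives are identified by integration by parts in
  space only (\<open>mass_balance\<close>, \<open>momentum_balance\<close>); the quantum pressure comes from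

    \<open>- f\<^sub>j\<^sub>j f\<^sub>k + \<partial>\<^sub>k (f f\<^sub>j\<^sub>j) / 2 = - \<partial>\<^sub>j (f\<^sub>j f\<^sub>k) + \<partial>\<^sub>j \<partial>\<^sub>j \<partial>\<^sub>k (f\<^sup>2) / 4\<close>,

  applied to \<open>f = a\<close> and \<open>f = b\<close> (\<open>stress_identity\<close>). Integrating over \<open>[0, \<tau>)\<close> gives the two equations.

  Integration by parts in \<open>H\<^sup>1\<close> does not use mollifiers. By density of test functions in \<open>L\<^sup>2\<close>
  (\<open>closure_test_classes\<close>), the translates \<open>f(x + s v)\<close> of a function with weak derivative
  \<open>f\<^sub>v\<close> form a curve in \<open>L\<^sup>2\<close> that is differentiable at \<open>s = 0\<close> with derivative
  \<open>f\<^sub>v\<close> (\<open>wd_has_vector_derivative\<close>). As the inner product of \<open>f(x + s v)\<close> and \<open>h(x + s v)\<close> does not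
  depend on \<open>s\<close>, its derivative \<open>\<integral> f\<^sub>v h + \<integral> f h\<^sub>v\<close> is zero.

  The assumption that \<open>\<psi>\<close> vanishes almost nowhere at positive times is used for the displayed identity and for
  the continuity of \<open>r\<^sub>j\<close> in time (\<open>sgn_pairing_tendsto\<close>), which makes the time integrals of
  \<open>r\<^sub>j r\<^sub>k\<close> meaningful.
\<close>

section \<open>Smooth functions of compact support\<close>

lemma dir_deriv_eq: "(f has_derivative f') (at x) \<Longrightarrow> dir_deriv v f x = f' v"
  unfolding dir_deriv_def by (metis frechet_derivative_at)

lemma has_derivative_dir_deriv:
  "f differentiable (at x) \<Longrightarrow> (f has_derivative (\<lambda>v. dir_deriv v f x)) (at x)"
  unfolding dir_deriv_def by (metis frechet_derivative_works)

lemma dir_deriv_add: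
  "f differentiable (at x) \<Longrightarrow> g differentiable (at x) \<Longrightarrow>
    dir_deriv v (\<lambda>x. f x + g x) x = dir_deriv v f x + dir_deriv v g x"
  by (rule dir_deriv_eq) (auto intro!: derivative_eq_intros has_derivative_dir_deriv)

lemma dir_deriv_mult:
  "f differentiable (at x) \<Longrightarrow> g differentiable (at x) \<Longrightarrow>
    dir_deriv v (\<lambda>x. f x * g x) x = f x * dir_deriv v g x + dir_deriv v f x * g x"
  by (rule dir_deriv_eq) (auto intro!: derivative_eq_intros has_derivative_dir_deriv)

lemma dir_deriv_affine:
  assumes "bounded_linear L" "f differentiable (at (L x + c))"
  shows "dir_deriv v (\<lambda>x. f (L x + c)) x = dir_deriv (L v) f (L x + c)"
    and "(\<lambda>x. f (L x + c)) differentiable (at x)"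
proof -
  have 1: "((\<lambda>x. L x + c) has_derivative L) (at x)"
    using assms(1) by (auto intro!: derivative_eq_intros bounded_linear_imp_has_derivative)
  have 2: "((\<lambda>x. f (L x + c)) has_derivative (\<lambda>v. dir_deriv (L v) f (L x + c))) (at x)"
    using has_derivative_compose[OF 1 has_derivative_dir_deriv[OF assms(2)]] .
  show "dir_deriv v (\<lambda>x. f (L x + c)) x = dir_deriv (L v) f (L x + c)"
    by (rule dir_deriv_eq[OF 2])
  show "(\<lambda>x. f (L x + c)) differentiable (at x)"
    using 2 by (auto simp: differentiable_def)
qed

lemma dir_deriv_basis_sum:
  assumes "f differentiable (at (x::'a::euclidean_space))"
  shows "dir_deriv v f x = (\<Sum>b\<in>Basis. (v \<bullet> b) * dir_deriv b f x)"
proof -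
  have lin: "linear (\<lambda>v. dir_deriv v f x)"
    using has_derivative_dir_deriv[OF assms] by (rule has_derivative_linear)
  have "dir_deriv v f x = dir_deriv (\<Sum>b\<in>Basis. (v \<bullet> b) *\<^sub>R b) f x"
    by (simp only: euclidean_representation)
  also have "\<dots> = (\<Sum>b\<in>Basis. (v \<bullet> b) * dir_deriv b f x)"
    using linear_sum[OF lin, of "\<lambda>b. (v \<bullet> b) *\<^sub>R b" Basis] by (simp add: linear_cmul[OF lin])
  finally show ?thesis .
qed

lemma Ck_Suc_imp_Ck: "Ck (Suc k) f \<Longrightarrow> Ck k f"
proof (induction k arbitrary: f)
  case 0
  then show ?case
    by (auto intro!: continuous_at_imp_continuous_on differentiable_imp_continuous_within)
next
  case (Suc k)
  then show ?case by (metis Ck.simps(2))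
qed

lemma Ck_const: "Ck k (\<lambda>x. c)"
proof (induction k arbitrary: c)
  case (Suc k)
  have "dir_deriv b (\<lambda>x. c) = (\<lambda>x. 0)" for b :: 'a
    by (rule ext, rule dir_deriv_eq) auto
  with Suc[of 0] show ?case by simp
qed auto

lemma Ck_add: "Ck k f \<Longrightarrow> Ck k g \<Longrightarrow> Ck k (\<lambda>x. f x + g x)"
proof (induction k arbitrary: f g)
  case (Suc k)
  have "dir_deriv b (\<lambda>x. f x + g x) = (\<lambda>x. dir_deriv b f x + dir_deriv b g x)" for b
    using Suc.prems by (intro ext dir_deriv_add) auto
  with Suc show ?case by (auto intro!: differentiable_add)
qed (auto intro!: continuous_intros)

lemma Ck_mult: "Ck k f \<Longrightarrow> Ck k g \<Longrightarrow> Ck k (\<lambda>x. f x * g x)"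
proof (induction k arbitrary: f g)
  case (Suc k)
  have "dir_deriv b (\<lambda>x. f x * g x) = (\<lambda>x. f x * dir_deriv b g x + dir_deriv b f x * g x)" for b
    using Suc.prems by (intro ext dir_deriv_mult) auto
  moreover have "Ck k (\<lambda>x. f x * dir_deriv b g x + dir_deriv b f x * g x)" if "b \<in> Basis" for b
    using Suc that Ck_Suc_imp_Ck[of k f] Ck_Suc_imp_Ck[of k g] by (intro Ck_add Suc.IH) auto
  ultimately show ?case using Suc.prems by (auto intro!: differentiable_mult)
qed (auto intro!: continuous_intros)

lemma Ck_sum: "(\<And>i. i \<in> I \<Longrightarrow> Ck k (f i)) \<Longrightarrow> Ck k (\<lambda>x. \<Sum>i\<in>I. f i x)"
  by (induction I rule: infinite_finite_induct) (auto intro: Ck_add Ck_const)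

lemma Ck_prod: "(\<And>i. i \<in> I \<Longrightarrow> Ck k (f i)) \<Longrightarrow> Ck k (\<lambda>x. \<Prod>i\<in>I. f i x)"
  by (induction I rule: infinite_finite_induct) (auto intro: Ck_mult Ck_const)

lemma Ck_dir_deriv:
  assumes "Ck (Suc k) f" shows "Ck k (dir_deriv v f)"
proof -
  have "dir_deriv v f = (\<lambda>x. \<Sum>b\<in>Basis. (v \<bullet> b) * dir_deriv b f x)"
    using assms by (intro ext dir_deriv_basis_sum) auto
  then show ?thesis
    using assms by (simp only:, intro Ck_sum Ck_mult Ck_const) simp
qed

lemma Ck_affine:
  fixes f :: "'a::euclidean_space \<Rightarrow> real" and L :: "'b::euclidean_space \<Rightarrow> 'a"
  assumes "bounded_linear L"
  shows "Ck k f \<Longrightarrow> Ck k (\<lambda>x. f (L x + c))"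
proof (induction k arbitrary: f)
  case 0
  have "continuous_on UNIV (\<lambda>x. L x + c)"
    using assms by (intro continuous_intros linear_continuous_on)
  then show ?case using 0 continuous_on_compose2[of UNIV f UNIV "\<lambda>x. L x + c"] by auto
next
  case (Suc k)
  have "dir_deriv b (\<lambda>x. f (L x + c)) = (\<lambda>x. dir_deriv (L b) f (L x + c))" for b
    using Suc.prems assms by (intro ext dir_deriv_affine) auto
  moreover have "Ck k (\<lambda>x. dir_deriv (L b) f (L x + c))" for b
    by (rule Suc.IH) (rule Ck_dir_deriv[OF Suc.prems])
  ultimately show ?case
    using Suc.prems assms dir_deriv_affine(2)[OF assms] by auto
qed

lemma Ck_real_Suc:
  fixes g :: "real \<Rightarrow> real"
  assumes "\<And>x. (g has_real_derivative g' x) (at x)" "Ck k g'"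
  shows "Ck (Suc k) g"
proof -
  have "dir_deriv 1 g x = g' x" for x
    using dir_deriv_eq[OF assms(1)[of x, unfolded has_field_derivative_def], of 1] by simp
  then have "dir_deriv 1 g = g'" by blast
  moreover have "g differentiable (at x)" for x
    using assms(1)[of x] unfolding real_differentiable_def by blast
  ultimately show ?thesis
    using assms(2) by simp
qed

text \<open>The functions \<open>p(1/x) e\<^bsup>-1/x\<^esup>\<close>, extended by \<open>0\<close> to \<open>x \<le> 0\<close>, with \<open>p\<close> a polynomial. This
  class is closed under differentiation, so its members are smooth.\<close>

definition flat :: "real poly \<Rightarrow> real \<Rightarrow> real" where
  "flat p x = (if x > 0 then poly p (1 / x) * exp (- (1 / x)) else 0)"

lemma poly_exp_tendsto_0: "((\<lambda>y. poly p y * exp (- y)) \<longlongrightarrow> (0::real)) at_top"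
proof -
  have "((\<lambda>y::real. \<Sum>i\<le>degree p. coeff p i * (y ^ i / exp y)) \<longlongrightarrow> (\<Sum>i\<le>degree p. coeff p i * 0)) at_top"
    by (intro tendsto_intros tendsto_power_div_exp_0)
  then show ?thesis
    by (simp add: poly_altdef sum_distrib_right exp_minus divide_inverse mult.assoc)
qed

lemma flat_right_tendsto_0: "(flat p \<longlongrightarrow> 0) (at_right 0)"
proof (rule Lim_transform_eventually)
  show "((\<lambda>x. poly p (inverse x) * exp (- inverse x)) \<longlongrightarrow> 0) (at_right 0)"
    by (rule filterlim_compose[OF poly_exp_tendsto_0 filterlim_inverse_at_top_right])
  show "\<forall>\<^sub>F x in at_right 0. poly p (inverse x) * exp (- inverse x) = flat p x"
    unfolding eventually_at_filter
    by (rule always_eventually) (auto simp: flat_def inverse_eq_divide)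
qed

lemma flat_has_derivative:
  "(flat p has_real_derivative flat (monom 1 2 * (p - pderiv p)) x) (at x)"
proof -
  consider "x > 0" | "x < 0" | "x = 0" by linarith
  then show ?thesis
  proof cases
    case 1
    have "((\<lambda>x. poly p (1 / x) * exp (- (1 / x))) has_real_derivative flat (monom 1 2 * (p - pderiv p)) x) (at x)"
      using 1 by (auto intro!: derivative_eq_intros DERIV_chain2[OF poly_DERIV]
          simp: flat_def poly_monom field_simps power2_eq_square)
    then show ?thesis
      by (rule has_field_derivative_transform_within_open[of _ _ _ "{0<..}"])
         (use 1 in \<open>auto simp: flat_def\<close>)
  next
    case 2
    have "((\<lambda>x. 0) has_real_derivative flat (monom 1 2 * (p - pderiv p)) x) (at x)"
      using 2 by (auto simp: flat_def)
    then show ?thesis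
      by (rule has_field_derivative_transform_within_open[of _ _ _ "{..<0}"])
         (use 2 in \<open>auto simp: flat_def\<close>)
  next
    case 3
    have "((\<lambda>h. (flat p h - flat p 0) / (h - 0)) \<longlongrightarrow> 0) (at_right 0)"
    proof (rule Lim_transform_eventually[OF flat_right_tendsto_0[of "monom 1 1 * p"]])
      show "\<forall>\<^sub>F x in at_right 0. flat (monom 1 1 * p) x = (flat p x - flat p 0) / (x - 0)"
        unfolding eventually_at_filter
        by (rule always_eventually) (auto simp: flat_def poly_monom)
    qed
    moreover have "((\<lambda>h. (flat p h - flat p 0) / (h - 0)) \<longlongrightarrow> 0) (at_left 0)"
    proof (rule Lim_transform_eventually[OF tendsto_const])
      show "\<forall>\<^sub>F x in at_left (0::real). 0 = (flat p x - flat p 0) / (x - 0)"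
        unfolding eventually_at_filter by (rule always_eventually) (simp add: flat_def)
    qed
    ultimately show ?thesis
      using 3 by (simp add: has_field_derivative_iff filterlim_at_split flat_def)
  qed
qed

lemma Ck_flat: "Ck k (flat p)"
proof (induction k arbitrary: p)
  case 0
  then show ?case
    using flat_has_derivative by (auto intro!: continuous_at_imp_continuous_on intro: DERIV_isCont)
next
  case (Suc k)
  show ?case by (rule Ck_real_Suc[OF flat_has_derivative Suc])
qed

lemma flat_bounds: "0 \<le> flat 1 x" "flat 1 x \<le> 1" "x \<le> 0 \<Longrightarrow> flat 1 x = 0" "x > 0 \<Longrightarrow> flat 1 x > 0"
  by (auto simp: flat_def)

lemma flat_tendsto_1: "x > 0 \<Longrightarrow> (\<lambda>n. flat 1 (real n * x)) \<longlonglongrightarrow> 1"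
proof -
  assume x: "x > 0"
  have "(\<lambda>n. exp (- (inverse (real n) * inverse x))) \<longlonglongrightarrow> exp (- (0 * inverse x))"
    by (intro tendsto_intros LIMSEQ_inverse_real_of_nat_add tendsto_exp lim_inverse_n)
  moreover have "\<forall>\<^sub>F n in sequentially. exp (- (inverse (real n) * inverse x)) = flat 1 (real n * x)"
    using eventually_gt_at_top[of "0::nat"]
    by eventually_elim (use x in \<open>auto simp: flat_def field_simps\<close>)
  ultimately show ?thesis using Lim_transform_eventually by force
qed

text \<open>A sequence of smooth functions with values in \<open>[0,1]\<close> that converges pointwise to the
  indicator function of an open box.\<close>

definition box_bump :: "nat \<Rightarrow> 'a \<Rightarrow> 'a \<Rightarrow> 'a::euclidean_space \<Rightarrow> real" where
  "box_bump n a b x = (\<Prod>i\<in>Basis. flat 1 (real n * (x \<bullet> i - a \<bullet> i)) * flat 1 (real n * (b \<bullet> i - x \<bullet> i)))"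

lemma box_bump_bounds: "0 \<le> box_bump n a b x" "box_bump n a b x \<le> 1"
  unfolding box_bump_def
  by (auto intro!: prod_nonneg prod_le_1 mult_nonneg_nonneg mult_le_one simp: flat_bounds)

lemma box_bump_outside: "x \<notin> box a b \<Longrightarrow> box_bump n a b x = 0"
  unfolding box_bump_def mem_box
  by (auto simp: prod_zero_iff not_less intro!: bexI flat_bounds(3) mult_nonneg_nonpos)

lemma box_bump_pos: "x \<in> box a b \<Longrightarrow> n > 0 \<Longrightarrow> box_bump n a b x > 0"
  unfolding box_bump_def mem_box
  by (auto intro!: prod_pos mult_pos_pos flat_bounds(4))

lemma box_bump_tendsto: "(\<lambda>n. box_bump n a b x) \<longlonglongrightarrow> indicator (box a b) x"
proof (cases "x \<in> box a b")
  case True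
  have "(\<lambda>n. box_bump n a b x) \<longlonglongrightarrow> (\<Prod>i\<in>(Basis::'a set). 1 * 1)"
    unfolding box_bump_def using True
    by (intro tendsto_prod tendsto_mult flat_tendsto_1) (auto simp: mem_box)
  with True show ?thesis by simp
qed (simp add: box_bump_outside)

lemma Ck_box_bump: "Ck k (box_bump n a b)"
proof -
  have 1: "Ck k (\<lambda>x. flat 1 (real n * (x \<bullet> i - a \<bullet> i)))" for i
    using Ck_affine[of "\<lambda>x. real n * (x \<bullet> i)" k "flat 1" "- real n * (a \<bullet> i)"] Ck_flat
    by (simp add: algebra_simps bounded_linear_const_mult bounded_linear_inner_left)
  have 2: "Ck k (\<lambda>x. flat 1 (real n * (b \<bullet> i - x \<bullet> i)))" for i
    using Ck_affine[of "\<lambda>x. (- real n) * (x \<bullet> i)" k "flat 1" "real n * (b \<bullet> i)"] Ck_flat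
    by (simp add: algebra_simps bounded_linear_const_mult bounded_linear_inner_left bounded_linear_minus)
  show ?thesis
    unfolding box_bump_def by (intro Ck_prod Ck_mult 1 2)
qed

lemma test_funI:
  assumes "\<And>k. Ck k \<phi>" "compact K" "K \<subseteq> \<Omega>" "\<And>x. x \<notin> K \<Longrightarrow> \<phi> x = 0"
  shows "test_fun \<Omega> \<phi>"
proof -
  have "closure {x. \<phi> x \<noteq> 0} \<subseteq> K"
    using assms by (intro closure_minimal) (auto intro: compact_imp_closed)
  then have "compact (closure {x. \<phi> x \<noteq> 0})" "closure {x. \<phi> x \<noteq> 0} \<subseteq> \<Omega>"
    using assms(2,3) compact_Int_closed[of K "closure {x. \<phi> x \<noteq> 0}"] by (auto simp: Int_absorb1)
  then show ?thesis
    using assms(1) unfolding test_fun_def by blast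
qed

lemma test_fun_supportE:
  assumes "test_fun \<Omega> \<phi>"
  obtains K where "compact K" "K \<subseteq> \<Omega>" "\<And>x. x \<notin> K \<Longrightarrow> \<phi> x = 0"
  using assms closure_subset[of "{x. \<phi> x \<noteq> 0}"] unfolding test_fun_def by blast

lemma test_fun_Ck: "test_fun \<Omega> \<phi> \<Longrightarrow> Ck k \<phi>"
  by (simp add: test_fun_def)

lemma test_fun_differentiable: "test_fun \<Omega> \<phi> \<Longrightarrow> \<phi> differentiable (at x)"
  using test_fun_Ck[of \<Omega> \<phi> 1] by simp

lemma test_fun_continuous: "test_fun \<Omega> \<phi> \<Longrightarrow> continuous_on S \<phi>"
  using test_fun_Ck[of \<Omega> \<phi> 0] continuous_on_subset by auto

lemma dir_deriv_zero_outside: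
  assumes "closed K" "\<And>x. x \<notin> K \<Longrightarrow> f x = 0" "x \<notin> K"
  shows "dir_deriv v f x = 0"
proof -
  have "(f has_derivative (\<lambda>v. 0)) (at x)"
    by (rule has_derivative_transform_within_open[of "\<lambda>x. 0" _ x UNIV "- K"]) (use assms in auto)
  then show ?thesis by (rule dir_deriv_eq)
qed

lemma test_fun_dir_deriv:
  assumes "test_fun \<Omega> \<phi>" shows "test_fun \<Omega> (dir_deriv v \<phi>)"
proof -
  obtain K where K: "compact K" "K \<subseteq> \<Omega>" "\<And>x. x \<notin> K \<Longrightarrow> \<phi> x = 0"
    using test_fun_supportE[OF assms] by blast
  show ?thesis
    by (rule test_funI[OF Ck_dir_deriv[OF test_fun_Ck[OF assms]] K(1,2)])
       (rule dir_deriv_zero_outside[OF compact_imp_closed[OF K(1)] K(3)])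
qed

lemma test_fun_add:
  assumes "test_fun \<Omega> f" "test_fun \<Omega> g" shows "test_fun \<Omega> (\<lambda>x. f x + g x)"
proof -
  obtain K where K: "compact K" "K \<subseteq> \<Omega>" "\<And>x. x \<notin> K \<Longrightarrow> f x = 0"
    using test_fun_supportE[OF assms(1)] by blast
  obtain L where L: "compact L" "L \<subseteq> \<Omega>" "\<And>x. x \<notin> L \<Longrightarrow> g x = 0"
    using test_fun_supportE[OF assms(2)] by blast
  show ?thesis
    by (rule test_funI[OF Ck_add[OF assms[THEN test_fun_Ck]] compact_Un[OF K(1) L(1)]])
       (use K L in auto)
qed

lemma test_fun_mult:
  assumes "test_fun \<Omega> f" "\<And>k. Ck k g" shows "test_fun \<Omega> (\<lambda>x. f x * g x)"
proof -
  obtain K where K: "compact K" "K \<subseteq> \<Omega>" "\<And>x. x \<notin> K \<Longrightarrow> f x = 0"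
    using test_fun_supportE[OF assms(1)] by blast
  show ?thesis
    by (rule test_funI[OF Ck_mult[OF test_fun_Ck[OF assms(1)] assms(2)] K(1,2)]) (simp add: K)
qed

lemma test_fun_cmult: "test_fun \<Omega> f \<Longrightarrow> test_fun \<Omega> (\<lambda>x. c * f x)"
  using test_fun_mult[OF _ Ck_const, of \<Omega> f c] by (simp add: mult.commute)

lemma test_fun_box_bump: "test_fun UNIV (box_bump n a b)"
  by (rule test_funI[OF Ck_box_bump compact_cbox[of a b]])
     (use box_subset_cbox in \<open>auto intro!: box_bump_outside\<close>)

lemma test_fun_bounded:
  assumes "test_fun \<Omega> \<phi>" obtains C where "C \<ge> 0" "\<And>x. \<bar>\<phi> x\<bar> \<le> C"
proof -
  obtain K where K: "compact K" "K \<subseteq> \<Omega>" "\<And>x. x \<notin> K \<Longrightarrow> \<phi> x = 0"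
    using test_fun_supportE[OF assms(1)] by blast
  have "compact (\<phi> ` K)" by (rule compact_continuous_image[OF test_fun_continuous[OF assms] K(1)])
  then obtain C where "\<forall>x\<in>K. \<bar>\<phi> x\<bar> \<le> C"
    using compact_imp_bounded[of "\<phi> ` K"] by (auto simp: bounded_iff)
  then have "\<bar>\<phi> x\<bar> \<le> max 0 C" for x
    using K(3)[of x] by (cases "x \<in> K") (auto simp: le_max_iff_disj)
  then show ?thesis using that[of "max 0 C"] by simp
qed

section \<open>The real Hilbert space of square integrable functions\<close>

text \<open>Real-valued square integrable functions. Complex functions are treated by their real and imaginary parts.\<close>

definition L2fun :: "('a::euclidean_space \<Rightarrow> real) \<Rightarrow> bool" where
  "L2fun f \<longleftrightarrow> f \<in> borel_measurable lebesgue \<and> integrable lebesgue (\<lambda>x. (f x)\<^sup>2)"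

lemma L2fun_measurable [measurable_dest]: "L2fun f \<Longrightarrow> f \<in> borel_measurable lebesgue"
  by (simp add: L2fun_def)

lemma L2fun_integrable_sq: "L2fun f \<Longrightarrow> integrable lebesgue (\<lambda>x. (f x)\<^sup>2)"
  by (simp add: L2fun_def)

lemma L2fun_dominated:
  assumes "L2fun g" "f \<in> borel_measurable lebesgue" "AE x in lebesgue. \<bar>f x\<bar> \<le> C * \<bar>g x\<bar>"
  shows "L2fun f"
  unfolding L2fun_def
proof (intro conjI assms(2))
  have "integrable lebesgue (\<lambda>x. C\<^sup>2 * (g x)\<^sup>2)"
    using L2fun_integrable_sq[OF assms(1)] by simp
  then show "integrable lebesgue (\<lambda>x. (f x)\<^sup>2)"
  proof (rule Bochner_Integration.integrable_bound)
    show "AE x in lebesgue. norm ((f x)\<^sup>2) \<le> norm (C\<^sup>2 * (g x)\<^sup>2)"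
      using assms(3)
    proof eventually_elim
      case (elim x)
      then have "\<bar>f x\<bar>\<^sup>2 \<le> (C * \<bar>g x\<bar>)\<^sup>2" by (intro power_mono) auto
      then show ?case by (simp add: power_mult_distrib)
    qed
  qed (use assms(2) in measurable)
qed

lemma L2fun_mult_integrable:
  assumes "L2fun f" "L2fun g" shows "integrable lebesgue (\<lambda>x. f x * g x)"
proof (rule Bochner_Integration.integrable_bound)
  show "integrable lebesgue (\<lambda>x. (f x)\<^sup>2 + (g x)\<^sup>2)"
    using assms by (intro Bochner_Integration.integrable_add L2fun_integrable_sq)
  have "\<bar>a * b\<bar> \<le> a\<^sup>2 + b\<^sup>2" for a b :: real
    using sum_squares_bound[of "\<bar>a\<bar>" "\<bar>b\<bar>"] mult_nonneg_nonneg[of "\<bar>a\<bar>" "\<bar>b\<bar>"]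
    unfolding abs_mult power2_abs mult.assoc by linarith
  then show "AE x in lebesgue. norm (f x * g x) \<le> norm ((f x)\<^sup>2 + (g x)\<^sup>2)"
    by (intro always_eventually) (simp add: abs_of_nonneg)
qed (use assms L2fun_measurable in measurable)

lemma L2fun_zero: "L2fun (\<lambda>x. 0)"
  by (simp add: L2fun_def)

lemma L2fun_add:
  assumes "L2fun f" "L2fun g" shows "L2fun (\<lambda>x. f x + g x)"
proof -
  have "integrable lebesgue (\<lambda>x. (f x)\<^sup>2 + (g x)\<^sup>2 + 2 * (f x * g x))"
    using assms by (intro Bochner_Integration.integrable_add L2fun_integrable_sq
        integrable_mult_right L2fun_mult_integrable)
  moreover have "(\<lambda>x. f x + g x) \<in> borel_measurable lebesgue"
    using assms L2fun_measurable by measurable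
  ultimately show ?thesis by (simp add: L2fun_def power2_sum mult.assoc)
qed

lemma L2fun_cmult: "L2fun f \<Longrightarrow> L2fun (\<lambda>x. c * f x)"
  by (auto simp: L2fun_def power_mult_distrib)

lemma L2fun_minus: "L2fun f \<Longrightarrow> L2fun (\<lambda>x. - f x)"
  using L2fun_cmult[of f "-1"] by simp

lemma L2fun_diff: "L2fun f \<Longrightarrow> L2fun g \<Longrightarrow> L2fun (\<lambda>x. f x - g x)"
  using L2fun_add[of f "\<lambda>x. - g x"] L2fun_minus[of g] by simp

lemma L2fun_sum: "(\<And>i. i \<in> I \<Longrightarrow> L2fun (f i)) \<Longrightarrow> L2fun (\<lambda>x. \<Sum>i\<in>I. f i x)"
  by (induction I rule: infinite_finite_induct) (auto intro: L2fun_zero L2fun_add)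

lemma L2fun_bounded_mult:
  assumes "L2fun f" "b \<in> borel_measurable lebesgue" "AE x in lebesgue. \<bar>b x\<bar> \<le> C"
  shows "L2fun (\<lambda>x. b x * f x)"
proof (rule L2fun_dominated[OF assms(1)])
  show "(\<lambda>x. b x * f x) \<in> borel_measurable lebesgue"
    using assms(1,2) L2fun_measurable by measurable
  show "AE x in lebesgue. \<bar>b x * f x\<bar> \<le> C * \<bar>f x\<bar>"
    using assms(3) by eventually_elim (simp add: abs_mult mult_right_mono)
qed

text \<open>Equality almost everywhere between square integrable functions: a partial equivalence relation, whose
  domain consists of the square integrable functions.\<close>

definition L2rel :: "('a::euclidean_space \<Rightarrow> real) \<Rightarrow> ('a \<Rightarrow> real) \<Rightarrow> bool" where
  "L2rel f g \<longleftrightarrow> L2fun f \<and> L2fun g \<and> (AE x in lebesgue. f x = g x)"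

text \<open>Square integrable functions modulo equality almost everywhere.\<close>

quotient_type (overloaded) 'a l2 = "'a::euclidean_space \<Rightarrow> real" / partial: L2rel
proof (rule part_equivpI)
  show "\<exists>f::'a \<Rightarrow> real. L2rel f f" by (auto simp: L2rel_def intro: L2fun_zero)
  show "symp (L2rel :: ('a \<Rightarrow> real) \<Rightarrow> _)" by (auto simp: symp_def L2rel_def eq_commute)
  show "transp (L2rel :: ('a \<Rightarrow> real) \<Rightarrow> _)"
    unfolding transp_def L2rel_def by (auto elim: eventually_elim2)
qed

lemma L2rel_integral:
  assumes "L2rel f f'" "L2rel g g'"
  shows "(LINT x|lebesgue. f x * g x) = (LINT x|lebesgue. f' x * g' x)"
proof (rule integral_cong_AE)
  have "AE x in lebesgue. f x = f' x" "AE x in lebesgue. g x = g' x"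
    using assms by (auto simp: L2rel_def)
  then show "AE x in lebesgue. f x * g x = f' x * g' x" by eventually_elim simp
qed (use assms in \<open>simp_all add: L2rel_def borel_measurable_times L2fun_measurable\<close>)

instantiation l2 :: (euclidean_space) real_vector
begin

lift_definition zero_l2 :: "'a l2" is "\<lambda>x. 0" by (simp add: L2rel_def L2fun_zero)

lift_definition plus_l2 :: "'a l2 \<Rightarrow> 'a l2 \<Rightarrow> 'a l2" is "\<lambda>f g x. f x + g x"
  unfolding L2rel_def by (auto intro: L2fun_add elim: eventually_elim2)

lift_definition minus_l2 :: "'a l2 \<Rightarrow> 'a l2 \<Rightarrow> 'a l2" is "\<lambda>f g x. f x - g x"
  unfolding L2rel_def by (auto intro: L2fun_diff elim: eventually_elim2)

lift_definition uminus_l2 :: "'a l2 \<Rightarrow> 'a l2" is "\<lambda>f x. - f x"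
  unfolding L2rel_def by (auto intro: L2fun_minus elim: eventually_mono)

lift_definition scaleR_l2 :: "real \<Rightarrow> 'a l2 \<Rightarrow> 'a l2" is "\<lambda>c f x. c * f x"
  unfolding L2rel_def by (auto intro: L2fun_cmult elim: eventually_mono)

instance
proof
  fix f g h :: "'a l2" and c d :: real
  show "f + g + h = f + (g + h)" by transfer (simp add: L2rel_def L2fun_add add.assoc)
  show "f + g = g + f" by transfer (simp add: L2rel_def L2fun_add add.commute)
  show "0 + f = f" by transfer (simp add: L2rel_def)
  show "- f + f = 0" by transfer (simp add: L2rel_def L2fun_zero)
  show "f - g = f + - g" by transfer (simp add: L2rel_def L2fun_diff)
  show "c *\<^sub>R (f + g) = c *\<^sub>R f + c *\<^sub>R g"
    by transfer (simp add: L2rel_def L2fun_cmult L2fun_add distrib_left)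
  show "(c + d) *\<^sub>R f = c *\<^sub>R f + d *\<^sub>R f"
    by transfer (simp add: L2rel_def L2fun_cmult L2fun_add distrib_right)
  show "c *\<^sub>R d *\<^sub>R f = (c * d) *\<^sub>R f"
    by transfer (simp add: L2rel_def L2fun_cmult mult.assoc)
  show "1 *\<^sub>R f = f" by transfer (simp add: L2rel_def)
qed

end

instantiation l2 :: (euclidean_space) real_inner
begin

lift_definition inner_l2 :: "'a l2 \<Rightarrow> 'a l2 \<Rightarrow> real" is "\<lambda>f g. LINT x|lebesgue. f x * g x"
  by (rule L2rel_integral)

definition norm_l2 :: "'a l2 \<Rightarrow> real" where "norm_l2 f = sqrt (f \<bullet> f)"

definition sgn_l2 :: "'a l2 \<Rightarrow> 'a l2" where "sgn_l2 f = f /\<^sub>R norm f"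

definition dist_l2 :: "'a l2 \<Rightarrow> 'a l2 \<Rightarrow> real" where "dist_l2 f g = norm (f - g)"

definition uniformity_l2 :: "('a l2 \<times> 'a l2) filter" where
  "uniformity_l2 = (INF e\<in>{0 <..}. principal {(x, y). dist x y < e})"

definition open_l2 :: "'a l2 set \<Rightarrow> bool" where
  "open_l2 S = (\<forall>x\<in>S. \<forall>\<^sub>F (x', y) in uniformity. x' = x \<longrightarrow> y \<in> S)"

instance
proof
  fix f g h :: "'a l2" and c d :: real
  show "f \<bullet> g = g \<bullet> f" by transfer (simp add: mult.commute)
  show "(f + g) \<bullet> h = f \<bullet> h + g \<bullet> h"
    by transfer (simp add: L2rel_def distrib_right L2fun_mult_integrable)
  show "c *\<^sub>R f \<bullet> g = c * (f \<bullet> g)"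
    by transfer (simp add: L2rel_def mult.assoc)
  show "0 \<le> f \<bullet> f" by transfer simp
  show "f \<bullet> f = 0 \<longleftrightarrow> f = 0"
  proof transfer
    fix f :: "'a \<Rightarrow> real" assume f: "L2rel f f"
    then have "(LINT x|lebesgue. f x * f x) = 0 \<longleftrightarrow> (AE x in lebesgue. f x * f x = 0)"
      by (intro integral_nonneg_eq_0_iff_AE) (auto simp: L2rel_def L2fun_mult_integrable)
    with f show "(LINT x|lebesgue. f x * f x) = 0 \<longleftrightarrow> L2rel f (\<lambda>x. 0)"
      by (simp add: L2rel_def L2fun_zero)
  qed
qed (rule norm_l2_def sgn_l2_def dist_l2_def uniformity_l2_def open_l2_def)+

end

text \<open>The class of a square integrable function; on other functions the value is unspecified.\<close>

definition cls :: "('a::euclidean_space \<Rightarrow> real) \<Rightarrow> 'a l2" where "cls f = abs_l2 f"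

lemma L2rel_refl: "L2fun f \<Longrightarrow> L2rel f f"
  by (simp add: L2rel_def)

lemma cls_exhaust: obtains f where "L2fun f" "F = cls f"
proof
  show "L2fun (rep_l2 F)"
    using Quotient3_rep_reflp[OF Quotient3_l2, of F] by (simp add: L2rel_def)
  show "F = cls (rep_l2 F)"
    by (simp add: cls_def Quotient3_abs_rep[OF Quotient3_l2])
qed

lemma cls_eq_iff: "L2fun f \<Longrightarrow> L2fun g \<Longrightarrow> cls f = cls g \<longleftrightarrow> (AE x in lebesgue. f x = g x)"
  unfolding cls_def using Quotient3_rel[OF Quotient3_l2, of f g] by (auto simp: L2rel_def)

lemma cls_zero: "cls (\<lambda>x. 0) = 0"
  by (simp add: cls_def zero_l2_def)

lemma cls_add: "L2fun f \<Longrightarrow> L2fun g \<Longrightarrow> cls (\<lambda>x. f x + g x) = cls f + cls g"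
  unfolding cls_def by (simp add: plus_l2.abs_eq L2rel_refl)

lemma cls_diff: "L2fun f \<Longrightarrow> L2fun g \<Longrightarrow> cls (\<lambda>x. f x - g x) = cls f - cls g"
  unfolding cls_def by (simp add: minus_l2.abs_eq L2rel_refl)

lemma cls_cmult: "L2fun f \<Longrightarrow> cls (\<lambda>x. c * f x) = c *\<^sub>R cls f"
  unfolding cls_def by (simp add: scaleR_l2.abs_eq L2rel_refl)

lemma cls_sum: "(\<And>i. i \<in> I \<Longrightarrow> L2fun (f i)) \<Longrightarrow> cls (\<lambda>x. \<Sum>i\<in>I. f i x) = (\<Sum>i\<in>I. cls (f i))"
  by (induction I rule: infinite_finite_induct) (auto simp: cls_zero cls_add L2fun_sum)

lemma inner_cls: "L2fun f \<Longrightarrow> L2fun g \<Longrightarrow> cls f \<bullet> cls g = (LINT x|lebesgue. f x * g x)"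
  unfolding cls_def by (simp add: inner_l2.abs_eq L2rel_refl)

lemma power2_norm_cls: "L2fun f \<Longrightarrow> (norm (cls f))\<^sup>2 = (LINT x|lebesgue. (f x)\<^sup>2)"
  by (simp add: power2_norm_eq_inner inner_cls) (simp add: power2_eq_square)

lemma norm_cls_mono:
  assumes "L2fun f" "L2fun g" "AE x in lebesgue. \<bar>f x\<bar> \<le> C * \<bar>g x\<bar>" "C \<ge> 0"
  shows "norm (cls f) \<le> C * norm (cls g)"
proof -
  have "(LINT x|lebesgue. (f x)\<^sup>2) \<le> (LINT x|lebesgue. C\<^sup>2 * (g x)\<^sup>2)"
  proof (rule integral_mono_AE)
    show "AE x in lebesgue. (f x)\<^sup>2 \<le> C\<^sup>2 * (g x)\<^sup>2"
      using assms(3)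
    proof eventually_elim
      case (elim x)
      then have "\<bar>f x\<bar>\<^sup>2 \<le> (C * \<bar>g x\<bar>)\<^sup>2" by (intro power_mono) auto
      then show ?case by (simp add: power_mult_distrib)
    qed
  qed (use assms in \<open>auto intro: L2fun_integrable_sq\<close>)
  also have "\<dots> = C\<^sup>2 * (LINT x|lebesgue. (g x)\<^sup>2)" by simp
  finally have "(norm (cls f))\<^sup>2 \<le> (C * norm (cls g))\<^sup>2"
    using assms by (simp add: power2_norm_cls power_mult_distrib)
  then show ?thesis
    by (rule power2_le_imp_le) (use assms(4) in simp)
qed

text \<open>Dominated convergence in \<open>L\<^sup>2\<close>.\<close>

lemma cls_tendsto:
  assumes f: "\<And>n. L2fun (f n)" "L2fun g" "L2fun w"
    and lim: "AE x in lebesgue. (\<lambda>n. f n x) \<longlonglongrightarrow> g x"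
    and dom: "\<And>n. AE x in lebesgue. \<bar>f n x\<bar> \<le> \<bar>w x\<bar>"
  shows "(\<lambda>n. cls (f n)) \<longlonglongrightarrow> cls g"
proof -
  have m: "f n \<in> borel_measurable lebesgue" "g \<in> borel_measurable lebesgue" for n
    using f by (auto intro: L2fun_measurable)
  have "AE x in lebesgue. \<forall>n. \<bar>f n x\<bar> \<le> \<bar>w x\<bar>"
    using dom by (simp add: AE_all_countable)
  then have gw: "AE x in lebesgue. \<bar>g x\<bar> \<le> \<bar>w x\<bar>"
    using lim by eventually_elim (rule Lim_bounded[OF tendsto_rabs], auto)
  have "(\<lambda>n. LINT x|lebesgue. (f n x - g x)\<^sup>2) \<longlonglongrightarrow> (LINT x::'a|lebesgue. 0)"
  proof (rule integral_dominated_convergence)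
    show "integrable lebesgue (\<lambda>x. 4 * (w x)\<^sup>2)" using L2fun_integrable_sq[OF f(3)] by simp
    show "AE x in lebesgue. (\<lambda>n. (f n x - g x)\<^sup>2) \<longlonglongrightarrow> 0"
      using lim
    proof eventually_elim
      case (elim x)
      then have "(\<lambda>n. (f n x - g x)\<^sup>2) \<longlonglongrightarrow> (g x - g x)\<^sup>2" by (intro tendsto_intros)
      then show ?case by simp
    qed
    show "AE x in lebesgue. norm ((f n x - g x)\<^sup>2) \<le> 4 * (w x)\<^sup>2" for n
      using dom[of n] gw
    proof eventually_elim
      case (elim x)
      then have "\<bar>f n x - g x\<bar>\<^sup>2 \<le> (2 * \<bar>w x\<bar>)\<^sup>2" by (intro power_mono) auto
      then show ?case by (simp add: power_mult_distrib)
    qed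
  qed (use m in measurable)
  then have "(\<lambda>n. (norm (cls (f n) - cls g))\<^sup>2) \<longlonglongrightarrow> 0"
    using f by (simp add: power2_norm_cls L2fun_diff flip: cls_diff)
  from tendsto_real_sqrt[OF this] have "(\<lambda>n. norm (cls (f n) - cls g)) \<longlonglongrightarrow> 0" by simp
  then show ?thesis by (simp add: LIM_zero_iff tendsto_norm_zero_iff)
qed

lemma cls_cong:
  assumes "L2fun f" "g \<in> borel_measurable lebesgue" "AE x in lebesgue. f x = g x"
  shows "L2fun g" "cls f = cls g"
proof -
  show "L2fun g"
    by (rule L2fun_dominated[OF assms(1,2), of 1]) (use assms(3) in \<open>auto elim: eventually_mono\<close>)
  with assms show "cls f = cls g" by (simp add: cls_eq_iff)
qed

subsection \<open>Multiplication by bounded continuous functions\<close>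

lemma continuous_lebesgue_measurable:
  "continuous_on UNIV f \<Longrightarrow> f \<in> borel_measurable lebesgue"
  by (intro measurable_completion) (simp add: borel_measurable_continuous_onI)

lemma bcontfun_measurable: "apply_bcontfun b \<in> borel_measurable lebesgue"
  by (rule continuous_lebesgue_measurable) simp

lemma L2fun_bcontfun_mult:
  fixes b :: "'a::euclidean_space \<Rightarrow>\<^sub>C real"
  assumes "L2fun f" shows "L2fun (\<lambda>x. b x * f x)"
  by (rule L2fun_bounded_mult[OF assms bcontfun_measurable, of _ "norm b"])
     (use norm_bounded[of b] in auto)

text \<open>Multiplication by a bounded continuous function, applied to the representative that the quotient type
  provides; by \<open>mulC_cls\<close> the choice does not matter.\<close>

definition mulC :: "('a::euclidean_space \<Rightarrow>\<^sub>C real) \<Rightarrow> 'a l2 \<Rightarrow> 'a l2" where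
  "mulC b F = cls (\<lambda>x. b x * rep_l2 F x)"

lemma mulC_cls:
  assumes "L2fun f" shows "mulC b (cls f) = cls (\<lambda>x. b x * f x)"
proof -
  have "L2rel (rep_l2 (cls f)) f"
    unfolding cls_def by (rule rep_abs_rsp_left[OF Quotient3_l2]) (rule L2rel_refl[OF assms])
  then have r: "L2fun (rep_l2 (cls f))" "AE x in lebesgue. rep_l2 (cls f) x = f x"
    by (auto simp: L2rel_def)
  then show ?thesis
    unfolding mulC_def using assms
    by (subst cls_eq_iff) (auto intro: L2fun_bcontfun_mult elim: eventually_mono)
qed

lemma bounded_bilinear_mulC: "bounded_bilinear (mulC :: ('a::euclidean_space \<Rightarrow>\<^sub>C real) \<Rightarrow> _)"
proof
  fix b b' :: "'a \<Rightarrow>\<^sub>C real" and F F' :: "'a l2" and c :: real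
  obtain f where f: "L2fun f" "F = cls f" by (rule cls_exhaust)
  obtain f' where f': "L2fun f'" "F' = cls f'" by (rule cls_exhaust)
  show "mulC (b + b') F = mulC b F + mulC b' F"
    by (simp add: f mulC_cls L2fun_bcontfun_mult plus_bcontfun.rep_eq distrib_right flip: cls_add)
  show "mulC b (F + F') = mulC b F + mulC b F'"
    by (simp add: f f' mulC_cls L2fun_bcontfun_mult L2fun_add distrib_left flip: cls_add)
  show "mulC (c *\<^sub>R b) F = c *\<^sub>R mulC b F"
    by (simp add: f mulC_cls L2fun_bcontfun_mult scaleR_bcontfun.rep_eq mult.assoc flip: cls_cmult)
  show "mulC b (c *\<^sub>R F) = c *\<^sub>R mulC b F"
    by (simp add: f mulC_cls L2fun_bcontfun_mult L2fun_cmult mult.left_commute flip: cls_cmult)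
next
  have "norm (mulC b f) \<le> norm b * norm f * 1" for b :: "'a \<Rightarrow>\<^sub>C real" and f :: "'a l2"
  proof (rule cls_exhaust[of f])
    fix g assume g: "L2fun g" "f = cls g"
    have "norm (cls (\<lambda>x. b x * g x)) \<le> norm b * norm (cls g)"
      using norm_bounded[of b]
      by (intro norm_cls_mono g L2fun_bcontfun_mult) (auto simp: abs_mult intro!: mult_right_mono)
    then show ?thesis by (simp add: g mulC_cls)
  qed
  then show "\<exists>K. \<forall>a b. norm (mulC a b :: 'a l2) \<le> norm a * norm b * K" by blast
qed

section \<open>Density of test functions\<close>

lemma lebesgue_measurable_borel: "f \<in> borel_measurable borel \<Longrightarrow> f \<in> borel_measurable lebesgue"
  by (intro measurable_completion) simp

lemma L2fun_bounded_support:
  assumes "f \<in> borel_measurable lebesgue" "bounded K" "\<And>x. \<bar>f x\<bar> \<le> C" "\<And>x. x \<notin> K \<Longrightarrow> f x = 0"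
  shows "L2fun f"
proof -
  obtain a where K: "K \<subseteq> cbox (-a) a" using bounded_subset_cbox_symmetric[OF assms(2)] by blast
  have i: "L2fun (indicator (cbox (-a) a))"
    using emeasure_lborel_cbox_finite[of "-a" a] unfolding L2fun_def
    by (auto simp: power2_eq_square indicator_inter_arith[symmetric] top.not_eq_extremum
        intro!: integrable_real_indicator borel_measurable_indicator)
  have C: "C \<ge> 0" using assms(3)[of undefined] by (smt (verit))
  show ?thesis
    by (rule L2fun_dominated[OF i assms(1), of C])
       (use assms(3,4) K C in \<open>auto simp: indicator_def intro!: always_eventually\<close>)
qed

lemma L2fun_test: "test_fun UNIV \<phi> \<Longrightarrow> L2fun \<phi>"
  by (metis L2fun_bounded_support compact_imp_bounded continuous_lebesgue_measurable
      test_fun_bounded test_fun_continuous test_fun_supportE)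

text \<open>A functional form of Dynkin's theorem: boxes form an intersection-stable generator of the
  Borel sets, and their indicator functions are bounded limits of test functions.\<close>

lemma monotone_class_box:
  fixes F :: "('a::euclidean_space \<Rightarrow> real) \<Rightarrow> bool"
  assumes test: "\<And>\<phi>. test_fun UNIV \<phi> \<Longrightarrow> F \<phi>"
    and add: "\<And>f g. F f \<Longrightarrow> F g \<Longrightarrow> F (\<lambda>x. f x + g x)"
    and cmult: "\<And>c f. F f \<Longrightarrow> F (\<lambda>x. c * f x)"
    and lim: "\<And>f g a b. (\<And>n::nat. F (f n)) \<Longrightarrow> (\<And>n x. \<bar>f n x\<bar> \<le> indicator (cbox a b) x)
      \<Longrightarrow> (\<And>x. (\<lambda>n. f n x) \<longlonglongrightarrow> g x) \<Longrightarrow> F g"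
    and "A \<in> sets borel"
  shows "F (indicator (A \<inter> box a b))"
proof -
  have box: "F (indicator (box c d))" for c d :: 'a
  proof (rule lim[of "\<lambda>n. box_bump n c d" c d])
    show "F (box_bump n c d)" for n by (rule test[OF test_fun_box_bump])
    show "\<bar>box_bump n c d x\<bar> \<le> indicator (cbox c d) x" for n x
      using box_bump_bounds[of n c d x] box_bump_outside[of x c d n] box_subset_cbox[of c d]
      by (auto simp: indicator_def)
  qed (rule box_bump_tendsto)
  have zero: "F (\<lambda>x. 0)" using cmult[OF box, of 0] by simp
  have sum: "F (\<lambda>x. \<Sum>i<n. f i x)" if "\<And>i. F (f i)" for f and n :: nat
    by (induction n) (auto intro: zero add that)
  have "Int_stable (range (\<lambda>(c, d). box c d :: 'a set))"
    by (auto simp: Int_stable_def box_Int_box)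
  moreover have "range (\<lambda>(c, d). box c d :: 'a set) \<subseteq> Pow UNIV"
    by simp
  moreover have "A \<in> sigma_sets UNIV (range (\<lambda>(c, d). box c d))"
    using assms(5) by (simp add: borel_eq_box)
  ultimately show ?thesis
  proof (induction rule: sigma_sets_induct_disjoint)
    case (basic A)
    then obtain c d where "A = box c d" by auto
    then show ?case by (simp add: box_Int_box box)
  next
    case empty
    then show ?case by (simp add: zero)
  next
    case (compl A)
    have "indicator ((UNIV - A) \<inter> box a b) = (\<lambda>x. indicator (box a b) x + (-1) * indicator (A \<inter> box a b) x :: real)"
      by (auto simp: indicator_def fun_eq_iff)
    then show ?case using add[OF box cmult[OF compl(2)]] by (simp only:)
  next
    case (union A)
    have disj: "(\<Sum>i<n. indicator (A i) x) = (indicator (\<Union>i<n. A i) x :: real)" for n x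
      using union(1) by (intro indicator_UN_disjoint[symmetric])
        (auto simp: disjoint_family_on_def)
    have eq: "(\<Sum>i<n. indicator (A i \<inter> box a b) x) = (indicator (\<Union>i<n. A i) x * indicator (box a b) x :: real)" for n x
      by (simp add: indicator_inter_arith flip: sum_distrib_right disj)
    show ?case
    proof (rule lim[of "\<lambda>n x. \<Sum>i<n. indicator (A i \<inter> box a b) x" a b])
      show "F (\<lambda>x. \<Sum>i<n. indicator (A i \<inter> box a b) x)" for n by (rule sum) (rule union(3))
      show "\<bar>\<Sum>i<n. indicator (A i \<inter> box a b) x\<bar> \<le> (indicator (cbox a b) x :: real)" for n x
        unfolding eq using box_subset_cbox[of a b] by (auto simp: indicator_def)
      fix x
      have "(\<lambda>n. indicator (\<Union>i<n. A i) x :: real) \<longlonglongrightarrow> indicator (\<Union>i. A i) x"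
        by (rule LIMSEQ_indicator_UN)
      from tendsto_mult_right[OF this, of "indicator (box a b) x"]
      show "(\<lambda>n. \<Sum>i<n. indicator (A i \<inter> box a b) x) \<longlonglongrightarrow> (indicator (\<Union> (range A) \<inter> box a b) x :: real)"
        unfolding eq by (simp add: indicator_inter_arith)
    qed
  qed
qed

text \<open>The test functions as elements of \<open>L\<^sup>2\<close>.\<close>

definition test_classes :: "'a::euclidean_space l2 set" where
  "test_classes = cls ` {\<phi>. test_fun UNIV \<phi>}"

lemma closure_test_classes_add:
  assumes "F \<in> closure test_classes" "G \<in> closure test_classes"
  shows "F + G \<in> closure test_classes"
proof -
  obtain f g where "\<And>n. f n \<in> test_classes" "f \<longlonglongrightarrow> F" "\<And>n. g n \<in> test_classes" "g \<longlonglongrightarrow> G"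
    using assms by (auto simp: closure_sequential)
  moreover have "f n + g n \<in> test_classes" for n
    using calculation(1,3)[of n] unfolding test_classes_def
    by (auto simp: cls_add[symmetric] L2fun_test intro!: imageI test_fun_add)
  ultimately show ?thesis unfolding closure_sequential
    by (intro exI[of _ "\<lambda>n. f n + g n"]) (auto intro: tendsto_add)
qed

lemma closure_test_classes_scale:
  assumes "F \<in> closure test_classes"
  shows "c *\<^sub>R F \<in> closure test_classes"
proof -
  obtain f where "\<And>n. f n \<in> test_classes" "f \<longlonglongrightarrow> F"
    using assms by (auto simp: closure_sequential)
  moreover have "c *\<^sub>R f n \<in> test_classes" for n
    using calculation(1)[of n] unfolding test_classes_def
    by (auto simp: cls_cmult[symmetric] L2fun_test intro!: imageI test_fun_cmult)
  ultimately show ?thesis unfolding closure_sequential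
    by (intro exI[of _ "\<lambda>n. c *\<^sub>R f n"]) (auto intro: tendsto_intros)
qed

lemma closure_sequence:
  "(\<And>n. f n \<in> closure S) \<Longrightarrow> f \<longlonglongrightarrow> l \<Longrightarrow> l \<in> closure S"
  using closed_sequentially[OF closed_closure] by blast

lemma indicator_in_closure_test_classes:
  fixes A :: "'a::euclidean_space set"
  assumes "A \<in> sets borel"
  shows "L2fun (indicator (A \<inter> box a b)) \<and> cls (indicator (A \<inter> box a b)) \<in> closure test_classes"
proof (rule monotone_class_box[where F = "\<lambda>f. L2fun f \<and> cls f \<in> closure test_classes", OF _ _ _ _ assms])
  show "L2fun \<phi> \<and> cls \<phi> \<in> closure test_classes" if "test_fun UNIV \<phi>" for \<phi> :: "'a \<Rightarrow> real"
    using that closure_subset[of test_classes] by (auto simp: test_classes_def L2fun_test)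
next
  fix f :: "nat \<Rightarrow> 'a \<Rightarrow> real" and g c d
  assume f: "\<And>n. L2fun (f n) \<and> cls (f n) \<in> closure test_classes"
    and b: "\<And>n x. \<bar>f n x\<bar> \<le> indicator (cbox c d) x" and lim: "\<And>x. (\<lambda>n. f n x) \<longlonglongrightarrow> g x"
  have w: "L2fun (indicator (cbox c d) :: 'a \<Rightarrow> real)"
    by (rule L2fun_bounded_support[of _ "cbox c d" 1])
       (auto simp: indicator_def[abs_def] intro!: lebesgue_measurable_borel)
  have gm: "g \<in> borel_measurable lebesgue"
    by (rule borel_measurable_LIMSEQ_real[OF lim]) (use f in \<open>auto intro: L2fun_measurable\<close>)
  have "\<bar>g x\<bar> \<le> indicator (cbox c d) x" for x
    by (rule Lim_bounded[OF tendsto_rabs[OF lim]]) (use b in auto)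
  then have g: "L2fun g" by (intro L2fun_dominated[OF w gm, of 1]) auto
  have "(\<lambda>n. cls (f n)) \<longlonglongrightarrow> cls g"
    by (rule cls_tendsto[OF _ g w]) (use f lim b in auto)
  then show "L2fun g \<and> cls g \<in> closure test_classes"
    using f g closure_sequence[of "\<lambda>n. cls (f n)" test_classes "cls g"] by blast
qed (auto simp: L2fun_add L2fun_cmult cls_add cls_cmult closure_test_classes_add closure_test_classes_scale)

text \<open>A square integrable Borel function is the limit of simple functions cut off to growing boxes; these are
  combinations of the indicator functions covered by \<open>monotone_class_box\<close>.\<close>

theorem closure_test_classes: "closure test_classes = (UNIV :: 'a::euclidean_space l2 set)"
proof -
  have "cls f \<in> closure test_classes" if f: "L2fun f" for f :: "'a \<Rightarrow> real"
  proof -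
    obtain g where g: "g \<in> borel_measurable lborel" "AE x in lborel. f x = g x"
      using completion_ex_borel_measurable_real[OF L2fun_measurable[OF f]] by blast
    have gf: "L2fun g" "cls f = cls g"
      using cls_cong[OF f measurable_completion[OF g(1)] AE_completion[OF g(2)]] by auto
    obtain s where s: "\<And>i. simple_function lborel (s i)" "\<And>x. (\<lambda>i. s i x) \<longlonglongrightarrow> g x"
      "\<And>i x. \<bar>s i x\<bar> \<le> 2 * \<bar>g x\<bar>"
      using borel_measurable_implies_sequence_metric[OF g(1), of 0] by (auto simp: dist_real_def)
    define B where "B n = box (- (real n *\<^sub>R One)) (real n *\<^sub>R One :: 'a)" for n
    define h where "h n x = indicator (B n) x * s n x" for n x
    have h_eq: "h n = (\<lambda>x. \<Sum>y\<in>range (s n). y * indicator (s n -` {y} \<inter> B n) x)" for n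
    proof
      fix x
      have "s n x = (\<Sum>y\<in>range (s n). indicator (s n -` {y}) x * y)"
        by (rule simple_function_indicator_representation_banach[OF s(1)[of n], of x,
              unfolded space_lborel space_borel Int_UNIV_right real_scaleR_def, OF UNIV_I])
      then have "h n x = (\<Sum>y\<in>range (s n). indicator (B n) x * (indicator (s n -` {y}) x * y))"
        unfolding h_def sum_distrib_left[symmetric] by (rule arg_cong)
      also have "\<dots> = (\<Sum>y\<in>range (s n). y * indicator (s n -` {y} \<inter> B n) x)"
        by (rule sum.cong) (auto simp: indicator_def)
      finally show "h n x = (\<Sum>y\<in>range (s n). y * indicator (s n -` {y} \<inter> B n) x)" .
    qed
    have ind: "L2fun (indicator (s n -` {y} \<inter> B n)) \<and> cls (indicator (s n -` {y} \<inter> B n)) \<in> closure test_classes" for n y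
      unfolding B_def
      by (rule indicator_in_closure_test_classes)
         (use simple_functionD(2)[OF s(1)[of n], of "{y}"] in simp)
    have fin: "finite (range (s n))" for n using simple_functionD(1)[OF s(1)[of n]] by simp
    have sum: "L2fun (\<lambda>x. \<Sum>y\<in>Y. y * indicator (s n -` {y} \<inter> B n) x)
        \<and> cls (\<lambda>x. \<Sum>y\<in>Y. y * indicator (s n -` {y} \<inter> B n) x) \<in> closure test_classes"
      if "finite Y" for n Y
      using that
    proof (induction Y rule: finite_induct)
      case empty
      have "cls (\<lambda>x. 0) \<in> closure (test_classes :: 'a l2 set)"
        using closure_test_classes_scale[of "cls (indicator (s n -` {0} \<inter> B n))" 0] ind[of n 0]
        by (simp add: cls_zero)
      then show ?case by (simp add: L2fun_zero)
    next
      case (insert y Y)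
      then show ?case
        using ind[of n y] unfolding sum.insert[OF insert(1,2)]
        by (auto simp only: cls_add cls_cmult L2fun_cmult intro!: L2fun_add L2fun_cmult
            closure_test_classes_add closure_test_classes_scale)
    qed
    have h: "L2fun (h n)" "cls (h n) \<in> closure test_classes" for n
      unfolding h_eq using sum[OF fin] by auto
    have w: "L2fun (\<lambda>x. 2 * g x)" by (rule L2fun_cmult[OF gf(1)])
    have "(\<lambda>n. cls (h n)) \<longlonglongrightarrow> cls g"
    proof (rule cls_tendsto[OF h(1) gf(1) w])
      show "AE x in lebesgue. \<bar>h n x\<bar> \<le> \<bar>2 * g x\<bar>" for n
        using s(3)[of n] by (auto simp: h_def indicator_def abs_mult)
      have "(\<lambda>n. h n x) \<longlonglongrightarrow> g x" for x
      proof (rule Lim_transform_eventually[OF s(2)])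
        obtain n0 where n0: "x \<in> B n0" using UN_box_eq_UNIV unfolding B_def by blast
        have "B n0 \<subseteq> B n" if "n \<ge> n0" for n
          unfolding B_def by (rule subset_box_imp) (use that in auto)
        then have "x \<in> B n" if "n \<ge> n0" for n using n0 that by blast
        then show "\<forall>\<^sub>F n in sequentially. s n x = h n x"
          unfolding eventually_sequentially h_def by (intro exI[of _ n0]) auto
      qed
      then show "AE x in lebesgue. (\<lambda>n. h n x) \<longlonglongrightarrow> g x" by simp
    qed
    then show ?thesis
      unfolding gf(2) using closure_sequence[of "\<lambda>n. cls (h n)" test_classes "cls g"] h(2) by blast
  qed
  then show ?thesis by (metis UNIV_eq_I cls_exhaust)
qed

text \<open>The fundamental lemma of the calculus of variations.\<close>

theorem AE_zero_if_orthogonal_to_test: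
  fixes g :: "'a::euclidean_space \<Rightarrow> real"
  assumes g: "loc_integrable g" "g \<in> borel_measurable lebesgue"
    and orth: "\<And>\<phi>. test_fun UNIV \<phi> \<Longrightarrow> (LINT x|lebesgue. \<phi> x * g x) = 0"
  shows "AE x in lebesgue. g x = 0"
proof -
  have int: "integrable lebesgue (\<lambda>x. f x * g x)"
    if "f \<in> borel_measurable lebesgue" "\<And>x. \<bar>f x\<bar> \<le> C * indicator K x" "compact K" for f :: "'a \<Rightarrow> real" and K C
  proof (rule Bochner_Integration.integrable_bound)
    show "integrable lebesgue (\<lambda>x. C * (indicator K x * g x))"
      using g(1) that(3) unfolding loc_integrable_def set_integrable_def by simp
    have "\<bar>f x * g x\<bar> \<le> \<bar>C * (indicator K x * g x)\<bar>" for x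
      using that(2)[of x] mult_right_mono[of "\<bar>f x\<bar>" "C * indicator K x" "\<bar>g x\<bar>"]
      by (cases "x \<in> K") (auto simp: abs_mult intro: order_trans mult_right_mono)
    then show "AE x in lebesgue. norm (f x * g x) \<le> norm (C * (indicator K x * g x))" by simp
  qed (use that(1) g(2) in measurable)
  define F where "F f \<longleftrightarrow> f \<in> borel_measurable lebesgue \<and> integrable lebesgue (\<lambda>x. f x * g x)
      \<and> (LINT x|lebesgue. f x * g x) = 0" for f
  have box0: "(LINT x|lebesgue. indicator (A \<inter> box a b) x * g x) = 0" if "A \<in> sets borel" for A a b
  proof -
    have "F (indicator (A \<inter> box a b))"
    proof (rule monotone_class_box[where F = F, OF _ _ _ _ that])
      fix \<phi> :: "'a \<Rightarrow> real" assume \<phi>: "test_fun UNIV \<phi>"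
      obtain K where K: "compact K" "\<And>x. x \<notin> K \<Longrightarrow> \<phi> x = 0" using test_fun_supportE[OF \<phi>] by metis
      obtain C where C: "\<And>x. \<bar>\<phi> x\<bar> \<le> C" using test_fun_bounded[OF \<phi>] by metis
      have m: "\<phi> \<in> borel_measurable lebesgue"
        by (rule continuous_lebesgue_measurable[OF test_fun_continuous[OF \<phi>]])
      have "integrable lebesgue (\<lambda>x. \<phi> x * g x)"
        by (rule int[OF m _ K(1), of C]) (use C K(2) in \<open>auto simp: indicator_def\<close>)
      with m orth[OF \<phi>] show "F \<phi>" by (simp add: F_def)
    next
      fix f :: "nat \<Rightarrow> 'a \<Rightarrow> real" and h c d
      assume f: "\<And>n. F (f n)" and b: "\<And>n x. \<bar>f n x\<bar> \<le> indicator (cbox c d) x"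
        and lim: "\<And>x. (\<lambda>n. f n x) \<longlonglongrightarrow> h x"
      have fm: "f n \<in> borel_measurable lebesgue" for n using f by (simp add: F_def)
      have hm: "h \<in> borel_measurable lebesgue"
        by (rule borel_measurable_LIMSEQ_real[OF lim fm])
      have hb: "\<bar>h x\<bar> \<le> indicator (cbox c d) x" for x
        by (rule Lim_bounded[OF tendsto_rabs[OF lim]]) (use b in auto)
      have "(\<lambda>n. LINT x|lebesgue. f n x * g x) \<longlonglongrightarrow> (LINT x|lebesgue. h x * g x)"
      proof (rule integral_dominated_convergence)
        have "set_integrable lebesgue (cbox c d) g" using g(1) by (simp add: loc_integrable_def)
        then show "integrable lebesgue (\<lambda>x. norm (indicator (cbox c d) x *\<^sub>R g x))"
          unfolding set_integrable_def by (rule integrable_norm)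
        show "AE x in lebesgue. norm (f n x * g x) \<le> norm (indicator (cbox c d) x *\<^sub>R g x)" for n
          using b[of n] by (auto simp: abs_mult intro!: always_eventually mult_right_mono)
        show "AE x in lebesgue. (\<lambda>n. f n x * g x) \<longlonglongrightarrow> h x * g x"
          by (intro always_eventually allI tendsto_intros lim)
      qed (use fm hm g(2) in measurable)
      then have "(LINT x|lebesgue. h x * g x) = 0"
        using f LIMSEQ_unique[OF _ tendsto_const] by (fastforce simp: F_def)
      moreover have "integrable lebesgue (\<lambda>x. h x * g x)"
        by (rule int[OF hm _ compact_cbox, of 1]) (use hb in auto)
      ultimately show "F h" using hm by (simp add: F_def)
    qed (auto simp: F_def distrib_right mult.assoc)
    then show ?thesis by (simp add: F_def)
  qed
  define B where "B n = box (- (real n *\<^sub>R One)) (real n *\<^sub>R One :: 'a)" for n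
  have "AE x in lebesgue. indicator (B n) x * g x = 0" for n
  proof -
    have gB: "integrable lebesgue (\<lambda>x. indicator (B n) x * g x)"
      by (rule int[of _ 1 "cbox (- (real n *\<^sub>R One)) (real n *\<^sub>R One)"])
         (use box_subset_cbox in \<open>auto simp: B_def indicator_def[abs_def] intro!: lebesgue_measurable_borel\<close>)
    obtain h where h: "h \<in> borel_measurable lborel" "AE x in lborel. indicator (B n) x * g x = h x"
      using completion_ex_borel_measurable_real[OF borel_measurable_integrable[OF gB]] by blast
    have "integrable lebesgue h"
      using integrable_cong_AE_imp[OF gB measurable_completion[OF h(1)]] AE_completion[OF h(2)]
      by (simp add: eq_commute)
    then have hi: "integrable lborel h" using h(1) by (simp add: integrable_completion)
    have h0: "AE x in lborel. h x = 0"
    proof (rule sigma_finite_measure.density_zero[OF sigma_finite_lborel hi])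
      fix A :: "'a set" assume A: "A \<in> sets lborel"
      have "set_lebesgue_integral lborel A h = (LINT x|lebesgue. indicator A x * h x)"
        unfolding set_lebesgue_integral_def using A h(1)
        by (subst integral_completion[symmetric]) auto
      also have "\<dots> = (LINT x|lebesgue. indicator (A \<inter> B n) x * g x)"
      proof (rule integral_cong_AE)
        show "AE x in lebesgue. indicator A x * h x = indicator (A \<inter> B n) x * g x"
          using AE_completion[OF h(2)] by eventually_elim (auto simp: indicator_def split: if_splits)
        show "(\<lambda>x. indicator A x * h x) \<in> borel_measurable lebesgue"
          using A h(1) by (intro measurable_completion) auto
        have "A \<inter> B n \<in> sets lebesgue" using A by (auto simp: B_def)
        then show "(\<lambda>x. indicator (A \<inter> B n) x * g x) \<in> borel_measurable lebesgue"
          using g(2) by measurable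
      qed
      also have "\<dots> = 0" unfolding B_def by (rule box0) (use A in simp)
      finally show "set_lebesgue_integral lborel A h = 0" .
    qed
    show ?thesis
      using AE_completion[OF h(2)] AE_completion[OF h0] by eventually_elim simp
  qed
  then have "AE x in lebesgue. \<forall>n. indicator (B n) x * g x = 0"
    by (intro AE_all_countable[THEN iffD2] allI)
  then show ?thesis
  proof eventually_elim
    case (elim x)
    obtain n where "x \<in> B n" using UN_box_eq_UNIV unfolding B_def by blast
    with elim show ?case by (auto dest: spec[of _ n])
  qed
qed

lemma norm_le_if_inner_bound_on_dense:
  fixes w :: "'h::real_inner"
  assumes "closure D = UNIV" "C \<ge> 0" "\<And>d. d \<in> D \<Longrightarrow> \<bar>d \<bullet> w\<bar> \<le> C * norm d"
  shows "norm w \<le> C"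
proof -
  obtain d where d: "\<And>n. d n \<in> D" "d \<longlonglongrightarrow> w"
    using assms(1) closure_sequential[of w D] by auto
  have "\<bar>w \<bullet> w\<bar> \<le> C * norm w"
  proof (rule LIMSEQ_le)
    show "(\<lambda>n. \<bar>d n \<bullet> w\<bar>) \<longlonglongrightarrow> \<bar>w \<bullet> w\<bar>" "(\<lambda>n. C * norm (d n)) \<longlonglongrightarrow> C * norm w"
      by (intro tendsto_intros d)+
  qed (use assms(3) d(1) in auto)
  then have "norm w * norm w \<le> C * norm w"
    by (simp add: dot_square_norm power2_eq_square)
  then show ?thesis
    using assms(2) by (cases "norm w = 0") (auto simp: mult_le_cancel_right)
qed

text \<open>A curve in a Hilbert space that is differentiable against a dense set of vectors, with a
  continuous candidate for the derivative, is differentiable in norm.\<close>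

lemma weak_imp_strong_vector_derivative:
  fixes U G :: "real \<Rightarrow> 'h::real_inner"
  assumes D: "closure D = UNIV" and S: "open S" "s \<in> S"
    and G: "continuous (at s) G"
    and der: "\<And>t d. t \<in> S \<Longrightarrow> d \<in> D \<Longrightarrow> ((\<lambda>t. d \<bullet> U t) has_real_derivative d \<bullet> G t) (at t)"
  shows "(U has_vector_derivative G s) (at s)"
  unfolding has_vector_derivative_def has_derivative_at_alt
proof (intro conjI allI impI)
  show "bounded_linear (\<lambda>x. x *\<^sub>R G s)" by (rule bounded_linear_scaleR_left)
  fix e :: real assume e: "e > 0"
  obtain d1 where d1: "d1 > 0" "\<And>t. dist t s < d1 \<Longrightarrow> dist (G t) (G s) < e"
    using G e unfolding continuous_at_eps_delta by metis
  obtain d2 where d2: "d2 > 0" "ball s d2 \<subseteq> S"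
    using S by (auto simp: open_contains_ball)
  define r where "r = min d1 d2"
  have "norm (U t - U s - (t - s) *\<^sub>R G s) \<le> e * norm (t - s)" if t: "norm (t - s) < r" for t
  proof (rule norm_le_if_inner_bound_on_dense[OF D])
    fix d assume d: "d \<in> D"
    have ts: "t \<in> ball s r" "s \<in> ball s r" using t e by (auto simp: dist_norm norm_minus_commute)
    have "norm ((d \<bullet> U t - t * (d \<bullet> G s)) - (d \<bullet> U s - s * (d \<bullet> G s))) \<le> (e * norm d) * norm (t - s)"
    proof (rule field_differentiable_bound[of "ball s r" _ "\<lambda>t. d \<bullet> G t - d \<bullet> G s"])
      fix z assume z: "z \<in> ball s r"
      then have "z \<in> S" using d2 by (auto simp: r_def)
      then show "((\<lambda>t. d \<bullet> U t - t * (d \<bullet> G s)) has_field_derivative d \<bullet> G z - d \<bullet> G s) (at z within ball s r)"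
        using der[OF _ d] by (auto intro!: derivative_eq_intros intro: has_field_derivative_at_within)
      have "norm (G z - G s) \<le> e"
        using d1(2)[of z] z by (simp add: r_def dist_norm abs_minus_commute)
      then show "norm (d \<bullet> G z - d \<bullet> G s) \<le> e * norm d"
        using Cauchy_Schwarz_ineq2[of d "G z - G s"] mult_left_mono[of "norm (G z - G s)" e "norm d"]
        by (simp add: inner_diff_right mult.commute)
    qed (use ts in auto)
    then show "\<bar>d \<bullet> (U t - U s - (t - s) *\<^sub>R G s)\<bar> \<le> e * norm (t - s) * norm d"
      by (simp add: inner_diff_right algebra_simps)
  qed (use e in simp)
  then show "\<exists>d>0. \<forall>y. norm (y - s) < d \<longrightarrow> norm (U y - U s - (y - s) *\<^sub>R G s) \<le> e * norm (y - s)"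
    using d1(1) d2(1) by (intro exI[of _ r]) (auto simp: r_def)
qed

section \<open>Translations and weak derivatives\<close>

text \<open>Differentiation under the integral sign, with the derivative dominated near \<open>s\<close>.\<close>

lemma has_real_derivative_integral:
  fixes q q' :: "real \<Rightarrow> 'a \<Rightarrow> real"
  assumes r: "r > 0"
    and int: "\<And>t. t \<in> ball s r \<Longrightarrow> integrable M (q t)"
    and der: "\<And>t x. t \<in> ball s r \<Longrightarrow> ((\<lambda>t. q t x) has_real_derivative q' t x) (at t)"
    and bound: "\<And>t x. t \<in> ball s r \<Longrightarrow> \<bar>q' t x\<bar> \<le> w x"
    and w: "integrable M w"
  shows "((\<lambda>t. LINT x|M. q t x) has_real_derivative (LINT x|M. q' s x)) (at s)"
proof -
  have s: "s \<in> ball s r" using r by simp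
  have "((\<lambda>t. ((LINT x|M. q t x) - (LINT x|M. q s x)) / (t - s)) \<longlongrightarrow> (LINT x|M. q' s x)) (at s within ball s r)"
    unfolding tendsto_at_iff_sequentially comp_def
  proof (intro allI impI)
    fix X assume X: "\<forall>i. X i \<in> ball s r - {s}" "X \<longlonglongrightarrow> s"
    have quot: "(\<lambda>n. (q (X n) x - q s x) / (X n - s)) \<longlonglongrightarrow> q' s x" for x
    proof -
      have "((\<lambda>t. (q t x - q s x) / (t - s)) \<longlongrightarrow> q' s x) (at s)"
        using der[OF s] by (simp add: has_field_derivative_iff)
      then show ?thesis
        using X unfolding tendsto_at_iff_sequentially comp_def by auto
    qed
    have "(\<lambda>n. LINT x|M. (q (X n) x - q s x) / (X n - s)) \<longlonglongrightarrow> (LINT x|M. q' s x)"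
    proof (rule integral_dominated_convergence[OF _ _ w])
      have m: "q (X n) \<in> borel_measurable M" "q s \<in> borel_measurable M" for n
        using int[of "X n"] int[OF s] X(1) by auto
      show "(\<lambda>x. (q (X n) x - q s x) / (X n - s)) \<in> borel_measurable M" for n
        using m by measurable
      show "q' s \<in> borel_measurable M"
        by (rule borel_measurable_LIMSEQ_real[OF quot]) (use m in measurable)
      show "AE x in M. (\<lambda>n. (q (X n) x - q s x) / (X n - s)) \<longlonglongrightarrow> q' s x"
        using quot by simp
      have "\<bar>q (X n) x - q s x\<bar> \<le> w x * \<bar>X n - s\<bar>" for n x
        using field_differentiable_bound[of "ball s r" "\<lambda>t. q t x" "\<lambda>t. q' t x" "w x" "X n" s]
          der bound X(1) s by (auto intro: has_field_derivative_at_within)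
      then show "AE x in M. norm ((q (X n) x - q s x) / (X n - s)) \<le> w x" for n
        using X(1) by (auto simp: divide_le_eq abs_divide)
    qed
    also have "(\<lambda>n. LINT x|M. (q (X n) x - q s x) / (X n - s))
        = (\<lambda>n. ((LINT x|M. q (X n) x) - (LINT x|M. q s x)) / (X n - s))"
      using int[OF s] int X(1) by (intro ext) (simp add: Bochner_Integration.integral_diff)
    finally show "(\<lambda>n. ((LINT x|M. q (X n) x) - (LINT x|M. q s x)) / (X n - s)) \<longlonglongrightarrow> (LINT x|M. q' s x)" .
  qed
  then show ?thesis
    using at_within_open[OF s] by (simp add: has_field_derivative_iff)
qed

lemma lebesgue_distr_translation: "distr lebesgue lebesgue (\<lambda>x. x + c) = (lebesgue :: 'a::euclidean_space measure)"
  and measurable_lebesgue_translation: "(\<lambda>x. x + c) \<in> lebesgue \<rightarrow>\<^sub>M (lebesgue :: 'a::euclidean_space measure)"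
proof -
  have eq: "(\<lambda>x. c + (\<Sum>j\<in>Basis. (1 * (x \<bullet> j)) *\<^sub>R j)) = (\<lambda>x. x + c)"
    by (simp add: euclidean_representation add.commute)
  show "(\<lambda>x. x + c) \<in> lebesgue \<rightarrow>\<^sub>M (lebesgue :: 'a measure)"
    using lebesgue_affine_measurable[of "\<lambda>_. 1" c] unfolding eq by simp
  show "distr lebesgue lebesgue (\<lambda>x. x + c) = (lebesgue :: 'a measure)"
    using lebesgue_affine_euclidean[of "\<lambda>_. 1" c] unfolding eq by (simp add: density_1)
qed

lemma integral_translation:
  fixes f :: "'a::euclidean_space \<Rightarrow> 'b::{banach, second_countable_topology}"
  assumes "f \<in> borel_measurable lebesgue"
  shows "(LINT x|lebesgue. f (x + c)) = (LINT x|lebesgue. f x)"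
  using integral_distr[OF measurable_lebesgue_translation assms, of c]
  by (simp add: lebesgue_distr_translation)

lemma measurable_translation:
  fixes f :: "'a::euclidean_space \<Rightarrow> 'b::{banach, second_countable_topology}"
  assumes "f \<in> borel_measurable lebesgue"
  shows "(\<lambda>x. f (x + c)) \<in> borel_measurable lebesgue"
  using measurable_compose[OF measurable_lebesgue_translation assms] .

lemma integrable_translation:
  fixes f :: "'a::euclidean_space \<Rightarrow> 'b::{banach, second_countable_topology}"
  assumes "integrable lebesgue f"
  shows "integrable lebesgue (\<lambda>x. f (x + c))"
  using integrable_distr[OF measurable_lebesgue_translation, of c f] assms
  by (simp add: lebesgue_distr_translation)

lemma L2fun_translation: "L2fun f \<Longrightarrow> L2fun (\<lambda>x. f (x + c))"
  using measurable_translation[of f c] integrable_translation[of "\<lambda>x. (f x)\<^sup>2" c]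
  by (simp add: L2fun_def)

lemma inner_cls_translation:
  assumes "L2fun f" "L2fun g"
  shows "cls (\<lambda>x. f (x + c)) \<bullet> cls (\<lambda>x. g (x + c)) = cls f \<bullet> cls g"
  using integral_translation[OF borel_measurable_integrable[OF L2fun_mult_integrable[OF assms]], of c]
  by (simp add: inner_cls L2fun_translation assms)

lemma inner_cls_shift:
  assumes "L2fun f" "L2fun g"
  shows "cls f \<bullet> cls (\<lambda>x. g (x + c)) = cls (\<lambda>x. f (x - c)) \<bullet> cls g"
  using inner_cls_translation[of "\<lambda>x. f (x - c)" g c] L2fun_translation[of f "-c"] assms by simp

lemma test_fun_translation:
  assumes "test_fun UNIV \<phi>" shows "test_fun UNIV (\<lambda>x. \<phi> (x + c))"
    and "dir_deriv v (\<lambda>x. \<phi> (x + c)) = (\<lambda>x. dir_deriv v \<phi> (x + c))"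
proof -
  obtain K where K: "compact K" "\<And>x. x \<notin> K \<Longrightarrow> \<phi> x = 0" using test_fun_supportE[OF assms] by metis
  show "test_fun UNIV (\<lambda>x. \<phi> (x + c))"
  proof (rule test_funI[of _ "(\<lambda>x. x - c) ` K"])
    show "Ck k (\<lambda>x. \<phi> (x + c))" for k
      using Ck_affine[of "\<lambda>x. x" k \<phi> c] test_fun_Ck[OF assms] by (simp add: bounded_linear_ident)
    show "compact ((\<lambda>x. x - c) ` K)"
      by (intro compact_continuous_image K continuous_intros)
    show "\<phi> (x + c) = 0" if "x \<notin> (\<lambda>x. x - c) ` K" for x
      using that K(2)[of "x + c"] by (force simp: image_iff)
  qed simp
  show "dir_deriv v (\<lambda>x. \<phi> (x + c)) = (\<lambda>x. dir_deriv v \<phi> (x + c))"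
    using dir_deriv_affine(1)[of "\<lambda>x. x" \<phi> _ c v] test_fun_differentiable[OF assms]
    by (auto simp: bounded_linear_ident)
qed

lemma test_fun_translates_bound:
  fixes \<phi> :: "'a::euclidean_space \<Rightarrow> real"
  assumes "test_fun UNIV \<phi>"
  obtains C R where "C \<ge> 0" "\<And>s x. \<bar>s\<bar> \<le> M \<Longrightarrow> \<bar>\<phi> (x + s *\<^sub>R v)\<bar> \<le> C * indicator (cball 0 R) x"
proof -
  obtain K where K: "compact K" "\<And>x. x \<notin> K \<Longrightarrow> \<phi> x = 0" using test_fun_supportE[OF assms] by metis
  obtain C where C: "C \<ge> 0" "\<And>x. \<bar>\<phi> x\<bar> \<le> C" using test_fun_bounded[OF assms] by metis
  obtain R where R: "\<And>x. x \<in> K \<Longrightarrow> norm x \<le> R"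
    using compact_imp_bounded[OF K(1)] by (auto simp: bounded_iff)
  have "\<bar>\<phi> (x + s *\<^sub>R v)\<bar> \<le> C * indicator (cball 0 (R + M * norm v)) x" if s: "\<bar>s\<bar> \<le> M" for s x
  proof (cases "norm x \<le> R + M * norm v")
    case False
    have "norm x \<le> norm (x + s *\<^sub>R v) + \<bar>s\<bar> * norm v"
      using norm_triangle_ineq4[of "x + s *\<^sub>R v" "s *\<^sub>R v"] by simp
    also have "\<bar>s\<bar> * norm v \<le> M * norm v" using s by (intro mult_right_mono) auto
    finally have "x + s *\<^sub>R v \<notin> K" using False R[of "x + s *\<^sub>R v"] by fastforce
    then show ?thesis using K(2) C(1) by simp
  qed (use C in auto)
  then show ?thesis using that C(1) by blast
qed

lemma L2fun_indicator_cball: "L2fun (indicator (cball (0::'a::euclidean_space) R))"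
  by (rule L2fun_bounded_support[of _ "cball 0 R" 1])
     (auto simp: indicator_def[abs_def] intro!: lebesgue_measurable_borel)

lemma translation_continuous_test:
  fixes \<phi> :: "'a::euclidean_space \<Rightarrow> real"
  assumes "test_fun UNIV \<phi>"
  shows "((\<lambda>s. cls (\<lambda>x. \<phi> (x + s *\<^sub>R v))) \<longlongrightarrow> cls \<phi>) (at 0)"
  unfolding tendsto_at_iff_sequentially comp_def
proof (intro allI impI)
  fix X :: "nat \<Rightarrow> real" assume X: "X \<longlonglongrightarrow> 0"
  then obtain M where M: "\<And>n. \<bar>X n\<bar> \<le> M"
    using convergent_imp_bounded[OF X] by (auto simp: bounded_iff)
  obtain C R where C: "C \<ge> 0" "\<And>s x. \<bar>s\<bar> \<le> M \<Longrightarrow> \<bar>\<phi> (x + s *\<^sub>R v)\<bar> \<le> C * indicator (cball 0 R) x"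
    using test_fun_translates_bound[OF assms] by metis
  show "(\<lambda>n. cls (\<lambda>x. \<phi> (x + X n *\<^sub>R v))) \<longlonglongrightarrow> cls \<phi>"
  proof (rule cls_tendsto[OF _ L2fun_test[OF assms] L2fun_cmult[OF L2fun_indicator_cball[of R], of C]])
    show "L2fun (\<lambda>x. \<phi> (x + X n *\<^sub>R v))" for n by (rule L2fun_translation[OF L2fun_test[OF assms]])
    show "AE x in lebesgue. \<bar>\<phi> (x + X n *\<^sub>R v)\<bar> \<le> \<bar>C * indicator (cball 0 R) x\<bar>" for n
      using C M by auto
    have "(\<lambda>n. \<phi> (x + X n *\<^sub>R v)) \<longlonglongrightarrow> \<phi> (x + 0 *\<^sub>R v)" for x
      by (rule continuous_on_tendsto_compose[OF test_fun_continuous[OF assms, of UNIV]])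
         (intro tendsto_intros X, auto)
    then show "AE x in lebesgue. (\<lambda>n. \<phi> (x + X n *\<^sub>R v)) \<longlonglongrightarrow> \<phi> x" by simp
  qed
qed

lemma translation_continuous:
  fixes f :: "'a::euclidean_space \<Rightarrow> real"
  assumes "L2fun f"
  shows "((\<lambda>s. cls (\<lambda>x. f (x + s *\<^sub>R v))) \<longlongrightarrow> cls f) (at 0)"
proof (rule tendstoI)
  fix e :: real assume e: "e > 0"
  have "cls f \<in> closure test_classes" by (simp add: closure_test_classes)
  then obtain \<phi> where \<phi>: "test_fun UNIV \<phi>" "dist (cls \<phi>) (cls f) < e / 3"
    using e unfolding closure_approachable test_classes_def by (auto dest!: spec[of _ "e/3"])
  note L = L2fun_test[OF \<phi>(1)]
  have d: "dist (cls (\<lambda>x. \<phi> (x + c))) (cls (\<lambda>x. f (x + c))) = dist (cls \<phi>) (cls f)" for c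
  proof -
    have "dist (cls (\<lambda>x. \<phi> (x + c))) (cls (\<lambda>x. f (x + c))) = norm (cls (\<lambda>x. \<phi> (x + c) - f (x + c)))"
      using L assms by (simp add: dist_norm L2fun_translation cls_diff)
    also have "\<dots> = norm (cls (\<lambda>x. \<phi> x - f x))"
      using inner_cls_translation[OF L2fun_diff[OF L assms] L2fun_diff[OF L assms], of c]
      by (simp add: norm_eq_sqrt_inner)
    finally show ?thesis using L assms by (simp add: dist_norm cls_diff)
  qed
  have "\<forall>\<^sub>F s in at 0. dist (cls (\<lambda>x. \<phi> (x + s *\<^sub>R v))) (cls \<phi>) < e / 3"
    by (rule tendstoD[OF translation_continuous_test[OF \<phi>(1)]]) (use e in simp)
  then show "\<forall>\<^sub>F s in at 0. dist (cls (\<lambda>x. f (x + s *\<^sub>R v))) (cls f) < e"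
  proof eventually_elim
    case (elim s)
    have "dist (cls (\<lambda>x. f (x + s *\<^sub>R v))) (cls f) \<le>
        dist (cls (\<lambda>x. \<phi> (x + s *\<^sub>R v))) (cls (\<lambda>x. f (x + s *\<^sub>R v)))
        + dist (cls (\<lambda>x. \<phi> (x + s *\<^sub>R v))) (cls \<phi>) + dist (cls \<phi>) (cls f)"
      using dist_triangle3[of "cls (\<lambda>x. f (x + s *\<^sub>R v))" "cls f" "cls (\<lambda>x. \<phi> (x + s *\<^sub>R v))"]
        dist_triangle[of "cls (\<lambda>x. \<phi> (x + s *\<^sub>R v))" "cls f" "cls \<phi>"] by linarith
    then show ?case using elim e \<phi>(2) d[of "s *\<^sub>R v"] by linarith
  qed
qed

text \<open>Weak directional derivatives within the space of square integrable functions.\<close>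

definition wd :: "'a \<Rightarrow> ('a::euclidean_space \<Rightarrow> real) \<Rightarrow> ('a \<Rightarrow> real) \<Rightarrow> bool" where
  "wd v f g \<longleftrightarrow> L2fun f \<and> L2fun g \<and> (\<forall>\<phi>. test_fun UNIV \<phi> \<longrightarrow>
     (LINT x|lebesgue. dir_deriv v \<phi> x * f x) = - (LINT x|lebesgue. \<phi> x * g x))"

lemma wd_L2fun: assumes "wd v f g" shows "L2fun f" "L2fun g"
  using assms by (auto simp: wd_def)

lemma wdD: "wd v f g \<Longrightarrow> test_fun UNIV \<phi> \<Longrightarrow> cls (dir_deriv v \<phi>) \<bullet> cls f = - (cls \<phi> \<bullet> cls g)"
  by (simp add: wd_def inner_cls L2fun_test test_fun_dir_deriv)

lemma wdI:
  assumes "L2fun f" "L2fun g"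
    "\<And>\<phi>. test_fun UNIV \<phi> \<Longrightarrow> cls (dir_deriv v \<phi>) \<bullet> cls f = - (cls \<phi> \<bullet> cls g)"
  shows "wd v f g"
  unfolding wd_def
proof (intro conjI assms(1,2) allI impI)
  fix \<phi> :: "'a \<Rightarrow> real" assume \<phi>: "test_fun UNIV \<phi>"
  show "(LINT x|lebesgue. dir_deriv v \<phi> x * f x) = - (LINT x|lebesgue. \<phi> x * g x)"
    using assms(3)[OF \<phi>] L2fun_test[OF \<phi>] L2fun_test[OF test_fun_dir_deriv[OF \<phi>]] assms(1,2)
    by (simp add: inner_cls)
qed

lemma wd_translation:
  assumes "wd v f g" shows "wd v (\<lambda>x. f (x + c)) (\<lambda>x. g (x + c))"
proof (rule wdI)
  note L = wd_L2fun[OF assms]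
  show "L2fun (\<lambda>x. f (x + c))" "L2fun (\<lambda>x. g (x + c))" using L by (auto intro: L2fun_translation)
  fix \<phi> :: "'a \<Rightarrow> real" assume \<phi>: "test_fun UNIV \<phi>"
  show "cls (dir_deriv v \<phi>) \<bullet> cls (\<lambda>x. f (x + c)) = - (cls \<phi> \<bullet> cls (\<lambda>x. g (x + c)))"
    using wdD[OF assms test_fun_translation(1)[OF \<phi>, of "-c"]] test_fun_translation(2)[OF \<phi>, of v "-c"]
      inner_cls_shift[OF L2fun_test[OF \<phi>] L(2), of c]
      inner_cls_shift[OF L2fun_test[OF test_fun_dir_deriv[OF \<phi>]] L(1), of v c]
    by simp
qed

lemma has_real_derivative_along:
  assumes "f differentiable (at (x + t *\<^sub>R v))"
  shows "((\<lambda>t. f (x + t *\<^sub>R v)) has_real_derivative dir_deriv v f (x + t *\<^sub>R v)) (at t)"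
proof -
  have 1: "((\<lambda>t. x + t *\<^sub>R v) has_derivative (\<lambda>h. h *\<^sub>R v)) (at t)"
    by (auto intro!: derivative_eq_intros)
  have d: "(f has_derivative (\<lambda>w. dir_deriv w f (x + t *\<^sub>R v))) (at (x + t *\<^sub>R v))"
    by (rule has_derivative_dir_deriv[OF assms])
  have "dir_deriv (h *\<^sub>R v) f (x + t *\<^sub>R v) = dir_deriv v f (x + t *\<^sub>R v) * h" for h
    using linear_cmul[OF has_derivative_linear[OF d]] by (simp add: mult.commute)
  with has_derivative_compose[OF 1 d] show ?thesis by (simp add: has_field_derivative_def)
qed

lemma integral_test_translates_derivative:
  fixes \<phi> :: "'a::euclidean_space \<Rightarrow> real"
  assumes \<phi>: "test_fun UNIV \<phi>" and f: "L2fun f"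
  shows "((\<lambda>s. cls (\<lambda>x. \<phi> (x + s *\<^sub>R v)) \<bullet> cls f) has_real_derivative
           cls (\<lambda>x. dir_deriv v \<phi> (x + s *\<^sub>R v)) \<bullet> cls f) (at s)"
proof -
  note d\<phi> = test_fun_dir_deriv[OF \<phi>, of v]
  obtain C R where C: "C \<ge> 0"
    "\<And>t x. \<bar>t\<bar> \<le> \<bar>s\<bar> + 1 \<Longrightarrow> \<bar>dir_deriv v \<phi> (x + t *\<^sub>R v)\<bar> \<le> C * indicator (cball 0 R) x"
    using test_fun_translates_bound[OF d\<phi>] by metis
  have "((\<lambda>s. LINT x|lebesgue. \<phi> (x + s *\<^sub>R v) * f x) has_real_derivative
      (LINT x|lebesgue. dir_deriv v \<phi> (x + s *\<^sub>R v) * f x)) (at s)"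
  proof (rule has_real_derivative_integral[of 1])
    show "integrable lebesgue (\<lambda>x. \<phi> (x + t *\<^sub>R v) * f x)" for t
      by (intro L2fun_mult_integrable f L2fun_translation L2fun_test \<phi>)
    show "((\<lambda>t. \<phi> (x + t *\<^sub>R v) * f x) has_real_derivative dir_deriv v \<phi> (x + t *\<^sub>R v) * f x) (at t)" for t x
      by (intro DERIV_cmult_right has_real_derivative_along test_fun_differentiable[OF \<phi>])
    show "\<bar>dir_deriv v \<phi> (x + t *\<^sub>R v) * f x\<bar> \<le> C * (indicator (cball 0 R) x * \<bar>f x\<bar>)" if "t \<in> ball s 1" for t x
    proof -
      have "\<bar>t\<bar> \<le> \<bar>s\<bar> + 1" using that by (auto simp: dist_real_def)
      from mult_right_mono[OF C(2)[OF this, of x], of "\<bar>f x\<bar>"]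
      show ?thesis by (simp add: abs_mult mult.assoc)
    qed
    have "integrable lebesgue (\<lambda>x. indicator (cball 0 R) x * \<bar>f x\<bar>)"
      by (intro L2fun_mult_integrable L2fun_indicator_cball L2fun_dominated[OF f, of _ 1])
         (use L2fun_measurable[OF f] in auto)
    then show "integrable lebesgue (\<lambda>x. C * (indicator (cball 0 R) x * \<bar>f x\<bar>))" by simp
  qed simp
  then show ?thesis
    using \<phi> d\<phi> f by (simp add: inner_cls L2fun_translation L2fun_test)
qed

text \<open>The difference quotients of a function converge in norm to its weak derivative.\<close>

theorem wd_has_vector_derivative:
  fixes f :: "'a::euclidean_space \<Rightarrow> real"
  assumes "wd v f g"
  shows "((\<lambda>s. cls (\<lambda>x. f (x + s *\<^sub>R v))) has_vector_derivative cls g) (at 0)"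
proof -
  note L = wd_L2fun[OF assms]
  have "((\<lambda>s. cls (\<lambda>x. f (x + s *\<^sub>R v))) has_vector_derivative (\<lambda>s. cls (\<lambda>x. g (x + s *\<^sub>R v))) 0) (at 0)"
  proof (rule weak_imp_strong_vector_derivative[OF closure_test_classes open_UNIV UNIV_I])
    show "continuous (at 0) (\<lambda>s. cls (\<lambda>x. g (x + s *\<^sub>R v)))"
      using translation_continuous[OF L(2), of v] by (simp add: continuous_at)
    fix t :: real and d :: "'a l2" assume "d \<in> test_classes"
    then obtain \<phi> where \<phi>: "test_fun UNIV \<phi>" "d = cls \<phi>" by (auto simp: test_classes_def)
    have shift: "cls \<phi> \<bullet> cls (\<lambda>x. h (x + s *\<^sub>R v)) = cls (\<lambda>x. \<phi> (x + s *\<^sub>R - v)) \<bullet> cls h" if "L2fun h" for h s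
      using inner_cls_shift[OF L2fun_test[OF \<phi>(1)] that, of "s *\<^sub>R v"] by simp
    have eq: "cls (\<lambda>x. dir_deriv (- v) \<phi> (x + t *\<^sub>R - v)) \<bullet> cls f = cls (\<lambda>x. \<phi> (x + t *\<^sub>R - v)) \<bullet> cls g"
    proof -
      have "dir_deriv (- v) \<phi> y = - dir_deriv v \<phi> y" for y
        using linear_neg[OF has_derivative_linear[OF has_derivative_dir_deriv[OF test_fun_differentiable[OF \<phi>(1)]]]] by blast
      then have "cls (\<lambda>x. dir_deriv (- v) \<phi> (x + t *\<^sub>R - v)) = - cls (\<lambda>x. dir_deriv v \<phi> (x + t *\<^sub>R - v))"
        using cls_cmult[of "\<lambda>x. dir_deriv v \<phi> (x + t *\<^sub>R - v)" "-1",
            OF L2fun_translation[OF L2fun_test[OF test_fun_dir_deriv[OF \<phi>(1)]]]] by simp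
      then show ?thesis
        using wdD[OF assms test_fun_translation(1)[OF \<phi>(1), of "t *\<^sub>R - v"]]
        unfolding test_fun_translation(2)[OF \<phi>(1)] by simp
    qed
    show "((\<lambda>t. d \<bullet> cls (\<lambda>x. f (x + t *\<^sub>R v))) has_real_derivative d \<bullet> cls (\<lambda>x. g (x + t *\<^sub>R v))) (at t)"
      unfolding \<phi>(2) shift[OF L(1)] shift[OF L(2)] eq[symmetric]
      by (rule integral_test_translates_derivative[OF \<phi>(1) L(1)])
  qed
  then show ?thesis by simp
qed

text \<open>By translation invariance the inner product of the two translated functions is constant.\<close>

theorem wd_integration_by_parts:
  assumes f: "wd v f f'" and g: "wd v g g'"
  shows "cls f' \<bullet> cls g = - (cls f \<bullet> cls g')"
proof -
  let ?F = "\<lambda>s. cls (\<lambda>x. f (x + s *\<^sub>R v))" and ?G = "\<lambda>s. cls (\<lambda>x. g (x + s *\<^sub>R v))"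
  have "((\<lambda>s. ?F s \<bullet> ?G s) has_vector_derivative ?F 0 \<bullet> cls g' + cls f' \<bullet> ?G 0) (at 0)"
    by (rule bounded_bilinear.has_vector_derivative[OF bounded_bilinear_inner
          wd_has_vector_derivative[OF f] wd_has_vector_derivative[OF g]])
  moreover have "(\<lambda>s. ?F s \<bullet> ?G s) = (\<lambda>s. cls f \<bullet> cls g)"
    by (simp add: inner_cls_translation wd_L2fun[OF f] wd_L2fun[OF g])
  ultimately have "((\<lambda>s. cls f \<bullet> cls g) has_vector_derivative cls f \<bullet> cls g' + cls f' \<bullet> cls g) (at 0)"
    by simp
  then show ?thesis
    using vector_derivative_unique_at[OF _ has_vector_derivative_const] by fastforce
qed

text \<open>If \<open>f\<^sub>j\<close>, \<open>f\<^sub>k\<close> and \<open>(f\<^sub>k)\<^sub>j\<close> exist in \<open>L\<^sup>2\<close>, then so does \<open>(f\<^sub>j)\<^sub>k\<close>, and it is the same function: weak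
  differentiation along \<open>k\<close> commutes with translation along \<open>j\<close>.\<close>

theorem wd_commute:
  assumes fj: "wd j f fj" and fk: "wd k f fk" and g: "wd j fk g"
  shows "wd k fj g"
proof (rule wdI)
  fix \<phi> :: "'a \<Rightarrow> real" assume \<phi>: "test_fun UNIV \<phi>"
  let ?F = "\<lambda>s. cls (\<lambda>x. f (x + s *\<^sub>R j))" and ?K = "\<lambda>s. cls (\<lambda>x. fk (x + s *\<^sub>R j))"
  have 1: "((\<lambda>s. cls (dir_deriv k \<phi>) \<bullet> ?F s) has_vector_derivative cls (dir_deriv k \<phi>) \<bullet> cls fj) (at 0)"
    by (rule bounded_linear.has_vector_derivative[OF bounded_linear_inner_right wd_has_vector_derivative[OF fj]])
  have 2: "((\<lambda>s. - cls \<phi> \<bullet> ?K s) has_vector_derivative - cls \<phi> \<bullet> cls g) (at 0)"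
    by (rule bounded_linear.has_vector_derivative[OF bounded_linear_inner_right wd_has_vector_derivative[OF g]])
  have "(\<lambda>s. cls (dir_deriv k \<phi>) \<bullet> ?F s) = (\<lambda>s. - cls \<phi> \<bullet> ?K s)"
    using wdD[OF wd_translation[OF fk] \<phi>] by (simp add: inner_minus_left)
  with vector_derivative_unique_at[OF 1] 2
  show "cls (dir_deriv k \<phi>) \<bullet> cls fj = - (cls \<phi> \<bullet> cls g)" by (simp add: inner_minus_left)
qed (use wd_L2fun[OF fj] wd_L2fun[OF g] in auto)

text \<open>For test functions the classical derivative is the weak one.\<close>

lemma wd_test:
  fixes \<phi> :: "'a::euclidean_space \<Rightarrow> real"
  assumes \<phi>: "test_fun UNIV \<phi>" shows "wd v \<phi> (dir_deriv v \<phi>)"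
proof (rule wdI)
  note d\<phi> = test_fun_dir_deriv[OF \<phi>, of v]
  show "L2fun \<phi>" "L2fun (dir_deriv v \<phi>)" using \<phi> d\<phi> by (auto intro: L2fun_test)
  fix \<psi> :: "'a \<Rightarrow> real" assume \<psi>: "test_fun UNIV \<psi>"
  note d\<psi> = test_fun_dir_deriv[OF \<psi>, of v]
  let ?t = "\<lambda>f s x. f (x + s *\<^sub>R v)"
  let ?p = "\<lambda>x. \<phi> x * \<psi> x"
  have p: "test_fun UNIV ?p" by (rule test_fun_mult[OF \<phi> test_fun_Ck[OF \<psi>]])
  have dp: "dir_deriv v ?p = (\<lambda>x. \<phi> x * dir_deriv v \<psi> x + dir_deriv v \<phi> x * \<psi> x)"
    by (intro ext dir_deriv_mult test_fun_differentiable[OF \<phi>] test_fun_differentiable[OF \<psi>])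
  obtain C R where C: "C \<ge> 0"
    "\<And>t x. \<bar>t\<bar> \<le> 1 \<Longrightarrow> \<bar>dir_deriv v ?p (x + t *\<^sub>R v)\<bar> \<le> C * indicator (cball 0 R) x"
    using test_fun_translates_bound[OF test_fun_dir_deriv[OF p, of v]] by metis
  have pi: "integrable lebesgue ?p"
    by (intro L2fun_mult_integrable L2fun_test \<phi> \<psi>)
  have "((\<lambda>s. LINT x|lebesgue. ?p (x + s *\<^sub>R v)) has_real_derivative
      (LINT x|lebesgue. dir_deriv v ?p (x + 0 *\<^sub>R v))) (at 0)"
  proof (rule has_real_derivative_integral[of 1])
    show "integrable lebesgue (\<lambda>x. ?p (x + t *\<^sub>R v))" for t by (rule integrable_translation[OF pi])
    show "((\<lambda>t. ?p (x + t *\<^sub>R v)) has_real_derivative dir_deriv v ?p (x + t *\<^sub>R v)) (at t)" for t x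
      by (rule has_real_derivative_along[OF test_fun_differentiable[OF p]])
    have "integrable lebesgue (indicator (cball 0 R) :: 'a \<Rightarrow> real)"
      using L2fun_mult_integrable[OF L2fun_indicator_cball L2fun_indicator_cball, of R R]
      by (simp flip: indicator_inter_arith)
    then show "integrable lebesgue (\<lambda>x::'a. C * indicator (cball 0 R) x)" by simp
  qed (use C in auto)
  moreover have "(\<lambda>s. LINT x|lebesgue. ?p (x + s *\<^sub>R v)) = (\<lambda>s. LINT x|lebesgue. ?p x)"
    using integral_translation[OF borel_measurable_integrable[OF pi]] by simp
  ultimately have "((\<lambda>s::real. LINT x|lebesgue. ?p x) has_real_derivative
      (LINT x|lebesgue. dir_deriv v ?p x)) (at 0)" by simp
  then have "(LINT x|lebesgue. dir_deriv v ?p x) = 0"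
    by (rule DERIV_unique[OF _ DERIV_const])
  then have "(LINT x|lebesgue. \<phi> x * dir_deriv v \<psi> x) + (LINT x|lebesgue. dir_deriv v \<phi> x * \<psi> x) = 0"
    unfolding dp by (subst (asm) Bochner_Integration.integral_add)
      (auto intro!: L2fun_mult_integrable L2fun_test \<phi> \<psi> d\<phi> d\<psi>)
  then show "cls (dir_deriv v \<psi>) \<bullet> cls \<phi> = - (cls \<psi> \<bullet> cls (dir_deriv v \<phi>))"
    using \<phi> \<psi> d\<phi> d\<psi> by (simp add: inner_cls L2fun_test mult.commute)
qed

lemma test_fun_mult_L2fun:
  assumes "test_fun UNIV \<phi>" "L2fun f" shows "L2fun (\<lambda>x. \<phi> x * f x)"
proof -
  obtain C where "\<And>x. \<bar>\<phi> x\<bar> \<le> C" using test_fun_bounded[OF assms(1)] by metis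
  then show ?thesis
    by (intro L2fun_bounded_mult[OF assms(2), of _ C])
       (use continuous_lebesgue_measurable[OF test_fun_continuous[OF assms(1)]] in auto)
qed

lemma wd_mult_test:
  assumes \<phi>: "test_fun UNIV \<phi>" and f: "wd v f g"
  shows "wd v (\<lambda>x. \<phi> x * f x) (\<lambda>x. \<phi> x * g x + dir_deriv v \<phi> x * f x)"
proof -
  note L = wd_L2fun[OF f] and d\<phi> = test_fun_dir_deriv[OF \<phi>, of v]
  note L' = test_fun_mult_L2fun[OF \<phi> L(1)] test_fun_mult_L2fun[OF \<phi> L(2)] test_fun_mult_L2fun[OF d\<phi> L(1)]
  show ?thesis
    unfolding wd_def
  proof (intro conjI allI impI)
    fix \<psi> :: "'a \<Rightarrow> real" assume \<psi>: "test_fun UNIV \<psi>"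
    note d\<psi> = test_fun_dir_deriv[OF \<psi>, of v]
    have p: "test_fun UNIV (\<lambda>x. \<phi> x * \<psi> x)" by (rule test_fun_mult[OF \<phi> test_fun_Ck[OF \<psi>]])
    have dp: "dir_deriv v (\<lambda>x. \<phi> x * \<psi> x) = (\<lambda>x. \<phi> x * dir_deriv v \<psi> x + dir_deriv v \<phi> x * \<psi> x)"
      by (intro ext dir_deriv_mult test_fun_differentiable[OF \<phi>] test_fun_differentiable[OF \<psi>])
    note i = L2fun_mult_integrable[OF L2fun_test[OF d\<psi>] L'(1)] L2fun_mult_integrable[OF L2fun_test[OF \<psi>] L'(2)]
      L2fun_mult_integrable[OF L2fun_test[OF \<psi>] L'(3)]
    have "(LINT x|lebesgue. (\<phi> x * dir_deriv v \<psi> x + dir_deriv v \<phi> x * \<psi> x) * f x) = - (LINT x|lebesgue. (\<phi> x * \<psi> x) * g x)"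
      using f[unfolded wd_def, THEN conjunct2, THEN conjunct2, rule_format, OF p] unfolding dp .
    also have "(LINT x|lebesgue. (\<phi> x * dir_deriv v \<psi> x + dir_deriv v \<phi> x * \<psi> x) * f x)
      = (LINT x|lebesgue. dir_deriv v \<psi> x * (\<phi> x * f x)) + (LINT x|lebesgue. \<psi> x * (dir_deriv v \<phi> x * f x))"
      by (subst Bochner_Integration.integral_add[OF i(1) i(3), symmetric]) (simp add: algebra_simps)
    finally show "(LINT x|lebesgue. dir_deriv v \<psi> x * (\<phi> x * f x)) =
        - (LINT x|lebesgue. \<psi> x * (\<phi> x * g x + dir_deriv v \<phi> x * f x))"
      unfolding distrib_left Bochner_Integration.integral_add[OF i(2,3)] by (simp add: mult_ac)
  qed (use L' L2fun_add in auto)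
qed

text \<open>A bounded function with bounded weak derivative multiplies \<open>H\<^sup>1\<close> into \<open>H\<^sup>1\<close>.\<close>

lemma wd_mult_bounded:
  assumes V: "V \<in> borel_measurable lebesgue" "AE x in lebesgue. \<bar>V x\<bar> \<le> C"
    and V': "V' \<in> borel_measurable lebesgue" "AE x in lebesgue. \<bar>V' x\<bar> \<le> C'"
    and weak: "\<And>\<phi>. test_fun UNIV \<phi> \<Longrightarrow> (LINT x|lebesgue. dir_deriv v \<phi> x * V x) = - (LINT x|lebesgue. \<phi> x * V' x)"
    and f: "wd v f g"
  shows "wd v (\<lambda>x. V x * f x) (\<lambda>x. V x * g x + V' x * f x)"
proof (rule wdI)
  note L = wd_L2fun[OF f]
  note LV = L2fun_bounded_mult[OF _ V] and LV' = L2fun_bounded_mult[OF _ V']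
  show "L2fun (\<lambda>x. V x * f x)" "L2fun (\<lambda>x. V x * g x + V' x * f x)"
    using L LV LV' L2fun_add by auto
  fix \<phi> :: "'a \<Rightarrow> real" assume \<phi>: "test_fun UNIV \<phi>"
  note d\<phi> = test_fun_dir_deriv[OF \<phi>, of v]
  have "wd v (\<lambda>x. V x * \<phi> x) (\<lambda>x. V' x * \<phi> x + V x * dir_deriv v \<phi> x)"
    unfolding wd_def
  proof (intro conjI allI impI)
    show "L2fun (\<lambda>x. V x * \<phi> x)" "L2fun (\<lambda>x. V' x * \<phi> x + V x * dir_deriv v \<phi> x)"
      using L2fun_test[OF \<phi>] L2fun_test[OF d\<phi>] LV LV' L2fun_add by auto
    fix \<psi> :: "'a \<Rightarrow> real" assume \<psi>: "test_fun UNIV \<psi>"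
    note d\<psi> = test_fun_dir_deriv[OF \<psi>, of v]
    have p: "test_fun UNIV (\<lambda>x. \<phi> x * \<psi> x)" by (rule test_fun_mult[OF \<phi> test_fun_Ck[OF \<psi>]])
    have dp: "dir_deriv v (\<lambda>x. \<phi> x * \<psi> x) = (\<lambda>x. \<phi> x * dir_deriv v \<psi> x + dir_deriv v \<phi> x * \<psi> x)"
      by (intro ext dir_deriv_mult test_fun_differentiable[OF \<phi>] test_fun_differentiable[OF \<psi>])
    note i = L2fun_mult_integrable[OF L2fun_test[OF d\<psi>] LV[OF L2fun_test[OF \<phi>]]]
      L2fun_mult_integrable[OF L2fun_test[OF \<psi>] LV'[OF L2fun_test[OF \<phi>]]]
      L2fun_mult_integrable[OF L2fun_test[OF \<psi>] LV[OF L2fun_test[OF d\<phi>]]]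
    have "(LINT x|lebesgue. (\<phi> x * dir_deriv v \<psi> x + dir_deriv v \<phi> x * \<psi> x) * V x) = - (LINT x|lebesgue. (\<phi> x * \<psi> x) * V' x)"
      using weak[OF p] unfolding dp .
    also have "(LINT x|lebesgue. (\<phi> x * dir_deriv v \<psi> x + dir_deriv v \<phi> x * \<psi> x) * V x)
      = (LINT x|lebesgue. dir_deriv v \<psi> x * (V x * \<phi> x)) + (LINT x|lebesgue. \<psi> x * (V x * dir_deriv v \<phi> x))"
      by (subst Bochner_Integration.integral_add[OF i(1) i(3), symmetric]) (simp add: algebra_simps)
    finally show "(LINT x|lebesgue. dir_deriv v \<psi> x * (V x * \<phi> x)) =
        - (LINT x|lebesgue. \<psi> x * (V' x * \<phi> x + V x * dir_deriv v \<phi> x))"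
      unfolding distrib_left Bochner_Integration.integral_add[OF i(2,3)] by (simp add: mult_ac)
  qed
  from wd_integration_by_parts[OF this f]
  have 1: "cls (\<lambda>x. V' x * \<phi> x + V x * dir_deriv v \<phi> x) \<bullet> cls f = - (cls (\<lambda>x. V x * \<phi> x) \<bullet> cls g)" .
  have move: "cls (\<lambda>x. W x * h x) \<bullet> cls k = cls h \<bullet> cls (\<lambda>x. W x * k x)"
    if "L2fun (\<lambda>x. W x * h x)" "L2fun (\<lambda>x. W x * k x)" "L2fun h" "L2fun k" for W h k :: "'a \<Rightarrow> real"
    using that by (simp add: inner_cls mult_ac)
  note M = L2fun_test[OF \<phi>] L2fun_test[OF d\<phi>]
  show "cls (dir_deriv v \<phi>) \<bullet> cls (\<lambda>x. V x * f x) = - (cls \<phi> \<bullet> cls (\<lambda>x. V x * g x + V' x * f x))"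
    using 1 move[OF LV'[OF M(1)] LV'[OF L(1)] M(1) L(1)] move[OF LV[OF M(2)] LV[OF L(1)] M(2) L(1)]
      move[OF LV[OF M(1)] LV[OF L(2)] M(1) L(2)]
    by (simp add: cls_add LV LV' L M inner_add_left inner_add_right)
qed

section \<open>Calculus of weak derivatives\<close>

lemma loc_integrable_measurable:
  fixes f :: "'a::euclidean_space \<Rightarrow> 'b::{banach, second_countable_topology}"
  assumes "loc_integrable f" shows "f \<in> borel_measurable lebesgue"
proof (rule borel_measurable_LIMSEQ_metric)
  show "(\<lambda>x. indicator (cball 0 (real n)) x *\<^sub>R f x) \<in> borel_measurable lebesgue" for n
    using assms[unfolded loc_integrable_def set_integrable_def, rule_format, OF compact_cball]
    by (rule borel_measurable_integrable)
  fix x :: 'a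
  obtain n0 where n0: "norm x \<le> real n0" using real_arch_simple by blast
  show "(\<lambda>n. indicator (cball 0 (real n)) x *\<^sub>R f x) \<longlonglongrightarrow> f x"
  proof (rule tendsto_eventually)
    show "\<forall>\<^sub>F n in sequentially. indicator (cball 0 (real n)) x *\<^sub>R f x = f x"
      using eventually_ge_at_top[of n0] by eventually_elim (use n0 in auto)
  qed
qed

lemma integrable_bounded_support_mult:
  fixes f :: "'a::euclidean_space \<Rightarrow> 'b::{banach, second_countable_topology}"
  assumes f: "loc_integrable f" and "compact K" "\<And>x. x \<notin> K \<Longrightarrow> \<phi> x = 0"
    and C: "\<And>x. \<bar>\<phi> x\<bar> \<le> C" and m: "\<phi> \<in> borel_measurable lebesgue"
  shows "integrable lebesgue (\<lambda>x. \<phi> x *\<^sub>R f x)"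
proof (rule Bochner_Integration.integrable_bound)
  have "integrable lebesgue (\<lambda>x. indicator K x *\<^sub>R f x)"
    by (rule f[unfolded loc_integrable_def set_integrable_def, rule_format, OF assms(2)])
  then show "integrable lebesgue (\<lambda>x. C *\<^sub>R (indicator K x *\<^sub>R f x))"
    by (rule integrable_scaleR_right)
  have "C \<ge> 0" using C[of undefined] by linarith
  then show "AE x in lebesgue. norm (\<phi> x *\<^sub>R f x) \<le> norm (C *\<^sub>R (indicator K x *\<^sub>R f x))"
    using C assms(3) by (auto simp: indicator_def intro!: always_eventually mult_right_mono)
qed (use m loc_integrable_measurable[OF f] in measurable)

lemma integrable_test_mult:
  fixes f :: "'a::euclidean_space \<Rightarrow> 'b::{banach, second_countable_topology}"
  assumes f: "loc_integrable f" and \<phi>: "test_fun UNIV \<phi>"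
  shows "integrable lebesgue (\<lambda>x. \<phi> x *\<^sub>R f x)"
proof -
  obtain K where K: "compact K" "\<And>x. x \<notin> K \<Longrightarrow> \<phi> x = 0" using test_fun_supportE[OF \<phi>] by metis
  obtain C where C: "\<And>x. \<bar>\<phi> x\<bar> \<le> C" using test_fun_bounded[OF \<phi>] by metis
  show ?thesis
    by (rule integrable_bounded_support_mult[OF f K C
          continuous_lebesgue_measurable[OF test_fun_continuous[OF \<phi>]]])
qed

lemma loc_integrable_bounded_linear:
  assumes "bounded_linear T" "loc_integrable f" shows "loc_integrable (\<lambda>x. T (f x))"
proof -
  interpret bounded_linear T by fact
  show ?thesis
    using assms(2) integrable_bounded_linear[OF assms(1)]
    by (fastforce simp: loc_integrable_def set_integrable_def scaleR[symmetric] simp del: scaleR)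
qed

lemma loc_integrable_diff: "loc_integrable f \<Longrightarrow> loc_integrable g \<Longrightarrow> loc_integrable (\<lambda>x. f x - g x)"
  by (simp add: loc_integrable_def set_integrable_def scaleR_diff_right)

lemma loc_integrable_L2fun:
  assumes "L2fun f" shows "loc_integrable f"
  unfolding loc_integrable_def set_integrable_def
proof (intro allI impI)
  fix K :: "'a set" assume K: "compact K"
  have "L2fun (indicator K :: 'a \<Rightarrow> real)"
    by (rule L2fun_bounded_support[of _ K 1])
       (use K in \<open>auto simp: indicator_def compact_imp_bounded intro!: lebesgue_measurable_borel
          borel_measurable_indicator borel_closed compact_imp_closed\<close>)
  from L2fun_mult_integrable[OF this assms]
  show "integrable lebesgue (\<lambda>x. indicat_real K x *\<^sub>R f x)" by simp
qed

lemma has_weak_deriv_bounded_linear: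
  fixes f g :: "real^'n::finite \<Rightarrow> 'b::{banach, second_countable_topology}"
    and T :: "'b \<Rightarrow> 'c::{banach, second_countable_topology}"
  assumes T: "bounded_linear T" and f: "has_weak_deriv j f g"
  shows "has_weak_deriv j (\<lambda>x. T (f x)) (\<lambda>x. T (g x))"
  unfolding has_weak_deriv_def
proof (intro conjI allI impI)
  interpret T: bounded_linear T by (rule T)
  have l: "loc_integrable f" "loc_integrable g" using f by (auto simp: has_weak_deriv_def)
  show "loc_integrable (\<lambda>x. T (f x))" "loc_integrable (\<lambda>x. T (g x))"
    using l by (auto intro: loc_integrable_bounded_linear[OF T])
  fix \<phi> :: "real^'n \<Rightarrow> real" assume \<phi>: "test_fun UNIV \<phi>"
  have "(LINT x|lebesgue. dir_deriv (axis j 1) \<phi> x *\<^sub>R f x) = - (LINT x|lebesgue. \<phi> x *\<^sub>R g x)"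
    using f \<phi> by (auto simp: has_weak_deriv_def)
  from arg_cong[OF this, of T]
  show "(LINT x|lebesgue. dir_deriv (axis j 1) \<phi> x *\<^sub>R T (f x)) = - (LINT x|lebesgue. \<phi> x *\<^sub>R T (g x))"
    using integral_bounded_linear[OF T integrable_test_mult[OF l(2) \<phi>]]
      integral_bounded_linear[OF T integrable_test_mult[OF l(1) test_fun_dir_deriv[OF \<phi>, of "axis j 1"]]]
    by (simp add: T.scaleR T.neg)
qed

lemma has_weak_deriv_diff:
  fixes f f' g g' :: "real^'n::finite \<Rightarrow> 'b::{banach, second_countable_topology}"
  assumes f: "has_weak_deriv j f g" and f': "has_weak_deriv j f' g'"
  shows "has_weak_deriv j (\<lambda>x. f x - f' x) (\<lambda>x. g x - g' x)"
  unfolding has_weak_deriv_def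
proof (intro conjI allI impI)
  have l: "loc_integrable f" "loc_integrable g" "loc_integrable f'" "loc_integrable g'"
    using f f' by (auto simp: has_weak_deriv_def)
  show "loc_integrable (\<lambda>x. f x - f' x)" "loc_integrable (\<lambda>x. g x - g' x)"
    using l by (auto intro: loc_integrable_diff)
  fix \<phi> :: "real^'n \<Rightarrow> real" assume \<phi>: "test_fun UNIV \<phi>"
  note d\<phi> = test_fun_dir_deriv[OF \<phi>, of "axis j 1"]
  have "(LINT x|lebesgue. dir_deriv (axis j 1) \<phi> x *\<^sub>R f x) = - (LINT x|lebesgue. \<phi> x *\<^sub>R g x)"
    "(LINT x|lebesgue. dir_deriv (axis j 1) \<phi> x *\<^sub>R f' x) = - (LINT x|lebesgue. \<phi> x *\<^sub>R g' x)"
    using f f' \<phi> by (auto simp: has_weak_deriv_def)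
  then show "(LINT x|lebesgue. dir_deriv (axis j 1) \<phi> x *\<^sub>R (f x - f' x)) = - (LINT x|lebesgue. \<phi> x *\<^sub>R (g x - g' x))"
    using integrable_test_mult[OF l(1) d\<phi>] integrable_test_mult[OF l(3) d\<phi>]
      integrable_test_mult[OF l(2) \<phi>] integrable_test_mult[OF l(4) \<phi>]
    by (simp add: scaleR_diff_right)
qed

lemma has_weak_deriv_cong_AE:
  fixes f f' g :: "real^'n::finite \<Rightarrow> 'b::{banach, second_countable_topology}"
  assumes f: "has_weak_deriv j f g" and f': "loc_integrable f'" "AE x in lebesgue. f x = f' x"
  shows "has_weak_deriv j f' g"
  unfolding has_weak_deriv_def
proof (intro conjI allI impI f'(1))
  have l: "loc_integrable f" "loc_integrable g" using f by (auto simp: has_weak_deriv_def)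
  then show "loc_integrable g" by simp
  fix \<phi> :: "real^'n \<Rightarrow> real" assume \<phi>: "test_fun UNIV \<phi>"
  note d\<phi> = test_fun_dir_deriv[OF \<phi>, of "axis j 1"]
  have "(LINT x|lebesgue. dir_deriv (axis j 1) \<phi> x *\<^sub>R f' x) = (LINT x|lebesgue. dir_deriv (axis j 1) \<phi> x *\<^sub>R f x)"
    using integrable_test_mult[OF l(1) d\<phi>] integrable_test_mult[OF f'(1) d\<phi>] f'(2)
    by (intro integral_cong_AE) (auto elim: eventually_mono)
  then show "(LINT x|lebesgue. dir_deriv (axis j 1) \<phi> x *\<^sub>R f' x) = - (LINT x|lebesgue. \<phi> x *\<^sub>R g x)"
    using f \<phi> by (simp add: has_weak_deriv_def)
qed

lemma has_weak_deriv_unique_real: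
  fixes f g g' :: "real^'n::finite \<Rightarrow> real"
  assumes f: "has_weak_deriv j f g" and f': "has_weak_deriv j f g'"
  shows "AE x in lebesgue. g x = g' x"
proof -
  have l: "loc_integrable g" "loc_integrable g'" using f f' by (auto simp: has_weak_deriv_def)
  have "AE x in lebesgue. g x - g' x = 0"
  proof (rule AE_zero_if_orthogonal_to_test[OF loc_integrable_diff[OF l]])
    show "(\<lambda>x. g x - g' x) \<in> borel_measurable lebesgue"
      using l[THEN loc_integrable_measurable] by measurable
    fix \<phi> :: "real^'n \<Rightarrow> real" assume \<phi>: "test_fun UNIV \<phi>"
    have "(LINT x|lebesgue. \<phi> x *\<^sub>R g x) = (LINT x|lebesgue. \<phi> x *\<^sub>R g' x)"
      using f f' \<phi> by (auto simp: has_weak_deriv_def)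
    then show "(LINT x|lebesgue. \<phi> x * (g x - g' x)) = 0"
      using integrable_test_mult[OF l(1) \<phi>] integrable_test_mult[OF l(2) \<phi>]
      by (simp add: right_diff_distrib)
  qed
  then show ?thesis by eventually_elim simp
qed

lemma has_weak_deriv_unique_complex:
  fixes f g g' :: "real^'n::finite \<Rightarrow> complex"
  assumes "has_weak_deriv j f g" "has_weak_deriv j f g'"
  shows "AE x in lebesgue. g x = g' x"
  using has_weak_deriv_unique_real[OF assms[THEN has_weak_deriv_bounded_linear[OF bounded_linear_Re]]]
    has_weak_deriv_unique_real[OF assms[THEN has_weak_deriv_bounded_linear[OF bounded_linear_Im]]]
  by eventually_elim (simp add: complex_eq_iff)

lemma has_weak_deriv_weak_deriv: "has_weak_deriv j f g \<Longrightarrow> has_weak_deriv j f (weak_deriv j f)"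
  unfolding weak_deriv_def by (rule someI[of "has_weak_deriv j f"])

lemma weak_deriv_eq_real:
  fixes f :: "real^'n::finite \<Rightarrow> real"
  shows "has_weak_deriv j f g \<Longrightarrow> AE x in lebesgue. weak_deriv j f x = g x"
  using has_weak_deriv_unique_real has_weak_deriv_weak_deriv by blast

lemma weak_deriv_eq_complex:
  fixes f :: "real^'n::finite \<Rightarrow> complex"
  shows "has_weak_deriv j f g \<Longrightarrow> AE x in lebesgue. weak_deriv j f x = g x"
  using has_weak_deriv_unique_complex has_weak_deriv_weak_deriv by blast

lemma has_weak_deriv_imp_wd:
  assumes "has_weak_deriv j f g" "L2fun f" "L2fun g" shows "wd (axis j 1) f g"
  using assms by (simp add: has_weak_deriv_def wd_def)

lemma wd_imp_has_weak_deriv: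
  assumes "wd (axis j 1) f g" shows "has_weak_deriv j f g"
  using assms by (auto simp: has_weak_deriv_def wd_def intro: loc_integrable_L2fun)

lemma in_L2_iff: "in_L2 f \<longleftrightarrow> L2fun (\<lambda>x. Re (f x)) \<and> L2fun (\<lambda>x. Im (f x))"
proof
  assume f: "in_L2 f"
  then have n: "L2fun (\<lambda>x. norm (f x))" by (auto simp: in_L2_def L2fun_def)
  have m: "(\<lambda>x. Re (f x)) \<in> borel_measurable lebesgue" "(\<lambda>x. Im (f x)) \<in> borel_measurable lebesgue"
    using f by (auto simp: in_L2_def)
  show "L2fun (\<lambda>x. Re (f x)) \<and> L2fun (\<lambda>x. Im (f x))"
    using L2fun_dominated[OF n m(1), of 1] L2fun_dominated[OF n m(2), of 1]
    by (simp add: abs_Re_le_cmod abs_Im_le_cmod)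
next
  assume *: "L2fun (\<lambda>x. Re (f x)) \<and> L2fun (\<lambda>x. Im (f x))"
  then have "f \<in> borel_measurable lebesgue"
    by (simp add: borel_measurable_complex_iff L2fun_def)
  with * show "in_L2 f"
    unfolding in_L2_def by (auto simp: cmod_power2 L2fun_def)
qed

lemma in_L2_norm: "in_L2 f \<Longrightarrow> L2fun (\<lambda>x. norm (f x))"
  by (auto simp: in_L2_def L2fun_def)

subsection \<open>The modulus\<close>

lemma wd_limit:
  assumes "\<And>n. wd v (f n) (g n)" "L2fun F" "L2fun G"
    and "(\<lambda>n. cls (f n)) \<longlonglongrightarrow> cls F" "(\<lambda>n. cls (g n)) \<longlonglongrightarrow> cls G"
  shows "wd v F G"
proof (rule wdI[OF assms(2,3)])
  fix \<phi> :: "'a \<Rightarrow> real" assume \<phi>: "test_fun UNIV \<phi>"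
  have "(\<lambda>n. cls (dir_deriv v \<phi>) \<bullet> cls (f n)) \<longlonglongrightarrow> cls (dir_deriv v \<phi>) \<bullet> cls F"
    by (intro tendsto_intros assms)
  moreover have "(\<lambda>n. cls (dir_deriv v \<phi>) \<bullet> cls (f n)) \<longlonglongrightarrow> - (cls \<phi> \<bullet> cls G)"
    unfolding wdD[OF assms(1) \<phi>] by (intro tendsto_intros assms)
  ultimately show "cls (dir_deriv v \<phi>) \<bullet> cls F = - (cls \<phi> \<bullet> cls G)"
    by (rule LIMSEQ_unique)
qed

text \<open>The second-order remainder of \<open>(a, b) \<mapsto> sqrt (a\<^sup>2 + b\<^sup>2 + \<epsilon>\<^sup>2)\<close>.\<close>

lemma sqrt_sum_squares_taylor:
  fixes a b c d \<epsilon> :: real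
  assumes "\<epsilon> > 0"
  defines "P \<equiv> sqrt (a\<^sup>2 + b\<^sup>2 + \<epsilon>\<^sup>2)" and "Q \<equiv> sqrt (c\<^sup>2 + d\<^sup>2 + \<epsilon>\<^sup>2)"
  shows "\<bar>Q - P - (a / P * (c - a) + b / P * (d - b))\<bar> \<le> ((c - a)\<^sup>2 + (d - b)\<^sup>2) / (2 * \<epsilon>)"
proof -
  have P: "P \<ge> \<epsilon>" "P\<^sup>2 = a\<^sup>2 + b\<^sup>2 + \<epsilon>\<^sup>2" and Q: "Q \<ge> \<epsilon>" "Q\<^sup>2 = c\<^sup>2 + d\<^sup>2 + \<epsilon>\<^sup>2"
    using assms(1) by (auto simp: P_def Q_def intro!: real_le_rsqrt)
  \<comment> \<open>The remainder equals \<open>E / P\<close>; \<open>0 \<le> E\<close> is the Cauchy-Schwarz inequality for \<open>(a, b, \<epsilon>)\<close> and \<open>(c, d, \<epsilon>)\<close>.\<close>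
  define E where "E = Q * P - (a * c + b * d + \<epsilon>\<^sup>2)"
  have "(Q - P)\<^sup>2 \<ge> 0" by simp
  then have E1: "2 * E \<le> (c - a)\<^sup>2 + (d - b)\<^sup>2"
    unfolding E_def using P(2) Q(2) by (simp add: power2_eq_square algebra_simps)
  have "(a * c + b * d + \<epsilon>\<^sup>2)\<^sup>2 \<le> (Q * P)\<^sup>2"
  proof -
    have "(Q * P)\<^sup>2 - (a * c + b * d + \<epsilon>\<^sup>2)\<^sup>2 = (a * d - b * c)\<^sup>2 + (\<epsilon> * (a - c))\<^sup>2 + (\<epsilon> * (b - d))\<^sup>2"
      unfolding power_mult_distrib P(2) Q(2) by (simp add: power2_eq_square algebra_simps)
    then show ?thesis by (smt (verit) zero_le_power2)
  qed
  then have E2: "E \<ge> 0"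
    unfolding E_def using P(1) Q(1) assms(1) abs_le_square_iff[of "a * c + b * d + \<epsilon>\<^sup>2" "Q * P"] by auto
  have "Q - P - (a / P * (c - a) + b / P * (d - b)) = E / P"
  proof -
    have "E = Q * P - P\<^sup>2 - (a * (c - a) + b * (d - b))"
      unfolding E_def P(2) by (simp add: power2_eq_square algebra_simps)
    then show ?thesis
      using P(1) assms(1) by (simp add: power2_eq_square diff_divide_distrib add_divide_distrib)
  qed
  moreover have "E / P \<le> ((c - a)\<^sup>2 + (d - b)\<^sup>2) / 2 / \<epsilon>"
    using E1 E2 P(1) assms(1) by (intro frac_le) auto
  ultimately show ?thesis
    using E2 P(1) assms(1) by simp
qed

text \<open>The chain rule for the smooth function \<open>sqrt (a\<^sup>2 + b\<^sup>2 + \<epsilon>\<^sup>2) - \<epsilon>\<close>; the constant is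
  subtracted to stay square integrable.\<close>

lemma wd_regularized_modulus:
  fixes a b :: "'a::euclidean_space \<Rightarrow> real"
  assumes a: "wd v a a'" and b: "wd v b b'" and \<epsilon>: "\<epsilon> > 0"
  defines "N \<equiv> \<lambda>x. sqrt ((a x)\<^sup>2 + (b x)\<^sup>2 + \<epsilon>\<^sup>2)"
  shows "wd v (\<lambda>x. N x - \<epsilon>) (\<lambda>x. a x / N x * a' x + b x / N x * b' x)"
proof (rule wdI)
  note La = wd_L2fun[OF a] and Lb = wd_L2fun[OF b]
  note m = La[THEN L2fun_measurable] Lb[THEN L2fun_measurable]
  have Nm: "N \<in> borel_measurable lebesgue"
    unfolding N_def using m by measurable
  have N: "N x \<ge> \<epsilon>" "N x \<le> sqrt ((a x)\<^sup>2 + (b x)\<^sup>2) + \<epsilon>" "\<bar>a x\<bar> \<le> N x" "\<bar>b x\<bar> \<le> N x" for x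
    using \<epsilon> sqrt_add_le_add_sqrt[of "(a x)\<^sup>2 + (b x)\<^sup>2" "\<epsilon>\<^sup>2"]
    by (auto simp: N_def intro!: real_le_rsqrt)
  have "L2fun (\<lambda>x. \<bar>a x\<bar> + \<bar>b x\<bar>)"
    by (intro L2fun_add L2fun_dominated[OF La(1), of _ 1] L2fun_dominated[OF Lb(1), of _ 1]) (use m in auto)
  then show M: "L2fun (\<lambda>x. N x - \<epsilon>)"
  proof (rule L2fun_dominated[of _ _ 1])
    show "(\<lambda>x. N x - \<epsilon>) \<in> borel_measurable lebesgue" using Nm by measurable
    have "\<bar>N x - \<epsilon>\<bar> \<le> \<bar>a x\<bar> + \<bar>b x\<bar>" for x
      using N(1,2)[of x] sqrt_sum_squares_le_sum_abs[of "a x" "b x"] by linarith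
    then show "AE x in lebesgue. \<bar>N x - \<epsilon>\<bar> \<le> 1 * \<bar>\<bar>a x\<bar> + \<bar>b x\<bar>\<bar>" by simp
  qed
  have qm: "(\<lambda>x. a x / N x) \<in> borel_measurable lebesgue" "(\<lambda>x. b x / N x) \<in> borel_measurable lebesgue"
    using m Nm by measurable
  have qb: "\<bar>a x / N x\<bar> \<le> 1" "\<bar>b x / N x\<bar> \<le> 1" for x
    using N[of x] \<epsilon> by (auto simp: abs_divide divide_le_eq)
  have qL: "L2fun (\<lambda>x. a x / N x * f x)" "L2fun (\<lambda>x. b x / N x * f x)" if "L2fun f" for f
    using L2fun_bounded_mult[OF that qm(1), of 1] L2fun_bounded_mult[OF that qm(2), of 1] qb by auto
  show D: "L2fun (\<lambda>x. a x / N x * a' x + b x / N x * b' x)"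
    by (intro L2fun_add qL La Lb)
  fix \<phi> :: "'a \<Rightarrow> real" assume \<phi>: "test_fun UNIV \<phi>"
  obtain C where C: "C \<ge> 0" "\<And>x. \<bar>\<phi> x\<bar> \<le> C" using test_fun_bounded[OF \<phi>] by metis
  let ?t = "\<lambda>f s. cls (\<lambda>x. f (x + s *\<^sub>R v))"
  let ?M = "\<lambda>x. N x - \<epsilon>" and ?D = "\<lambda>x. a x / N x * a' x + b x / N x * b' x"
  have der1: "((\<lambda>s. cls \<phi> \<bullet> ?t ?M s) has_real_derivative - (cls (dir_deriv v \<phi>) \<bullet> cls ?M)) (at 0)"
  proof -
    have eq: "cls \<phi> \<bullet> ?t ?M s = cls (\<lambda>x. \<phi> (x + s *\<^sub>R (- v))) \<bullet> cls ?M" for s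
      using inner_cls_shift[OF L2fun_test[OF \<phi>] M, of "s *\<^sub>R v"] by simp
    have "dir_deriv (- v) \<phi> y = - dir_deriv v \<phi> y" for y
      using linear_neg[OF has_derivative_linear[OF has_derivative_dir_deriv[OF test_fun_differentiable[OF \<phi>]]]] by blast
    then have "cls (\<lambda>x. dir_deriv (- v) \<phi> (x + 0 *\<^sub>R (- v))) = - cls (dir_deriv v \<phi>)"
      using cls_cmult[OF L2fun_test[OF test_fun_dir_deriv[OF \<phi>]], of "-1" v] by simp
    then show ?thesis
      unfolding eq using integral_test_translates_derivative[OF \<phi> M, of "- v" 0] by (simp add: inner_minus_left)
  qed
  \<comment> \<open>The linear part of the increment is handled by the norm derivatives of \<open>a\<close> and \<open>b\<close>, the
    remainder is quadratic in the increments.\<close>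
  define ra rb where "ra s = ?t a s - cls a" and "rb s = ?t b s - cls b" for s
  have ders: "((\<lambda>s. ?t a s) has_vector_derivative cls a') (at 0)" "((\<lambda>s. ?t b s) has_vector_derivative cls b') (at 0)"
    using wd_has_vector_derivative[OF a] wd_has_vector_derivative[OF b] .
  then have rders: "(ra has_vector_derivative cls a') (at 0)" "(rb has_vector_derivative cls b') (at 0)"
    unfolding ra_def rb_def by (auto intro!: derivative_eq_intros)
  have r0: "ra 0 = 0" "rb 0 = 0" by (auto simp: ra_def rb_def)
  define g where "g s = C / (2 * \<epsilon>) * (ra s \<bullet> ra s + rb s \<bullet> rb s)" for s
  have g: "(g has_real_derivative 0) (at 0)"
  proof -
    have "((\<lambda>s. C / (2 * \<epsilon>) * (ra s \<bullet> ra s + rb s \<bullet> rb s)) has_vector_derivative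
      C / (2 * \<epsilon>) * ((ra 0 \<bullet> cls a' + cls a' \<bullet> ra 0) + (rb 0 \<bullet> cls b' + cls b' \<bullet> rb 0))) (at 0)"
      by (intro bounded_linear.has_vector_derivative[OF bounded_linear_mult_right] has_vector_derivative_add
          bounded_bilinear.has_vector_derivative[OF bounded_bilinear_inner] rders)
    then show ?thesis
      unfolding g_def[abs_def] by (simp add: r0 has_real_derivative_iff_has_vector_derivative)
  qed
  let ?X = "cls (\<lambda>x. a x / N x * \<phi> x)" and ?Y = "cls (\<lambda>x. b x / N x * \<phi> x)"
  define E where "E s = cls \<phi> \<bullet> ?t ?M s - cls \<phi> \<bullet> cls ?M - (?X \<bullet> ra s + ?Y \<bullet> rb s)" for s
  have E_bound: "\<bar>E s\<bar> \<le> g s" for s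
  proof -
    define \<delta>a \<delta>b where "\<delta>a x = a (x + s *\<^sub>R v) - a x" and "\<delta>b x = b (x + s *\<^sub>R v) - b x" for x
    define \<delta> where "\<delta> x = N (x + s *\<^sub>R v) - N x" for x
    have L\<delta>: "L2fun \<delta>a" "L2fun \<delta>b" "L2fun \<delta>"
      using L2fun_diff[OF L2fun_translation[OF La(1)] La(1)] L2fun_diff[OF L2fun_translation[OF Lb(1)] Lb(1)]
        L2fun_diff[OF L2fun_translation[OF M] M]
      by (auto simp: \<delta>a_def[abs_def] \<delta>b_def[abs_def] \<delta>_def[abs_def])
    have r: "ra s = cls \<delta>a" "rb s = cls \<delta>b" and \<delta>: "?t ?M s - cls ?M = cls \<delta>"
      using cls_diff[OF L2fun_translation[OF La(1)] La(1)] cls_diff[OF L2fun_translation[OF Lb(1)] Lb(1)]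
        cls_diff[OF L2fun_translation[OF M] M, of "s *\<^sub>R v"]
      by (auto simp: ra_def rb_def \<delta>a_def[abs_def] \<delta>b_def[abs_def] \<delta>_def[abs_def])
    note i = L2fun_mult_integrable[OF L2fun_test[OF \<phi>] L\<delta>(3)]
      L2fun_mult_integrable[OF qL(1)[OF L2fun_test[OF \<phi>]] L\<delta>(1)]
      L2fun_mult_integrable[OF qL(2)[OF L2fun_test[OF \<phi>]] L\<delta>(2)]
    have "E s = cls \<phi> \<bullet> cls \<delta> - (?X \<bullet> cls \<delta>a + ?Y \<bullet> cls \<delta>b)"
      by (simp add: E_def r inner_diff_right flip: \<delta>)
    also have "\<dots> = (LINT x|lebesgue. \<phi> x * \<delta> x - (a x / N x * \<phi> x * \<delta>a x + b x / N x * \<phi> x * \<delta>b x))"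
      unfolding inner_cls[OF L2fun_test[OF \<phi>] L\<delta>(3)]
        inner_cls[OF qL(1)[OF L2fun_test[OF \<phi>]] L\<delta>(1)]
        inner_cls[OF qL(2)[OF L2fun_test[OF \<phi>]] L\<delta>(2)]
      using i by simp
    finally have E: "E s = \<dots>" .
    have "\<bar>E s\<bar> \<le> (LINT x|lebesgue. \<bar>\<phi> x * \<delta> x - (a x / N x * \<phi> x * \<delta>a x + b x / N x * \<phi> x * \<delta>b x)\<bar>)"
      unfolding E by (rule integral_abs_bound)
    also have "\<dots> \<le> (LINT x|lebesgue. C / (2 * \<epsilon>) * ((\<delta>a x)\<^sup>2 + (\<delta>b x)\<^sup>2))"
    proof (rule integral_mono)
      show "integrable lebesgue (\<lambda>x. \<bar>\<phi> x * \<delta> x - (a x / N x * \<phi> x * \<delta>a x + b x / N x * \<phi> x * \<delta>b x)\<bar>)"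
        by (intro integrable_abs Bochner_Integration.integrable_diff Bochner_Integration.integrable_add i)
      show "integrable lebesgue (\<lambda>x. C / (2 * \<epsilon>) * ((\<delta>a x)\<^sup>2 + (\<delta>b x)\<^sup>2))"
        by (intro integrable_mult_right Bochner_Integration.integrable_add L2fun_integrable_sq L\<delta>)
      fix x
      have "\<phi> x * \<delta> x - (a x / N x * \<phi> x * \<delta>a x + b x / N x * \<phi> x * \<delta>b x)
          = \<phi> x * (\<delta> x - (a x / N x * \<delta>a x + b x / N x * \<delta>b x))"
        by (simp add: algebra_simps)
      also have "\<bar>\<dots>\<bar> \<le> C * (((\<delta>a x)\<^sup>2 + (\<delta>b x)\<^sup>2) / (2 * \<epsilon>))"
        unfolding abs_mult
        using sqrt_sum_squares_taylor[OF \<epsilon>, of "a (x + s *\<^sub>R v)" "b (x + s *\<^sub>R v)" "a x" "b x"]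
        by (intro mult_mono C) (simp_all add: \<delta>_def \<delta>a_def \<delta>b_def N_def C)
      finally show "\<bar>\<phi> x * \<delta> x - (a x / N x * \<phi> x * \<delta>a x + b x / N x * \<phi> x * \<delta>b x)\<bar>
          \<le> C / (2 * \<epsilon>) * ((\<delta>a x)\<^sup>2 + (\<delta>b x)\<^sup>2)" by simp
    qed
    also have "\<dots> = g s"
      unfolding g_def r
      by (simp add: inner_cls L\<delta> L2fun_integrable_sq flip: power2_eq_square)
    finally show ?thesis .
  qed
  have E: "(E has_real_derivative 0) (at 0)"
    unfolding has_field_derivative_iff
  proof (rule Lim_null_comparison)
    show "(\<lambda>s. \<bar>(g s - g 0) / (s - 0)\<bar>) \<midarrow>0\<rightarrow> 0"
      using g unfolding has_field_derivative_iff by (rule tendsto_rabs_zero)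
    have "E 0 = 0" by (simp add: E_def r0)
    moreover have "g 0 = 0" by (simp add: g_def r0)
    ultimately show "\<forall>\<^sub>F s in at 0. norm ((E s - E 0) / (s - 0)) \<le> \<bar>(g s - g 0) / (s - 0)\<bar>"
      using E_bound by (intro always_eventually allI) (auto simp: abs_divide intro!: divide_right_mono order_trans[OF E_bound])
  qed
  have der2: "((\<lambda>s. cls \<phi> \<bullet> ?t ?M s) has_real_derivative (cls \<phi> \<bullet> cls ?D)) (at 0)"
  proof -
    have "((\<lambda>s. cls \<phi> \<bullet> cls ?M + (?X \<bullet> ra s + ?Y \<bullet> rb s) + E s) has_vector_derivative
        0 + (?X \<bullet> cls a' + ?Y \<bullet> cls b') + 0) (at 0)"
      by (intro has_vector_derivative_add has_vector_derivative_const rders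
          bounded_linear.has_vector_derivative[OF bounded_linear_inner_right]
          E[unfolded has_real_derivative_iff_has_vector_derivative])
    moreover have "cls \<phi> \<bullet> cls ?M + (?X \<bullet> ra s + ?Y \<bullet> rb s) + E s = cls \<phi> \<bullet> ?t ?M s" for s
      by (simp add: E_def)
    moreover have "cls \<phi> \<bullet> cls ?D = ?X \<bullet> cls a' + ?Y \<bullet> cls b'"
      unfolding cls_add[OF qL(1)[OF La(2)] qL(2)[OF Lb(2)]] inner_add_right
        inner_cls[OF L2fun_test[OF \<phi>] qL(1)[OF La(2)]] inner_cls[OF L2fun_test[OF \<phi>] qL(2)[OF Lb(2)]]
        inner_cls[OF qL(1)[OF L2fun_test[OF \<phi>]] La(2)] inner_cls[OF qL(2)[OF L2fun_test[OF \<phi>]] Lb(2)]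
      by (simp add: mult_ac)
    ultimately show ?thesis by (simp add: has_real_derivative_iff_has_vector_derivative)
  qed
  show "cls (dir_deriv v \<phi>) \<bullet> cls ?M = - (cls \<phi> \<bullet> cls ?D)"
    using DERIV_unique[OF der1 der2] by simp
qed

text \<open>The weak gradient of the modulus \<open>sqrt (a\<^sup>2 + b\<^sup>2)\<close> of \<open>a + \<i> b\<close>. Where both functions
  vanish the gradient is set to \<open>0\<close>, the value of the division by \<open>0\<close>.\<close>

theorem wd_modulus:
  fixes a b :: "'a::euclidean_space \<Rightarrow> real"
  assumes a: "wd v a a'" and b: "wd v b b'"
  shows "wd v (\<lambda>x. sqrt ((a x)\<^sup>2 + (b x)\<^sup>2)) (\<lambda>x. (a x * a' x + b x * b' x) / sqrt ((a x)\<^sup>2 + (b x)\<^sup>2))"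
    (is "wd v ?F ?G")
proof -
  note La = wd_L2fun[OF a] and Lb = wd_L2fun[OF b]
  note m = La[THEN L2fun_measurable] Lb[THEN L2fun_measurable]
  have abs2: "L2fun (\<lambda>x. \<bar>f x\<bar> + \<bar>g x\<bar>)" if "L2fun f" "L2fun g" for f g :: "'a \<Rightarrow> real"
    by (intro L2fun_add L2fun_dominated[OF that(1), of _ 1] L2fun_dominated[OF that(2), of _ 1])
       (use that[THEN L2fun_measurable] in auto)
  define \<epsilon> where "\<epsilon> n = inverse (real (Suc n))" for n
  have \<epsilon>: "\<epsilon> n > 0" "\<epsilon> \<longlonglongrightarrow> 0" for n
    unfolding \<epsilon>_def using LIMSEQ_inverse_real_of_nat by auto
  define N where "N n x = sqrt ((a x)\<^sup>2 + (b x)\<^sup>2 + (\<epsilon> n)\<^sup>2)" for n x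
  define G where "G n x = a x / N n x * a' x + b x / N n x * b' x" for n x
  have w: "wd v (\<lambda>x. N n x - \<epsilon> n) (G n)" for n
    using wd_regularized_modulus[OF a b \<epsilon>(1)[of n]] unfolding N_def G_def .
  have Nlim: "(\<lambda>n. N n x) \<longlonglongrightarrow> ?F x" for x
  proof -
    have "(\<lambda>n. N n x) \<longlonglongrightarrow> sqrt ((a x)\<^sup>2 + (b x)\<^sup>2 + 0\<^sup>2)"
      unfolding N_def by (intro tendsto_intros \<epsilon>)
    then show ?thesis by simp
  qed
  have Glim: "(\<lambda>n. G n x) \<longlonglongrightarrow> ?G x" for x
  proof (cases "?F x = 0")
    case True
    then have "a x = 0" "b x = 0" by (auto simp: sum_power2_eq_zero_iff)
    then show ?thesis by (simp add: G_def)
  next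
    case False
    have "(\<lambda>n. G n x) \<longlonglongrightarrow> a x / ?F x * a' x + b x / ?F x * b' x"
      unfolding G_def by (intro tendsto_intros Nlim False)
    then show ?thesis by (simp add: add_divide_distrib)
  qed
  have N: "\<epsilon> n \<le> N n x" "N n x \<le> ?F x + \<epsilon> n" "\<bar>a x\<bar> \<le> N n x" "\<bar>b x\<bar> \<le> N n x" for n x
    using \<epsilon>(1)[of n] sqrt_add_le_add_sqrt[of "(a x)\<^sup>2 + (b x)\<^sup>2" "(\<epsilon> n)\<^sup>2"]
    by (auto simp: N_def intro!: real_le_rsqrt)
  have Nb: "\<bar>N n x - \<epsilon> n\<bar> \<le> \<bar>\<bar>a x\<bar> + \<bar>b x\<bar>\<bar>" for n x
    using N(1,2)[where n=n and x=x] sqrt_sum_squares_le_sum_abs[of "a x" "b x"] by linarith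
  have Gb: "\<bar>G n x\<bar> \<le> \<bar>\<bar>a' x\<bar> + \<bar>b' x\<bar>\<bar>" for n x
  proof -
    have "\<bar>a x / N n x\<bar> \<le> 1" "\<bar>b x / N n x\<bar> \<le> 1"
      using N[where n=n and x=x] \<epsilon>(1)[of n] by (auto simp: abs_divide divide_le_eq)
    from this[THEN mult_right_mono, OF abs_ge_zero[of "a' x"]] this[THEN mult_right_mono, OF abs_ge_zero[of "b' x"]]
    have "\<bar>a x / N n x * a' x\<bar> \<le> \<bar>a' x\<bar>" "\<bar>b x / N n x * b' x\<bar> \<le> \<bar>b' x\<bar>"
      by (simp_all only: abs_mult mult_1)
    then show ?thesis unfolding G_def by linarith
  qed
  have LF: "L2fun ?F"
    by (rule L2fun_dominated[OF abs2[OF La(1) Lb(1)], of _ 1])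
       (use m sqrt_sum_squares_le_sum_abs in \<open>auto\<close>)
  have "\<bar>?G x\<bar> \<le> \<bar>\<bar>a' x\<bar> + \<bar>b' x\<bar>\<bar>" for x
    by (rule Lim_bounded[OF tendsto_rabs[OF Glim]]) (use Gb in auto)
  then have LG: "L2fun ?G"
    by (intro L2fun_dominated[OF abs2[OF La(2) Lb(2)], of _ 1]) (use m in auto)
  show ?thesis
  proof (rule wd_limit[OF w LF LG])
    have "(\<lambda>n. N n x - \<epsilon> n) \<longlonglongrightarrow> ?F x - 0" for x
      by (intro tendsto_intros Nlim \<epsilon>)
    then show "(\<lambda>n. cls (\<lambda>x. N n x - \<epsilon> n)) \<longlonglongrightarrow> cls ?F"
      by (intro cls_tendsto[OF wd_L2fun(1)[OF w] LF abs2[OF La(1) Lb(1)]] always_eventually allI Nb) simp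
    show "(\<lambda>n. cls (G n)) \<longlonglongrightarrow> cls ?G"
      by (intro cls_tendsto[OF wd_L2fun(2)[OF w] LG abs2[OF La(2) Lb(2)]] always_eventually allI Gb Glim)
  qed
qed

section \<open>Continuous curves in Sobolev spaces\<close>

lemma in_H_2D:
  assumes "in_H 2 f"
  shows "in_L2 f" "in_L2 (weak_deriv j f)" "in_L2 (weak_deriv k (weak_deriv j f))"
    and "has_weak_deriv j f (weak_deriv j f)"
    and "has_weak_deriv k (weak_deriv j f) (weak_deriv k (weak_deriv j f))"
  using assms by (auto simp: numeral_2_eq_2 weakly_diff_def intro: has_weak_deriv_weak_deriv)

text \<open>The squared \<open>L\<^sup>2\<close> distance of complex-valued functions.\<close>

definition sq_dist :: "(real^'n::finite \<Rightarrow> complex) \<Rightarrow> (real^'n \<Rightarrow> complex) \<Rightarrow> real" where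
  "sq_dist f g = (LINT x|lebesgue. (norm (f x - g x))\<^sup>2)"

lemma H_norm_sq_nonneg: "0 \<le> H_norm_sq k f"
  by (induction k arbitrary: f) (auto intro!: add_nonneg_nonneg sum_nonneg)

lemma sq_dist_le_H_norm_sq:
  fixes f g :: "real^'n::finite \<Rightarrow> complex"
  assumes f: "in_H 2 f" and g: "in_H 2 g"
  defines "N \<equiv> H_norm_sq 2 (\<lambda>x. f x - g x)"
  shows "sq_dist f g \<le> N" "sq_dist (weak_deriv j f) (weak_deriv j g) \<le> N"
    "sq_dist (weak_deriv k (weak_deriv j f)) (weak_deriv k (weak_deriv j g)) \<le> N"
proof -
  let ?D = "\<lambda>x. f x - g x"
  let ?D1 = "\<lambda>j x. weak_deriv j f x - weak_deriv j g x"
  let ?D2 = "\<lambda>j k x. weak_deriv k (weak_deriv j f) x - weak_deriv k (weak_deriv j g) x"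
  have d1: "has_weak_deriv j ?D (?D1 j)" for j
    by (intro has_weak_deriv_diff in_H_2D f g)
  have d2: "has_weak_deriv k (?D1 j) (?D2 j k)" for j k
    by (intro has_weak_deriv_diff in_H_2D f g)
  have e1: "AE x in lebesgue. weak_deriv j ?D x = ?D1 j x" for j
    by (rule weak_deriv_eq_complex[OF d1])
  have w1: "has_weak_deriv j ?D (weak_deriv j ?D)" for j
    by (rule has_weak_deriv_weak_deriv[OF d1])
  have d2': "has_weak_deriv k (weak_deriv j ?D) (?D2 j k)" for j k
    by (rule has_weak_deriv_cong_AE[OF d2])
       (use w1[of j] e1[of j] in \<open>auto simp: has_weak_deriv_def elim: eventually_mono\<close>)
  have e2: "AE x in lebesgue. weak_deriv k (weak_deriv j ?D) x = ?D2 j k x" for j k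
    by (rule weak_deriv_eq_complex[OF d2'])
  have m: "h \<in> borel_measurable lebesgue" "h' \<in> borel_measurable lebesgue"
    if "has_weak_deriv j h h'" for j and h h' :: "real^'n \<Rightarrow> complex"
    using that by (auto simp: has_weak_deriv_def loc_integrable_measurable)
  have i1: "(LINT x|lebesgue. (norm (weak_deriv j ?D x))\<^sup>2) = sq_dist (weak_deriv j f) (weak_deriv j g)" for j
    unfolding sq_dist_def using m(2)[OF w1[of j]] m(2)[OF d1[of j]] e1[of j]
    by (intro integral_cong_AE) (auto elim: eventually_mono)
  have i2: "(LINT x|lebesgue. (norm (weak_deriv k (weak_deriv j ?D) x))\<^sup>2)
      = sq_dist (weak_deriv k (weak_deriv j f)) (weak_deriv k (weak_deriv j g))" for j k
    unfolding sq_dist_def using m(2)[OF has_weak_deriv_weak_deriv[OF d2'[of k j]]] m(2)[OF d2'[of k j]] e2[of k j]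
    by (intro integral_cong_AE) (auto elim: eventually_mono)
  let ?S1 = "\<lambda>j. sq_dist (weak_deriv j f) (weak_deriv j g)"
  let ?S2 = "\<lambda>j k. sq_dist (weak_deriv k (weak_deriv j f)) (weak_deriv k (weak_deriv j g))"
  have N: "N = sq_dist f g + (\<Sum>j\<in>UNIV. ?S1 j + (\<Sum>k\<in>UNIV. ?S2 j k))"
    unfolding N_def numeral_2_eq_2 by (simp add: i1 i2) (simp add: sq_dist_def)
  have pos: "sq_dist h h' \<ge> 0" for h h' :: "real^'n \<Rightarrow> complex" by (simp add: sq_dist_def)
  have S: "?S1 j + (\<Sum>k\<in>UNIV. ?S2 j k) \<le> (\<Sum>j\<in>UNIV. ?S1 j + (\<Sum>k\<in>UNIV. ?S2 j k))"
    by (rule member_le_sum) (auto intro!: add_nonneg_nonneg sum_nonneg pos)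
  have S2: "?S2 j k \<le> (\<Sum>k\<in>UNIV. ?S2 j k)"
    by (rule member_le_sum) (auto intro!: pos)
  have S20: "0 \<le> (\<Sum>k\<in>UNIV. ?S2 j k)" by (intro sum_nonneg pos)
  show "sq_dist f g \<le> N" using N S pos S20 pos[of "weak_deriv j f" "weak_deriv j g"] by linarith
  show "?S1 j \<le> N" using N S pos[of f g] S20 by linarith
  show "?S2 j k \<le> N" using N S S2 pos[of f g] pos[of "weak_deriv j f" "weak_deriv j g"] by linarith
qed

lemma continuous_curve_sq_dist:
  assumes c: "continuous_curve_H 2 \<tau> \<psi>" and t: "t \<in> {0..<\<tau>}"
  shows "((\<lambda>s. sq_dist (\<psi> s) (\<psi> t)) \<longlongrightarrow> 0) (at t within {0..<\<tau>})"
    and "((\<lambda>s. sq_dist (weak_deriv j (\<psi> s)) (weak_deriv j (\<psi> t))) \<longlongrightarrow> 0) (at t within {0..<\<tau>})"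
    and "((\<lambda>s. sq_dist (weak_deriv k (weak_deriv j (\<psi> s))) (weak_deriv k (weak_deriv j (\<psi> t)))) \<longlongrightarrow> 0) (at t within {0..<\<tau>})"
proof -
  have H: "in_H 2 (\<psi> s)" if "s \<in> {0..<\<tau>}" for s
    using c that by (auto simp: continuous_curve_H_def)
  have "((\<lambda>s. (sqrt (H_norm_sq 2 (\<lambda>x. \<psi> s x - \<psi> t x)))\<^sup>2) \<longlongrightarrow> 0\<^sup>2) (at t within {0..<\<tau>})"
    using c t unfolding continuous_curve_H_def by (intro tendsto_power) auto
  then have N: "((\<lambda>s. H_norm_sq 2 (\<lambda>x. \<psi> s x - \<psi> t x)) \<longlongrightarrow> 0) (at t within {0..<\<tau>})"
    by (simp add: H_norm_sq_nonneg)
  have *: "(f \<longlongrightarrow> 0) (at t within {0..<\<tau>})"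
    if "\<And>s. s \<in> {0..<\<tau>} \<Longrightarrow> 0 \<le> f s \<and> f s \<le> H_norm_sq 2 (\<lambda>x. \<psi> s x - \<psi> t x)" for f :: "real \<Rightarrow> real"
    by (rule tendsto_sandwich[OF _ _ tendsto_const N])
       (use that in \<open>auto simp: eventually_at_filter\<close>)
  show "((\<lambda>s. sq_dist (\<psi> s) (\<psi> t)) \<longlongrightarrow> 0) (at t within {0..<\<tau>})"
    "((\<lambda>s. sq_dist (weak_deriv j (\<psi> s)) (weak_deriv j (\<psi> t))) \<longlongrightarrow> 0) (at t within {0..<\<tau>})"
    "((\<lambda>s. sq_dist (weak_deriv k (weak_deriv j (\<psi> s))) (weak_deriv k (weak_deriv j (\<psi> t)))) \<longlongrightarrow> 0) (at t within {0..<\<tau>})"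
    using sq_dist_le_H_norm_sq[OF H H[OF t]] by (auto intro!: * simp: sq_dist_def)
qed

lemma in_L2_diff: "in_L2 f \<Longrightarrow> in_L2 g \<Longrightarrow> in_L2 (\<lambda>x. f x - g x)"
  by (simp add: in_L2_iff L2fun_diff)

lemma power2_norm_cls_norm: "in_L2 f \<Longrightarrow> (norm (cls (\<lambda>x. norm (f x))))\<^sup>2 = (LINT x|lebesgue. (norm (f x))\<^sup>2)"
  by (simp add: power2_norm_cls in_L2_norm)

lemma cls_norm_diff_tendsto:
  assumes "\<And>s. s \<in> I \<Longrightarrow> in_L2 (f s)" "t \<in> I" "((\<lambda>s. sq_dist (f s) (f t)) \<longlongrightarrow> 0) (at t within I)"
  shows "((\<lambda>s. norm (cls (\<lambda>x. norm (f s x - f t x)))) \<longlongrightarrow> 0) (at t within I)"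
proof -
  have "((\<lambda>s. sqrt (sq_dist (f s) (f t))) \<longlongrightarrow> 0) (at t within I)"
    using tendsto_real_sqrt[OF assms(3)] by simp
  moreover have "sqrt (sq_dist (f s) (f t)) = norm (cls (\<lambda>x. norm (f s x - f t x)))" if "s \<in> I" for s
    using power2_norm_cls_norm[OF in_L2_diff[OF assms(1)[OF that] assms(1)[OF assms(2)]]]
    unfolding sq_dist_def by (rule real_sqrt_unique) simp
  ultimately show ?thesis
    by (elim Lim_transform_eventually) (auto simp: eventually_at_filter)
qed

lemma cls_part_tendsto:
  assumes f: "\<And>s. s \<in> I \<Longrightarrow> in_L2 (f s)" and t: "t \<in> I"
    and lim: "((\<lambda>s. sq_dist (f s) (f t)) \<longlongrightarrow> 0) (at t within I)"
    and T: "T = Re \<or> T = Im"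
  shows "((\<lambda>s. cls (\<lambda>x. T (f s x))) \<longlongrightarrow> cls (\<lambda>x. T (f t x))) (at t within I)"
proof (rule LIM_zero_cancel, rule Lim_null_comparison[OF _ cls_norm_diff_tendsto[OF f t lim]])
  have L: "L2fun (\<lambda>x. T (f s x))" if "s \<in> I" for s
    using f[OF that] T by (auto simp: in_L2_iff)
  have "norm (cls (\<lambda>x. T (f s x)) - cls (\<lambda>x. T (f t x))) \<le> 1 * norm (cls (\<lambda>x. norm (f s x - f t x)))"
    if "s \<in> I" for s
    unfolding cls_diff[OF L[OF that] L[OF t], symmetric]
  proof (rule norm_cls_mono)
    have "\<bar>T (f s x) - T (f t x)\<bar> \<le> 1 * \<bar>norm (f s x - f t x)\<bar>" for x
      using T abs_Re_le_cmod[of "f s x - f t x"] abs_Im_le_cmod[of "f s x - f t x"] by auto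
    then show "AE x in lebesgue. \<bar>T (f s x) - T (f t x)\<bar> \<le> 1 * \<bar>norm (f s x - f t x)\<bar>" by simp
  qed (use L2fun_diff[OF L[OF that] L[OF t]] in_L2_norm[OF in_L2_diff[OF f[OF that] f[OF t]]] in auto)
  then show "\<forall>\<^sub>F s in at t within I. norm (cls (\<lambda>x. T (f s x)) - cls (\<lambda>x. T (f t x)))
      \<le> norm (cls (\<lambda>x. norm (f s x - f t x)))"
    by (auto simp: eventually_at_filter)
qed

lemma norm_sgn_diff_le: "norm (sgn z - sgn w) \<le> 2 * norm (z - w) / norm w" if "w \<noteq> 0" for z w :: complex
proof (cases "z = 0")
  case False
  have eq: "(sgn z - sgn w) * of_real (norm w) = sgn z * of_real (norm w - norm z) + (z - w)"
    using False that by (simp add: sgn_eq algebra_simps)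
  have "norm (sgn z - sgn w) * norm w = norm (sgn z * of_real (norm w - norm z) + (z - w))"
    unfolding eq[symmetric] norm_mult by simp
  also have "\<dots> \<le> norm (sgn z * of_real (norm w - norm z)) + norm (z - w)" by (rule norm_triangle_ineq)
  also have "\<dots> \<le> 2 * norm (z - w)"
    using False norm_triangle_ineq3[of w z]
    by (simp add: norm_mult norm_sgn norm_minus_commute flip: of_real_diff)
  finally show ?thesis using that by (simp add: pos_le_divide_eq)
qed (use that in \<open>simp add: norm_sgn\<close>)

text \<open>For the limit point \<open>f t\<close> vanishing almost nowhere, \<open>Re (cnj (sgn (f s)) * g s)\<close> depends
  continuously on \<open>(f s, g s)\<close>. On \<open>{norm (g t) \<le> K * norm (f t)}\<close> the phase \<open>sgn\<close> is controlled by a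
  Lipschitz bound; the rest of \<open>g t\<close> is small for large \<open>K\<close>.\<close>

lemma sgn_pairing_tendsto:
  fixes f g :: "real \<Rightarrow> real^'n::finite \<Rightarrow> complex"
  assumes f: "\<And>s. s \<in> I \<Longrightarrow> in_L2 (f s)" and g: "\<And>s. s \<in> I \<Longrightarrow> in_L2 (g s)" and t: "t \<in> I"
    and flim: "((\<lambda>s. sq_dist (f s) (f t)) \<longlongrightarrow> 0) (at t within I)"
    and glim: "((\<lambda>s. sq_dist (g s) (g t)) \<longlongrightarrow> 0) (at t within I)"
    and nz: "AE x in lebesgue. f t x \<noteq> 0"
  defines "r \<equiv> \<lambda>s x. Re (cnj (sgn (f s x)) * g s x)"
  shows "((\<lambda>s. cls (r s)) \<longlongrightarrow> cls (r t)) (at t within I)"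
proof -
  have m: "f s \<in> borel_measurable lebesgue" "g s \<in> borel_measurable lebesgue" if "s \<in> I" for s
    using f[OF that] g[OF that] by (auto simp: in_L2_def)
  have rL: "L2fun (r s)" if "s \<in> I" for s
  proof (rule L2fun_dominated[OF in_L2_norm[OF g[OF that]], of _ 1])
    have "(\<lambda>x. sgn (f s x)) \<in> borel_measurable lebesgue"
      unfolding sgn_div_norm using m[OF that] by measurable
    moreover have "(\<lambda>x. cnj (sgn (f s x))) \<in> borel_measurable lebesgue"
      by (rule measurable_compose[OF calculation]) (intro borel_measurable_continuous_onI continuous_intros)
    ultimately show "r s \<in> borel_measurable lebesgue"
      unfolding r_def using m[OF that] by measurable
    have "\<bar>r s x\<bar> \<le> 1 * \<bar>norm (g s x)\<bar>" for x
      using abs_Re_le_cmod[of "cnj (sgn (f s x)) * g s x"] by (auto simp: r_def norm_mult norm_sgn split: if_splits)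
    then show "AE x in lebesgue. \<bar>r s x\<bar> \<le> 1 * \<bar>norm (g s x)\<bar>" by simp
  qed
  define h where "h n x = (if norm (g t x) > real n * norm (f t x) then norm (g t x) else 0)" for n x
  have hm: "h n \<in> borel_measurable lebesgue" for n
    unfolding h_def using m[OF t] by measurable
  have hL: "L2fun (h n)" for n
    by (rule L2fun_dominated[OF in_L2_norm[OF g[OF t]] hm, of _ 1]) (auto simp: h_def)
  have h0: "(\<lambda>n. cls (h n)) \<longlonglongrightarrow> 0"
    unfolding cls_zero[symmetric]
  proof (rule cls_tendsto[OF hL L2fun_zero in_L2_norm[OF g[OF t]]])
    show "AE x in lebesgue. (\<lambda>n. h n x) \<longlonglongrightarrow> 0"
      using nz
    proof eventually_elim
      case (elim x)
      obtain n0 where n0: "norm (g t x) / norm (f t x) \<le> real n0" using real_arch_simple by blast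
      have "\<forall>\<^sub>F n in sequentially. h n x = 0"
        using eventually_ge_at_top[of n0]
      proof eventually_elim
        case (elim n)
        then have "norm (g t x) / norm (f t x) \<le> real n" using n0 by linarith
        then show ?case using \<open>f t x \<noteq> 0\<close> by (auto simp: h_def pos_divide_le_eq)
      qed
      then show ?case by (rule tendsto_eventually)
    qed
  qed (auto simp: h_def)
  have pw: "\<bar>r s x - r t x\<bar> \<le> norm (g s x - g t x) + 2 * real n * norm (f s x - f t x) + 2 * h n x"
    if nz: "f t x \<noteq> 0" for s x n
  proof -
    have "r s x - r t x = Re (cnj (sgn (f s x)) * (g s x - g t x)) + Re (cnj (sgn (f s x) - sgn (f t x)) * g t x)"
      by (simp add: r_def algebra_simps)
    moreover have "\<bar>Re (cnj (sgn (f s x)) * (g s x - g t x))\<bar> \<le> norm (g s x - g t x)"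
      using abs_Re_le_cmod[of "cnj (sgn (f s x)) * (g s x - g t x)"] by (auto simp: norm_mult norm_sgn split: if_splits)
    moreover have "\<bar>Re (cnj (sgn (f s x) - sgn (f t x)) * g t x)\<bar> \<le> norm (sgn (f s x) - sgn (f t x)) * norm (g t x)"
      using abs_Re_le_cmod[of "cnj (sgn (f s x) - sgn (f t x)) * g t x"]
      by (metis complex_mod_cnj norm_mult)
    moreover have "norm (sgn (f s x) - sgn (f t x)) * norm (g t x) \<le> 2 * real n * norm (f s x - f t x) + 2 * h n x"
    proof (cases "norm (g t x) > real n * norm (f t x)")
      case True
      have "norm (sgn (f s x) - sgn (f t x)) \<le> 2"
        using norm_triangle_ineq4[of "sgn (f s x)" "sgn (f t x)"] by (auto simp: norm_sgn split: if_splits)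
      then have "norm (sgn (f s x) - sgn (f t x)) * norm (g t x) \<le> 2 * norm (g t x)"
        by (rule mult_right_mono) simp
      moreover have "0 \<le> 2 * real n * norm (f s x - f t x)" by simp
      moreover have "h n x = norm (g t x)" using True by (simp add: h_def)
      ultimately show ?thesis by linarith
    next
      case False
      have "norm (sgn (f s x) - sgn (f t x)) * norm (g t x)
          \<le> (2 * norm (f s x - f t x) / norm (f t x)) * (real n * norm (f t x))"
        using False norm_sgn_diff_le[OF nz, of "f s x"] by (intro mult_mono) auto
      also have "\<dots> = 2 * real n * norm (f s x - f t x)" using nz by simp
      finally show ?thesis using False by (simp add: h_def)
    qed
    ultimately show ?thesis by linarith
  qed
  let ?F = "\<lambda>s. cls (\<lambda>x. norm (f s x - f t x))" and ?G = "\<lambda>s. cls (\<lambda>x. norm (g s x - g t x))"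
  have est: "norm (cls (r s) - cls (r t)) \<le> norm (?G s) + 2 * real n * norm (?F s) + 2 * norm (cls (h n))"
    if s: "s \<in> I" for s n
  proof -
    note Lf = in_L2_norm[OF in_L2_diff[OF f[OF s] f[OF t]]] and Lg = in_L2_norm[OF in_L2_diff[OF g[OF s] g[OF t]]]
    have L: "L2fun (\<lambda>x. norm (g s x - g t x) + 2 * real n * norm (f s x - f t x) + 2 * h n x)"
      by (intro L2fun_add L2fun_cmult Lf Lg hL)
    have "norm (cls (\<lambda>x. r s x - r t x)) \<le> 1 * norm (cls (\<lambda>x. norm (g s x - g t x) + 2 * real n * norm (f s x - f t x) + 2 * h n x))"
    proof (rule norm_cls_mono[OF L2fun_diff[OF rL[OF s] rL[OF t]] L])
      show "AE x in lebesgue. \<bar>r s x - r t x\<bar> \<le> 1 * \<bar>norm (g s x - g t x) + 2 * real n * norm (f s x - f t x) + 2 * h n x\<bar>"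
        using nz by eventually_elim (use pw in \<open>fastforce intro: order_trans[OF _ abs_ge_self]\<close>)
    qed simp
    also have "cls (\<lambda>x. norm (g s x - g t x) + 2 * real n * norm (f s x - f t x) + 2 * h n x)
        = ?G s + (2 * real n) *\<^sub>R ?F s + 2 *\<^sub>R cls (h n)"
      by (simp add: cls_add cls_cmult L2fun_add L2fun_cmult Lf Lg hL)
    also have "1 * norm (?G s + (2 * real n) *\<^sub>R ?F s + 2 *\<^sub>R cls (h n))
        \<le> norm (?G s) + norm ((2 * real n) *\<^sub>R ?F s) + norm (2 *\<^sub>R cls (h n))"
      using norm_triangle_ineq[of "?G s + (2 * real n) *\<^sub>R ?F s" "2 *\<^sub>R cls (h n)"]
        norm_triangle_ineq[of "?G s" "(2 * real n) *\<^sub>R ?F s"] by linarith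
    finally show ?thesis by (simp add: cls_diff[OF rL[OF s] rL[OF t]])
  qed
  show ?thesis
  proof (rule tendstoI)
    fix e :: real assume e: "e > 0"
    obtain n where n: "norm (cls (h n)) < e / 4"
      using LIMSEQ_D[OF h0, of "e/4"] e by auto
    have "((\<lambda>s. norm (?G s) + 2 * real n * norm (?F s)) \<longlongrightarrow> 0 + 2 * real n * 0) (at t within I)"
      by (intro tendsto_intros cls_norm_diff_tendsto f g t flim glim)
    then have "((\<lambda>s. norm (?G s) + 2 * real n * norm (?F s)) \<longlongrightarrow> 0) (at t within I)" by simp
    from order_tendstoD(2)[OF this, of "e/2"] e
    have "\<forall>\<^sub>F s in at t within I. norm (?G s) + 2 * real n * norm (?F s) < e / 2" by simp
    moreover have "\<forall>\<^sub>F s in at t within I. s \<in> I" by (simp add: eventually_at_filter)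
    ultimately show "\<forall>\<^sub>F s in at t within I. dist (cls (r s)) (cls (r t)) < e"
    proof eventually_elim
      case (elim s)
      then show ?case using est[OF elim(2), of n] n by (simp add: dist_norm)
    qed
  qed
qed

lemma bounded_mult_tendsto:
  assumes V: "V \<in> borel_measurable lebesgue" "AE x in lebesgue. \<bar>V x\<bar> \<le> C"
    and f: "\<And>s. s \<in> I \<Longrightarrow> L2fun (f s)" and t: "t \<in> I"
    and lim: "((\<lambda>s. cls (f s)) \<longlongrightarrow> cls (f t)) (at t within I)"
  shows "((\<lambda>s. cls (\<lambda>x. V x * f s x)) \<longlongrightarrow> cls (\<lambda>x. V x * f t x)) (at t within I)"
proof (rule LIM_zero_cancel, rule Lim_null_comparison)
  show "((\<lambda>s. \<bar>C\<bar> * norm (cls (f s) - cls (f t))) \<longlongrightarrow> 0) (at t within I)"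
    using tendsto_mult_left[OF tendsto_norm[OF LIM_zero[OF lim]], of "\<bar>C\<bar>"] by simp
  have V': "AE x in lebesgue. \<bar>V x\<bar> \<le> \<bar>C\<bar>" using V(2) by eventually_elim simp
  note L = L2fun_bounded_mult[OF _ V]
  have "norm (cls (\<lambda>x. V x * f s x) - cls (\<lambda>x. V x * f t x)) \<le> \<bar>C\<bar> * norm (cls (f s) - cls (f t))"
    if s: "s \<in> I" for s
    unfolding cls_diff[OF f[OF s] f[OF t], symmetric] cls_diff[OF L[OF f[OF s]] L[OF f[OF t]], symmetric]
  proof (rule norm_cls_mono)
    show "AE x in lebesgue. \<bar>V x * f s x - V x * f t x\<bar> \<le> \<bar>C\<bar> * \<bar>f s x - f t x\<bar>"
      using V' by eventually_elim (simp add: abs_mult mult_right_mono flip: right_diff_distrib)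
  qed (use L f s t in \<open>auto intro!: L2fun_diff\<close>)
  then show "\<forall>\<^sub>F s in at t within I. norm (cls (\<lambda>x. V x * f s x) - cls (\<lambda>x. V x * f t x)) \<le> \<bar>C\<bar> * norm (cls (f s) - cls (f t))"
    by (auto simp: eventually_at_filter)
qed

section \<open>Weak time derivatives\<close>

text \<open>The lemma of du Bois-Reymond: a continuous function whose distributional derivative is
  continuous is classically differentiable.\<close>

lemma weak_derivative_imp_derivative:
  fixes p q :: "real \<Rightarrow> real"
  assumes p: "continuous_on {0<..<\<tau>} p" and q: "continuous_on {0<..<\<tau>} q"
    and weak: "\<And>\<theta>. test_fun {0<..<\<tau>} \<theta> \<Longrightarrow>
      (LINT t:{0..<\<tau>}|lebesgue. dir_deriv 1 \<theta> t * p t) = - (LINT t:{0..<\<tau>}|lebesgue. \<theta> t * q t)"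
    and s: "s \<in> {0<..<\<tau>}"
  shows "(p has_real_derivative q s) (at s)"
  unfolding has_field_derivative_def has_derivative_at_alt
proof (intro conjI allI impI)
  show "bounded_linear ((*) (q s))" by (rule bounded_linear_mult_right)
  fix e :: real assume e: "e > 0"
  have qs: "isCont q s" "open {0<..<\<tau>}"
    using q s by (auto simp: continuous_on_eq_continuous_at)
  then obtain d1 where d1: "d1 > 0" "\<And>t. dist t s < d1 \<Longrightarrow> dist (q t) (q s) < e"
    using e unfolding continuous_at_eps_delta by metis
  obtain d2 where d2: "d2 > 0" "ball s d2 \<subseteq> {0<..<\<tau>}"
    using s qs(2) unfolding open_contains_ball by blast
  define d where "d = min d1 d2 / 3"
  have d: "d > 0" "3 * d \<le> d1" "3 * d \<le> d2" using d1 d2 by (auto simp: d_def)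
  let ?J = "{s - 2 * d .. s + 2 * d}"
  have J: "?J \<subseteq> {0<..<\<tau>}" "\<And>t. t \<in> ?J \<Longrightarrow> \<bar>q t - q s\<bar> < e"
  proof -
    have J1: "\<bar>t - s\<bar> < 3 * d" if "t \<in> ?J" for t using that d(1) by (auto simp: abs_less_iff)
    have "?J \<subseteq> ball s d2" using J1 d(3) by (force simp: dist_real_def)
    then show "?J \<subseteq> {0<..<\<tau>}" using d2(2) by blast
    show "\<And>t. t \<in> ?J \<Longrightarrow> \<bar>q t - q s\<bar> < e" using J1 d(2) d1(2) by (force simp: dist_real_def)
  qed
  have cut: "L2fun (\<lambda>t. indicator ?J t * f t)" if f: "continuous_on {0<..<\<tau>} f" for f :: "real \<Rightarrow> real"
  proof -
    have fJ: "continuous_on ?J f" using f J(1) continuous_on_subset by blast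
    obtain B where B: "\<forall>y\<in>f ` ?J. norm y \<le> B"
      using compact_imp_bounded[OF compact_continuous_image[OF fJ compact_Icc]]
      unfolding bounded_iff by blast
    show ?thesis
    proof (rule L2fun_bounded_support[of _ ?J "\<bar>B\<bar>"])
      have "(\<lambda>t. indicator ?J t *\<^sub>R f t) \<in> borel_measurable borel"
        by (rule borel_measurable_continuous_on_indicator[OF _ fJ]) simp
      then show "(\<lambda>t. indicator ?J t * f t) \<in> borel_measurable lebesgue"
        by (intro lebesgue_measurable_borel) simp
      show "\<bar>indicator ?J t * f t\<bar> \<le> \<bar>B\<bar>" for t using B by (auto simp: indicator_def intro: order_trans[OF _ abs_ge_self])
    qed auto
  qed
  define p0 q0 where "p0 t = indicator ?J t * p t" and "q0 t = indicator ?J t * q t" for t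
  have L: "L2fun p0" "L2fun q0" using cut[OF p] cut[OF q] by (simp_all add: p0_def[abs_def] q0_def[abs_def])
  have main: "\<bar>p z - p s - q s * (z - s)\<bar> \<le> e * \<bar>z - s\<bar>" if z: "\<bar>z - s\<bar> < d" for z
  proof (rule field_le_epsilon)
    fix \<eta> :: real assume \<eta>: "\<eta> > 0"
    have near: "\<exists>\<delta>>0. \<forall>t. \<bar>t - y\<bar> < \<delta> \<longrightarrow> \<bar>p t - p y\<bar> < \<eta> / 2" if "\<bar>y - s\<bar> < d" for y
    proof -
      have "y \<in> {0<..<\<tau>}" using that J(1) d(1) by (auto simp: abs_less_iff subset_iff)
      then have "isCont p y" using p by (auto simp: continuous_on_eq_continuous_at)
      then show ?thesis using \<eta> unfolding continuous_at_eps_delta dist_real_def by (metis half_gt_zero)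
    qed
    obtain \<delta>1 \<delta>2 where \<delta>12: "\<delta>1 > 0" "\<delta>2 > 0" "\<And>t. \<bar>t - z\<bar> < \<delta>1 \<Longrightarrow> \<bar>p t - p z\<bar> < \<eta> / 2"
      "\<And>t. \<bar>t - s\<bar> < \<delta>2 \<Longrightarrow> \<bar>p t - p s\<bar> < \<eta> / 2"
      using near[OF z] near[of s] d(1) by auto
    define \<delta> where "\<delta> = min (min \<delta>1 \<delta>2) d"
    have \<delta>: "\<delta> > 0" "\<delta> \<le> \<delta>1" "\<delta> \<le> \<delta>2" "\<delta> \<le> d" using \<delta>12 d by (auto simp: \<delta>_def)
    \<comment> \<open>A nonnegative kernel supported in \<open>[-\<delta>, \<delta>]\<close>. The weighted average of \<open>p\<close> around a point is
      differentiable, with the average of \<open>q\<close> as derivative, and differs from \<open>p\<close> by at most \<open>\<eta> / 2\<close> at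
      \<open>s\<close> and \<open>z\<close>.\<close>
    define \<theta> where "\<theta> = box_bump 1 (-\<delta>) \<delta>"
    have \<theta>: "test_fun UNIV \<theta>" "\<And>t. \<theta> t \<ge> 0" "\<And>t. \<bar>t\<bar> \<ge> \<delta> \<Longrightarrow> \<theta> t = 0" "\<And>t. \<bar>t\<bar> < \<delta> \<Longrightarrow> \<theta> t > 0"
      unfolding \<theta>_def by (auto simp: box_bump_bounds test_fun_box_bump intro!: box_bump_outside box_bump_pos)
    define c where "c = (LINT t|lebesgue. \<theta> t)"
    have \<theta>m: "\<theta> \<in> borel_measurable lebesgue"
      by (rule continuous_lebesgue_measurable[OF test_fun_continuous[OF \<theta>(1)]])
    have L1: "loc_integrable (\<lambda>t::real. 1::real)"
      unfolding loc_integrable_def set_integrable_def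
      using lmeasurable_compact lmeasurable_iff_integrable by (auto simp del: integrable_indicator_iff)
    have \<theta>i: "integrable lebesgue \<theta>"
      using integrable_test_mult[OF L1 \<theta>(1)] by simp
    have \<theta>s: "integrable lebesgue (\<lambda>t. \<theta> (t - y))" for y
      using integrable_translation[OF \<theta>i, of "- y"] by simp
    have cs: "(LINT t|lebesgue. \<theta> (t - y)) = c" for y
      using integral_translation[OF \<theta>m, of "- y"] by (simp add: c_def)
    have c: "c > 0"
    proof -
      have "c \<noteq> 0"
      proof
        assume "c = 0"
        then have "AE t in lebesgue. \<theta> t = 0"
          using integral_nonneg_eq_0_iff_AE[OF \<theta>i] \<theta>(2) by (auto simp: c_def)
        then have "AE t in lebesgue. t \<notin> {-\<delta><..<\<delta>}"
          by eventually_elim (use \<theta>(4) in \<open>force simp: abs_less_iff\<close>)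
        then have "emeasure lebesgue {-\<delta><..<\<delta>} = 0"
          by (intro null_setsD1 AE_iff_null_sets[THEN iffD2]) auto
        then show False using \<delta>(1) by simp
      qed
      moreover have "c \<ge> 0" unfolding c_def using \<theta>(2) by simp
      ultimately show ?thesis by simp
    qed
    have test_y: "L2fun (\<lambda>t. \<theta> (t - y))" for y
      using L2fun_translation[OF L2fun_test[OF \<theta>(1)], of "- y"] by simp
    have avg: "\<bar>cls (\<lambda>t. \<theta> (t - y)) \<bullet> cls f - K * c\<bar> \<le> \<omega> * c"
      if f: "L2fun f" and "\<And>t. \<bar>t - y\<bar> < \<delta> \<Longrightarrow> \<bar>f t - K\<bar> \<le> \<omega>" for f y K \<omega>
    proof -
      have i: "integrable lebesgue (\<lambda>t. \<theta> (t - y) * f t)"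
        by (rule L2fun_mult_integrable[OF test_y f])
      have "cls (\<lambda>t. \<theta> (t - y)) \<bullet> cls f - K * c = (LINT t|lebesgue. \<theta> (t - y) * f t - K * \<theta> (t - y))"
        using i \<theta>s by (simp add: inner_cls test_y f cs)
      also have "\<bar>\<dots>\<bar> \<le> (LINT t|lebesgue. \<bar>\<theta> (t - y) * f t - K * \<theta> (t - y)\<bar>)"
        by (rule integral_abs_bound)
      also have "\<dots> \<le> (LINT t|lebesgue. \<omega> * \<theta> (t - y))"
      proof (rule integral_mono)
        show "\<bar>\<theta> (t - y) * f t - K * \<theta> (t - y)\<bar> \<le> \<omega> * \<theta> (t - y)" for t
        proof (cases "\<bar>t - y\<bar> < \<delta>")
          case True
          have "\<theta> (t - y) * f t - K * \<theta> (t - y) = (f t - K) * \<theta> (t - y)" by (simp add: algebra_simps)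
          then show ?thesis using that(2)[OF True] \<theta>(2)[of "t - y"] by (simp add: abs_mult mult_right_mono)
        qed (simp add: \<theta>(3))
      qed (use i \<theta>s in auto)
      finally show ?thesis by (simp add: cs)
    qed
    have P: "((\<lambda>y. cls (\<lambda>t. \<theta> (t - y)) \<bullet> cls p0) has_real_derivative cls (\<lambda>t. \<theta> (t - y)) \<bullet> cls q0) (at y)"
      if y: "\<bar>y - s\<bar> < d" for y
    proof -
      have inJ: "t \<in> ?J" if "\<theta> (t - y) \<noteq> 0 \<or> dir_deriv v \<theta> (t - y) \<noteq> 0" for t v
      proof -
        have "dir_deriv v \<theta> r = 0" if "\<bar>r\<bar> > \<delta>" for r
          by (rule dir_deriv_zero_outside[of "{-\<delta>..\<delta>}"]) (use \<theta>(3) that in \<open>auto simp: abs_if split: if_splits\<close>)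
        then have "\<bar>t - y\<bar> \<le> \<delta>" using that \<theta>(3)[of "t - y"] by (metis linorder_not_less less_imp_le)
        then show ?thesis using y \<delta>(4) by (auto simp: abs_if split: if_splits)
      qed
      have T: "test_fun {0<..<\<tau>} (\<lambda>t. \<theta> (t - y))"
        using test_fun_translation(1)[OF \<theta>(1), of "- y"] inJ J(1)
        by (intro test_funI[of _ ?J]) (auto dest: test_fun_Ck)
      have d1: "dir_deriv 1 (\<lambda>t. \<theta> (t - y)) t = dir_deriv 1 \<theta> (t - y)" for t
        using test_fun_translation(2)[OF \<theta>(1), of 1 "- y"] by (simp add: fun_eq_iff)
      have dm: "dir_deriv (- 1) \<theta> r = - dir_deriv 1 \<theta> r" for r
        using linear_neg[OF has_derivative_linear[OF has_derivative_dir_deriv[OF test_fun_differentiable[OF \<theta>(1)]]]] by blast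
      have sub: "t \<in> {0..<\<tau>}" if "t \<in> ?J" for t using J(1) that by force
      have Ld: "L2fun (\<lambda>t. dir_deriv (- 1) \<theta> (t - y))"
        using L2fun_translation[OF L2fun_test[OF test_fun_dir_deriv[OF \<theta>(1)]], of "- 1" "- y"] by simp
      have "cls (\<lambda>t. dir_deriv (- 1) \<theta> (t - y)) \<bullet> cls p0 = - (LINT t:{0..<\<tau>}|lebesgue. dir_deriv 1 (\<lambda>t. \<theta> (t - y)) t * p t)"
        unfolding inner_cls[OF Ld L(1)] set_lebesgue_integral_def integral_minus[symmetric] d1
      proof (intro Bochner_Integration.integral_cong refl)
        fix t
        show "dir_deriv (- 1) \<theta> (t - y) * p0 t = - (indicat_real {0..<\<tau>} t *\<^sub>R (dir_deriv 1 \<theta> (t - y) * p t))"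
          using inJ[of t 1] sub[of t] by (cases "dir_deriv 1 \<theta> (t - y) = 0") (auto simp: dm p0_def)
      qed
      also have "\<dots> = (LINT t:{0..<\<tau>}|lebesgue. \<theta> (t - y) * q t)"
        using weak[OF T] by simp
      also have "\<dots> = cls (\<lambda>t. \<theta> (t - y)) \<bullet> cls q0"
        unfolding inner_cls[OF test_y L(2)] set_lebesgue_integral_def
      proof (intro Bochner_Integration.integral_cong refl)
        fix t
        show "indicat_real {0..<\<tau>} t *\<^sub>R (\<theta> (t - y) * q t) = \<theta> (t - y) * q0 t"
          using inJ[of t 1] sub[of t] by (cases "\<theta> (t - y) = 0") (auto simp: q0_def)
      qed
      finally show ?thesis
        using integral_test_translates_derivative[OF \<theta>(1) L(1), of "- 1" y] by simp
    qed
    let ?P = "\<lambda>y. cls (\<lambda>t. \<theta> (t - y)) \<bullet> cls p0"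
    have inc: "norm ((?P z - z * (q s * c)) - (?P s - s * (q s * c))) \<le> (e * c) * norm (z - s)"
    proof (rule field_differentiable_bound[of "ball s d" _ "\<lambda>y. cls (\<lambda>t. \<theta> (t - y)) \<bullet> cls q0 - q s * c"])
      fix y assume "y \<in> ball s d"
      then have y: "\<bar>y - s\<bar> < d" by (simp add: dist_real_def abs_minus_commute)
      show "((\<lambda>y. ?P y - y * (q s * c)) has_field_derivative cls (\<lambda>t. \<theta> (t - y)) \<bullet> cls q0 - q s * c) (at y within ball s d)"
        using P[OF y] by (auto intro!: derivative_eq_intros intro: has_field_derivative_at_within)
      have "\<bar>q0 t - q s\<bar> \<le> e" if "\<bar>t - y\<bar> < \<delta>" for t
      proof -
        have "t \<in> ?J" using that y \<delta>(4) by (auto simp: abs_if split: if_splits)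
        then show ?thesis using J(2)[of t] by (simp add: q0_def)
      qed
      then show "norm (cls (\<lambda>t. \<theta> (t - y)) \<bullet> cls q0 - q s * c) \<le> e * c"
        unfolding real_norm_def by (rule avg[OF L(2)])
    qed (use z d in \<open>auto simp: dist_real_def abs_minus_commute\<close>)
    have Pp: "\<bar>?P y - p y * c\<bar> \<le> \<eta> / 2 * c" if "y = z \<or> y = s" for y
    proof (rule avg[OF L(1)])
      fix t assume t: "\<bar>t - y\<bar> < \<delta>"
      then have "t \<in> ?J" using that z \<delta>(4) by (auto simp: abs_if split: if_splits)
      then show "\<bar>p0 t - p y\<bar> \<le> \<eta> / 2"
        using that t \<delta> \<delta>12(3)[of t] \<delta>12(4)[of t] by (auto simp: p0_def)
    qed
    have "\<bar>(p z - p s - q s * (z - s)) * c\<bar> \<le> (e * \<bar>z - s\<bar> + \<eta>) * c"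
    proof -
      have "(p z - p s - q s * (z - s)) * c = ((?P z - z * (q s * c)) - (?P s - s * (q s * c))) - (?P z - p z * c) + (?P s - p s * c)"
        by (simp add: algebra_simps)
      also have "\<bar>\<dots>\<bar> \<le> (e * c) * \<bar>z - s\<bar> + \<eta> / 2 * c + \<eta> / 2 * c"
        using inc Pp[of z] Pp[of s] unfolding real_norm_def by linarith
      finally show ?thesis by (simp add: algebra_simps)
    qed
    then show "\<bar>p z - p s - q s * (z - s)\<bar> \<le> e * \<bar>z - s\<bar> + \<eta>"
      using c by (simp add: abs_mult)
  qed
  then show "\<exists>d>0. \<forall>y. norm (y - s) < d \<longrightarrow> norm (p y - p s - q s * (y - s)) \<le> e * norm (y - s)"
    using d(1) by auto
qed

section \<open>The Schroedinger equation in the space of square integrable functions\<close>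

lemma dir_deriv_tensor:
  fixes \<theta> :: "real \<Rightarrow> real" and g :: "'a::euclidean_space \<Rightarrow> real"
  assumes "test_fun \<Omega> \<theta>" "test_fun UNIV g"
  shows "dir_deriv (v, w) (\<lambda>z. \<theta> (fst z) * g (snd z)) = (\<lambda>z. \<theta> (fst z) * dir_deriv w g (snd z) + dir_deriv v \<theta> (fst z) * g (snd z))"
proof
  fix z :: "real \<times> 'a"
  have 1: "((\<lambda>z. \<theta> (fst z)) has_derivative (\<lambda>h. dir_deriv (fst h) \<theta> (fst z))) (at z)"
    using has_derivative_compose[OF has_derivative_fst[OF has_derivative_ident] has_derivative_dir_deriv[OF test_fun_differentiable[OF assms(1)]]] .
  have 2: "((\<lambda>z. g (snd z)) has_derivative (\<lambda>h. dir_deriv (snd h) g (snd z))) (at z)"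
    using has_derivative_compose[OF has_derivative_snd[OF has_derivative_ident] has_derivative_dir_deriv[OF test_fun_differentiable[OF assms(2)]]] .
  show "dir_deriv (v, w) (\<lambda>z. \<theta> (fst z) * g (snd z)) z = \<theta> (fst z) * dir_deriv w g (snd z) + dir_deriv v \<theta> (fst z) * g (snd z)"
    using dir_deriv_eq[OF has_derivative_mult[OF 1 2], of "(v, w)"] by simp
qed

lemma dir_deriv_0: "f differentiable (at x) \<Longrightarrow> dir_deriv 0 f x = 0"
  using linear_0[OF has_derivative_linear[OF has_derivative_dir_deriv]] .

lemma test_fun_tensor:
  fixes \<theta> :: "real \<Rightarrow> real" and g :: "'a::euclidean_space \<Rightarrow> real"
  assumes "test_fun \<Omega> \<theta>" "test_fun UNIV g"
  shows "test_fun (\<Omega> \<times> UNIV) (\<lambda>z. \<theta> (fst z) * g (snd z))"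
proof -
  obtain K where K: "compact K" "K \<subseteq> \<Omega>" "\<And>x. x \<notin> K \<Longrightarrow> \<theta> x = 0" using test_fun_supportE[OF assms(1)] by blast
  obtain K' where K': "compact K'" "\<And>x. x \<notin> K' \<Longrightarrow> g x = 0" using test_fun_supportE[OF assms(2)] by metis
  show ?thesis
  proof (rule test_funI[of _ "K \<times> K'"])
    show "Ck k (\<lambda>z. \<theta> (fst z) * g (snd z))" for k
      using Ck_affine[OF bounded_linear_fst test_fun_Ck[OF assms(1), of k], of 0]
        Ck_affine[OF bounded_linear_snd test_fun_Ck[OF assms(2), of k], of 0]
      by (intro Ck_mult) auto
    show "\<theta> (fst x) * g (snd x) = 0" if "x \<notin> K \<times> K'" for x
      using that K(3) K'(2) by (cases x) auto
  qed (use K K' in \<open>auto intro: compact_Times\<close>)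
qed

lemma set_integrable_test_mult:
  fixes u :: "real \<Rightarrow> real"
  assumes \<theta>: "test_fun {0<..<\<tau>} \<theta>" and u: "continuous_on {0<..<\<tau>} u"
  shows "set_integrable lebesgue {0..<\<tau>} (\<lambda>t. \<theta> t * u t)"
proof -
  obtain K where K: "compact K" "K \<subseteq> {0<..<\<tau>}" "\<And>x. x \<notin> K \<Longrightarrow> \<theta> x = 0" using test_fun_supportE[OF \<theta>] by blast
  have "integrable lborel (\<lambda>t. indicator K t *\<^sub>R (\<theta> t * u t))"
    using K(2) u by (intro borel_integrable_compact K continuous_intros test_fun_continuous[OF \<theta>])
      (auto intro: continuous_on_subset)
  then have "integrable lebesgue (\<lambda>t. indicator K t *\<^sub>R (\<theta> t * u t))"
    by (simp add: integrable_completion borel_measurable_integrable)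
  also have "(\<lambda>t. indicator K t *\<^sub>R (\<theta> t * u t)) = (\<lambda>t. indicator {0..<\<tau>} t *\<^sub>R (\<theta> t * u t))"
    using K(2,3) by (force simp: indicator_def)
  finally show ?thesis by (simp add: set_integrable_def)
qed

lemma integral_Complex:
  fixes u v :: "'a \<Rightarrow> real"
  assumes "integrable M u" "integrable M v"
  shows "(LINT x|M. Complex (u x) (v x)) = Complex (LINT x|M. u x) (LINT x|M. v x)"
  using assms by (simp add: Complex_eq)

lemma set_integral_test_Complex:
  fixes u v :: "real \<Rightarrow> real"
  assumes \<theta>: "test_fun {0<..<\<tau>} \<theta>" and u: "continuous_on {0<..<\<tau>} u" and v: "continuous_on {0<..<\<tau>} v"
  shows "(LINT t:{0..<\<tau>}|lebesgue. \<theta> t *\<^sub>R Complex (u t) (v t)) =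
    Complex (LINT t:{0..<\<tau>}|lebesgue. \<theta> t * u t) (LINT t:{0..<\<tau>}|lebesgue. \<theta> t * v t)"
proof -
  have i: "integrable lebesgue (\<lambda>t. indicator {0..<\<tau>} t * (\<theta> t * u t))"
    "integrable lebesgue (\<lambda>t. indicator {0..<\<tau>} t * (\<theta> t * v t))"
    using set_integrable_test_mult[OF \<theta> u] set_integrable_test_mult[OF \<theta> v] by (simp_all add: set_integrable_def)
  have "(\<lambda>t. indicat_real {0..<\<tau>} t *\<^sub>R \<theta> t *\<^sub>R Complex (u t) (v t))
      = (\<lambda>t. Complex (indicator {0..<\<tau>} t * (\<theta> t * u t)) (indicator {0..<\<tau>} t * (\<theta> t * v t)))"
    by (auto simp: complex_eq_iff fun_eq_iff)
  then show ?thesis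
    unfolding set_lebesgue_integral_def by (simp only: integral_Complex[OF i] real_scaleR_def)
qed

lemma integral_test_complex:
  fixes f :: "'a::euclidean_space \<Rightarrow> complex"
  assumes g: "test_fun UNIV g" and f: "L2fun (\<lambda>x. Re (f x))" "L2fun (\<lambda>x. Im (f x))"
  shows "(LINT x|lebesgue. g x *\<^sub>R f x) = Complex (cls g \<bullet> cls (\<lambda>x. Re (f x))) (cls g \<bullet> cls (\<lambda>x. Im (f x)))"
proof -
  note i = L2fun_mult_integrable[OF L2fun_test[OF g] f(1)] L2fun_mult_integrable[OF L2fun_test[OF g] f(2)]
  have "(\<lambda>x. g x *\<^sub>R f x) = (\<lambda>x. Complex (g x * Re (f x)) (g x * Im (f x)))"
    by (auto simp: complex_eq_iff)
  then show ?thesis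
    by (simp only: integral_Complex[OF i] inner_cls[OF L2fun_test[OF g] f(1)] inner_cls[OF L2fun_test[OF g] f(2)])
qed

text \<open>A family of functions tested with a product of a function of time and a function of space.\<close>

lemma distr_of_tensor:
  fixes f :: "real \<Rightarrow> real^'n::finite \<Rightarrow> complex"
  assumes \<theta>: "test_fun {0<..<\<tau>} \<theta>" and g: "test_fun UNIV g"
    and f: "\<And>t. t \<in> {0..<\<tau>} \<Longrightarrow> L2fun (\<lambda>x. Re (f t x))" "\<And>t. t \<in> {0..<\<tau>} \<Longrightarrow> L2fun (\<lambda>x. Im (f t x))"
    and c: "continuous_on {0..<\<tau>} (\<lambda>t. cls (\<lambda>x. Re (f t x)))" "continuous_on {0..<\<tau>} (\<lambda>t. cls (\<lambda>x. Im (f t x)))"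
  shows "distr_of \<tau> f (\<lambda>z. \<theta> (fst z) * g (snd z)) =
    Complex (LINT t:{0..<\<tau>}|lebesgue. \<theta> t * (cls g \<bullet> cls (\<lambda>x. Re (f t x))))
      (LINT t:{0..<\<tau>}|lebesgue. \<theta> t * (cls g \<bullet> cls (\<lambda>x. Im (f t x))))"
proof -
  have "distr_of \<tau> f (\<lambda>z. \<theta> (fst z) * g (snd z)) =
    (LINT t:{0..<\<tau>}|lebesgue. \<theta> t *\<^sub>R Complex (cls g \<bullet> cls (\<lambda>x. Re (f t x))) (cls g \<bullet> cls (\<lambda>x. Im (f t x))))"
    unfolding distr_of_def
  proof (intro set_lebesgue_integral_cong allI impI)
    fix t assume t: "t \<in> {0..<\<tau>}"
    have "(LINT x|lebesgue. (\<theta> (fst (t, x)) * g (snd (t, x))) *\<^sub>R f t x) = (LINT x|lebesgue. \<theta> t *\<^sub>R (g x *\<^sub>R f t x))"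
      by simp
    also have "\<dots> = \<theta> t *\<^sub>R (LINT x|lebesgue. g x *\<^sub>R f t x)"
      by (rule integral_scaleR_right)
    finally show "(LINT x|lebesgue. (\<theta> (fst (t, x)) * g (snd (t, x))) *\<^sub>R f t x) =
        \<theta> t *\<^sub>R Complex (cls g \<bullet> cls (\<lambda>x. Re (f t x))) (cls g \<bullet> cls (\<lambda>x. Im (f t x)))"
      by (simp add: integral_test_complex[OF g f(1)[OF t] f(2)[OF t]])
  qed simp
  also have "\<dots> = Complex (LINT t:{0..<\<tau>}|lebesgue. \<theta> t * (cls g \<bullet> cls (\<lambda>x. Re (f t x))))
      (LINT t:{0..<\<tau>}|lebesgue. \<theta> t * (cls g \<bullet> cls (\<lambda>x. Im (f t x))))"
    by (rule set_integral_test_Complex[OF \<theta>]; intro continuous_intros continuous_on_subset[OF c(1)] continuous_on_subset[OF c(2)]) auto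
  finally show ?thesis .
qed

lemma set_integral_linear_combination:
  fixes f :: "'i \<Rightarrow> real \<Rightarrow> real"
  assumes "finite J" "\<And>j. j \<in> J \<Longrightarrow> set_integrable M I (f j)" "set_integrable M I g"
  shows "(LINT t:I|M. c * (\<Sum>j\<in>J. f j t) + d * g t) = c * (\<Sum>j\<in>J. LINT t:I|M. f j t) + d * (LINT t:I|M. g t)"
proof -
  define F G where "F j t = indicat_real I t *\<^sub>R f j t" and "G t = indicat_real I t *\<^sub>R g t" for j t
  have eq: "(\<lambda>t. indicat_real I t *\<^sub>R (c * (\<Sum>j\<in>J. f j t) + d * g t)) = (\<lambda>t. c * (\<Sum>j\<in>J. F j t) + d * G t)"
    unfolding F_def G_def scaleR_sum_right[symmetric] by (simp add: algebra_simps)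
  have "integrable M (F j)" if "j \<in> J" for j
    using assms(2)[OF that] by (simp add: F_def[abs_def] set_integrable_def)
  moreover have "integrable M G"
    using assms(3) by (simp add: G_def[abs_def] set_integrable_def)
  ultimately show ?thesis
    unfolding set_lebesgue_integral_def eq unfolding F_def[symmetric] G_def[symmetric] by simp
qed

lemma set_integrable_sum:
  fixes f :: "'i \<Rightarrow> 'a \<Rightarrow> real"
  assumes "\<And>j. j \<in> J \<Longrightarrow> set_integrable M I (f j)"
  shows "set_integrable M I (\<lambda>t. \<Sum>j\<in>J. f j t)"
  using assms
proof (induction J rule: infinite_finite_induct)
  case (insert j J)
  have "set_integrable M I (\<lambda>t. f j t + (\<Sum>j\<in>J. f j t))"
    by (rule set_integral_add(1)) (use insert in auto)
  then show ?case using insert(1,2) by simp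
qed (simp_all add: set_integrable_def)

text \<open>The assumptions on potential and wave function. Only at positive times is the wave function assumed to
  vanish almost nowhere, so arguments at time \<open>0\<close> cannot use it.\<close>

locale schroedinger_flow =
  fixes hbar m \<tau> :: real and V :: "real^'n::finite \<Rightarrow> real" and \<psi> :: "real \<Rightarrow> real^'n \<Rightarrow> complex"
  assumes hbar: "hbar > 0" and m: "m > 0" and \<tau>: "\<tau> > 0"
    and V_W1inf: "in_W1inf V"
    and curve: "continuous_curve_H 2 \<tau> \<psi>"
    and equation: "schroedinger_solution hbar m \<tau> V \<psi>"
    and nonzero: "\<And>t. t \<in> {0<..<\<tau>} \<Longrightarrow> AE x in lebesgue. \<psi> t x \<noteq> 0"
begin

text \<open>Real and imaginary parts of the wave function and of its weak derivatives.\<close>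

definition "a t x = Re (\<psi> t x)"
definition "b t x = Im (\<psi> t x)"
definition "a1 j t x = Re (weak_deriv j (\<psi> t) x)"
definition "b1 j t x = Im (weak_deriv j (\<psi> t) x)"
definition "a2 j k t x = Re (weak_deriv k (weak_deriv j (\<psi> t)) x)"
definition "b2 j k t x = Im (weak_deriv k (weak_deriv j (\<psi> t)) x)"

text \<open>The time derivatives of \<open>a\<close> and \<open>b\<close> prescribed by the equation.\<close>

definition "da t x = - (hbar / (2 * m)) * (\<Sum>j\<in>UNIV. b2 j j t x) + 1 / hbar * (V x * b t x)"
definition "db t x = hbar / (2 * m) * (\<Sum>j\<in>UNIV. a2 j j t x) + (- (1 / hbar)) * (V x * a t x)"

lemma in_H: "t \<in> {0..<\<tau>} \<Longrightarrow> in_H 2 (\<psi> t)"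
  using curve by (auto simp: continuous_curve_H_def)

lemma L2_parts:
  assumes "t \<in> {0..<\<tau>}"
  shows "L2fun (a t)" "L2fun (b t)" "L2fun (a1 j t)" "L2fun (b1 j t)" "L2fun (a2 j k t)" "L2fun (b2 j k t)"
  using in_H_2D(1-3)[OF in_H[OF assms]]
  by (auto simp: in_L2_iff a_def[abs_def] b_def[abs_def] a1_def[abs_def] b1_def[abs_def] a2_def[abs_def] b2_def[abs_def])

lemma wd_parts:
  assumes "t \<in> {0..<\<tau>}"
  shows "wd (axis j 1) (a t) (a1 j t)" "wd (axis j 1) (b t) (b1 j t)"
    "wd (axis k 1) (a1 j t) (a2 j k t)" "wd (axis k 1) (b1 j t) (b2 j k t)"
  using in_H_2D(4,5)[OF in_H[OF assms], THEN has_weak_deriv_bounded_linear[OF bounded_linear_Re]]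
    in_H_2D(4,5)[OF in_H[OF assms], THEN has_weak_deriv_bounded_linear[OF bounded_linear_Im]]
    L2_parts[OF assms]
  unfolding a_def[abs_def] b_def[abs_def] a1_def[abs_def] b1_def[abs_def] a2_def[abs_def] b2_def[abs_def]
  by (auto intro!: has_weak_deriv_imp_wd)

lemma continuous_parts:
  "continuous_on {0..<\<tau>} (\<lambda>t. cls (a t))" "continuous_on {0..<\<tau>} (\<lambda>t. cls (b t))"
  "continuous_on {0..<\<tau>} (\<lambda>t. cls (a1 j t))" "continuous_on {0..<\<tau>} (\<lambda>t. cls (b1 j t))"
  "continuous_on {0..<\<tau>} (\<lambda>t. cls (a2 j k t))" "continuous_on {0..<\<tau>} (\<lambda>t. cls (b2 j k t))"
  unfolding continuous_on_def a_def[abs_def] b_def[abs_def] a1_def[abs_def] b1_def[abs_def] a2_def[abs_def] b2_def[abs_def]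
  by (intro ballI cls_part_tendsto continuous_curve_sq_dist[OF curve] in_H_2D in_H; simp)+

lemma V_bounded: obtains C where "V \<in> borel_measurable lebesgue" "AE x in lebesgue. \<bar>V x\<bar> \<le> C"
  using V_W1inf by (auto simp: in_W1inf_def in_Linf_def)

lemma dV_bounded: obtains C where "weak_deriv k V \<in> borel_measurable lebesgue" "AE x in lebesgue. \<bar>weak_deriv k V x\<bar> \<le> C"
  using V_W1inf by (auto simp: in_W1inf_def in_Linf_def)

lemma dV_weak:
  assumes "test_fun UNIV \<phi>"
  shows "(LINT x|lebesgue. dir_deriv (axis k 1) \<phi> x * V x) = - (LINT x|lebesgue. \<phi> x * weak_deriv k V x)"
proof -
  have "has_weak_deriv k V (weak_deriv k V)"
    using V_W1inf by (auto simp: in_W1inf_def weakly_diff_def intro: has_weak_deriv_weak_deriv)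
  then show ?thesis using assms by (simp add: has_weak_deriv_def)
qed

lemma L2_V_mult: "L2fun f \<Longrightarrow> L2fun (\<lambda>x. V x * f x)" "L2fun f \<Longrightarrow> L2fun (\<lambda>x. weak_deriv k V x * f x)"
  by (metis V_bounded L2fun_bounded_mult, metis dV_bounded L2fun_bounded_mult)

lemma wd_V_mult:
  assumes "wd (axis k 1) f g"
  shows "wd (axis k 1) (\<lambda>x. V x * f x) (\<lambda>x. V x * g x + weak_deriv k V x * f x)"
proof -
  obtain C where C: "V \<in> borel_measurable lebesgue" "AE x in lebesgue. \<bar>V x\<bar> \<le> C" by (rule V_bounded)
  obtain C' where C': "weak_deriv k V \<in> borel_measurable lebesgue" "AE x in lebesgue. \<bar>weak_deriv k V x\<bar> \<le> C'"
    by (rule dV_bounded)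
  show ?thesis by (rule wd_mult_bounded[OF C C' dV_weak assms])
qed

lemma continuous_V_mult:
  assumes "\<And>t. t \<in> {0..<\<tau>} \<Longrightarrow> L2fun (f t)" "continuous_on {0..<\<tau>} (\<lambda>t. cls (f t))"
  shows "continuous_on {0..<\<tau>} (\<lambda>t. cls (\<lambda>x. V x * f t x))"
    and "continuous_on {0..<\<tau>} (\<lambda>t. cls (\<lambda>x. weak_deriv k V x * f t x))"
proof -
  obtain C where C: "V \<in> borel_measurable lebesgue" "AE x in lebesgue. \<bar>V x\<bar> \<le> C" by (rule V_bounded)
  obtain C' where C': "weak_deriv k V \<in> borel_measurable lebesgue" "AE x in lebesgue. \<bar>weak_deriv k V x\<bar> \<le> C'"
    by (rule dV_bounded)
  show "continuous_on {0..<\<tau>} (\<lambda>t. cls (\<lambda>x. V x * f t x))"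
    "continuous_on {0..<\<tau>} (\<lambda>t. cls (\<lambda>x. weak_deriv k V x * f t x))"
    unfolding continuous_on_def
    by (intro ballI bounded_mult_tendsto[OF C] bounded_mult_tendsto[OF C'] assms(1);
        use assms(2) in \<open>auto simp: continuous_on_def\<close>)+
qed

lemma cls_da:
  assumes "t \<in> {0..<\<tau>}"
  shows "cls (da t) = - (hbar / (2 * m)) *\<^sub>R (\<Sum>j\<in>UNIV. cls (b2 j j t)) + (1 / hbar) *\<^sub>R cls (\<lambda>x. V x * b t x)"
proof -
  note L = L2_parts[OF assms] L2_V_mult(1)[OF L2_parts(2)[OF assms]]
  show ?thesis
    unfolding da_def[abs_def]
    by (subst cls_add cls_cmult cls_sum, (intro L2fun_cmult L2fun_sum L)+)+ simp
qed

lemma cls_db: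
  assumes "t \<in> {0..<\<tau>}"
  shows "cls (db t) = (hbar / (2 * m)) *\<^sub>R (\<Sum>j\<in>UNIV. cls (a2 j j t)) + (- (1 / hbar)) *\<^sub>R cls (\<lambda>x. V x * a t x)"
proof -
  note L = L2_parts[OF assms] L2_V_mult(1)[OF L2_parts(1)[OF assms]]
  show ?thesis
    unfolding db_def[abs_def]
    by (subst cls_add cls_cmult cls_sum, (intro L2fun_cmult L2fun_sum L)+)+ simp
qed

lemma continuous_da_db:
  "continuous_on {0..<\<tau>} (\<lambda>t. cls (da t))" "continuous_on {0..<\<tau>} (\<lambda>t. cls (db t))"
proof -
  have "continuous_on {0..<\<tau>} (\<lambda>t. - (hbar / (2 * m)) *\<^sub>R (\<Sum>j\<in>UNIV. cls (b2 j j t)) + (1 / hbar) *\<^sub>R cls (\<lambda>x. V x * b t x))"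
    by (intro continuous_intros continuous_parts continuous_V_mult(1) L2_parts)
  then show "continuous_on {0..<\<tau>} (\<lambda>t. cls (da t))"
    by (rule continuous_on_eq) (simp only: cls_da)
  have "continuous_on {0..<\<tau>} (\<lambda>t. (hbar / (2 * m)) *\<^sub>R (\<Sum>j\<in>UNIV. cls (a2 j j t)) + (- (1 / hbar)) *\<^sub>R cls (\<lambda>x. V x * a t x))"
    by (intro continuous_intros continuous_parts continuous_V_mult(1) L2_parts)
  then show "continuous_on {0..<\<tau>} (\<lambda>t. cls (db t))"
    by (rule continuous_on_eq) (simp only: cls_db)
qed

text \<open>The real and imaginary parts of the equation for test functions \<open>\<theta>(t) g(x)\<close>.\<close>

lemma weak_equation:
  assumes \<theta>: "test_fun {0<..<\<tau>} \<theta>" and g: "test_fun UNIV g"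
  shows "(LINT t:{0..<\<tau>}|lebesgue. dir_deriv 1 \<theta> t * (cls g \<bullet> cls (a t))) = - (LINT t:{0..<\<tau>}|lebesgue. \<theta> t * (cls g \<bullet> cls (da t)))"
    and "(LINT t:{0..<\<tau>}|lebesgue. dir_deriv 1 \<theta> t * (cls g \<bullet> cls (b t))) = - (LINT t:{0..<\<tau>}|lebesgue. \<theta> t * (cls g \<bullet> cls (db t)))"
proof -
  let ?\<phi> = "\<lambda>z. \<theta> (fst z) * g (snd z)"
  let ?I = "\<lambda>\<theta> u. LINT t:{0..<\<tau>}|lebesgue. \<theta> t * u t"
  note d\<theta> = test_fun_dir_deriv[OF \<theta>, of 1]
  have fold: "(\<lambda>x. Re (\<psi> t x)) = a t" "(\<lambda>x. Im (\<psi> t x)) = b t" for t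
    by (auto simp: a_def b_def)
  have foldV: "(\<lambda>x. Re (of_real (V x) * \<psi> t x)) = (\<lambda>x. V x * a t x)" "(\<lambda>x. Im (of_real (V x) * \<psi> t x)) = (\<lambda>x. V x * b t x)" for t
    by (auto simp: a_def b_def)
  have tensor: "distr_of \<tau> \<psi> (\<lambda>z. \<eta> (fst z) * h (snd z)) =
      Complex (?I \<eta> (\<lambda>t. cls h \<bullet> cls (a t))) (?I \<eta> (\<lambda>t. cls h \<bullet> cls (b t)))"
    if "test_fun {0<..<\<tau>} \<eta>" "test_fun UNIV h" for \<eta> h
    using distr_of_tensor[OF that, of \<psi>] L2_parts(1,2) continuous_parts(1,2) unfolding fold by auto
  have d_t: "dir_deriv (1, 0) ?\<phi> = (\<lambda>z. dir_deriv 1 \<theta> (fst z) * g (snd z))"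
    by (simp add: dir_deriv_tensor[OF \<theta> g] dir_deriv_0 test_fun_differentiable[OF g])
  have d_x: "dir_deriv (0, axis j 1) (\<lambda>z. \<theta> (fst z) * h (snd z)) = (\<lambda>z. \<theta> (fst z) * dir_deriv (axis j 1) h (snd z))"
    if "test_fun UNIV h" for j h
    by (simp add: dir_deriv_tensor[OF \<theta> that] dir_deriv_0 test_fun_differentiable[OF \<theta>])
  have \<theta>0: "\<theta> 0 = 0"
    using test_fun_supportE[OF \<theta>] by (metis greaterThanLessThan_iff less_irrefl subsetD)
  have D_t: "D_t \<tau> \<psi> ?\<phi> = - Complex (?I (dir_deriv 1 \<theta>) (\<lambda>t. cls g \<bullet> cls (a t))) (?I (dir_deriv 1 \<theta>) (\<lambda>t. cls g \<bullet> cls (b t)))"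
    unfolding D_t_def d_t tensor[OF d\<theta> g] by (simp add: \<theta>0)
  have lap: "cls (dir_deriv (axis j 1) (dir_deriv (axis j 1) g)) \<bullet> cls (a t) = cls g \<bullet> cls (a2 j j t)"
    "cls (dir_deriv (axis j 1) (dir_deriv (axis j 1) g)) \<bullet> cls (b t) = cls g \<bullet> cls (b2 j j t)"
    if t: "t \<in> {0..<\<tau>}" for j t
    using wdD[OF wd_parts(1)[OF t] test_fun_dir_deriv[OF g]] wdD[OF wd_parts(3)[OF t] g]
      wdD[OF wd_parts(2)[OF t] test_fun_dir_deriv[OF g]] wdD[OF wd_parts(4)[OF t] g] by auto
  have D_xx: "D_x j (D_x j (distr_of \<tau> \<psi>)) ?\<phi> = Complex (?I \<theta> (\<lambda>t. cls g \<bullet> cls (a2 j j t))) (?I \<theta> (\<lambda>t. cls g \<bullet> cls (b2 j j t)))" for j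
  proof -
    have "D_x j (D_x j (distr_of \<tau> \<psi>)) ?\<phi> = distr_of \<tau> \<psi> (\<lambda>z. \<theta> (fst z) * dir_deriv (axis j 1) (dir_deriv (axis j 1) g) (snd z))"
      by (simp add: D_x_def d_x g test_fun_dir_deriv)
    also have "\<dots> = Complex (?I \<theta> (\<lambda>t. cls g \<bullet> cls (a2 j j t))) (?I \<theta> (\<lambda>t. cls g \<bullet> cls (b2 j j t)))"
      unfolding tensor[OF \<theta> test_fun_dir_deriv[OF test_fun_dir_deriv[OF g]]]
      by (intro arg_cong2[where f = Complex] set_lebesgue_integral_cong) (auto simp: lap)
    finally show ?thesis .
  qed
  have DV: "distr_of \<tau> (\<lambda>t x. of_real (V x) * \<psi> t x) ?\<phi> =
      Complex (?I \<theta> (\<lambda>t. cls g \<bullet> cls (\<lambda>x. V x * a t x))) (?I \<theta> (\<lambda>t. cls g \<bullet> cls (\<lambda>x. V x * b t x)))"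
    using distr_of_tensor[OF \<theta> g, of "\<lambda>t x. of_real (V x) * \<psi> t x"] L2_parts(1,2) continuous_parts(1,2) L2_V_mult(1)
      continuous_V_mult(1)
    unfolding foldV by auto
  have cont: "continuous_on {0<..<\<tau>} (\<lambda>t. cls g \<bullet> U t)" if "continuous_on {0..<\<tau>} U" for U :: "real \<Rightarrow> (real^'n) l2"
    by (intro continuous_intros continuous_on_subset[OF that]) auto
  note int = set_integrable_test_mult[OF \<theta> cont]
  have da_int: "?I \<theta> (\<lambda>t. cls g \<bullet> cls (da t)) =
     - (hbar / (2 * m)) * (\<Sum>j\<in>UNIV. ?I \<theta> (\<lambda>t. cls g \<bullet> cls (b2 j j t))) + 1 / hbar * ?I \<theta> (\<lambda>t. cls g \<bullet> cls (\<lambda>x. V x * b t x))"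
  proof -
    have "?I \<theta> (\<lambda>t. cls g \<bullet> cls (da t)) = (LINT t:{0..<\<tau>}|lebesgue. - (hbar / (2 * m)) * (\<Sum>j\<in>UNIV. \<theta> t * (cls g \<bullet> cls (b2 j j t)))
        + 1 / hbar * (\<theta> t * (cls g \<bullet> cls (\<lambda>x. V x * b t x))))"
      by (intro set_lebesgue_integral_cong)
         (simp_all add: cls_da inner_add_right inner_sum_right algebra_simps flip: sum_distrib_left)
    also have "\<dots> = - (hbar / (2 * m)) * (\<Sum>j\<in>UNIV. ?I \<theta> (\<lambda>t. cls g \<bullet> cls (b2 j j t))) + 1 / hbar * ?I \<theta> (\<lambda>t. cls g \<bullet> cls (\<lambda>x. V x * b t x))"
      by (intro set_integral_linear_combination int continuous_parts continuous_V_mult L2_parts) auto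
    finally show ?thesis .
  qed
  have db_int: "?I \<theta> (\<lambda>t. cls g \<bullet> cls (db t)) =
     hbar / (2 * m) * (\<Sum>j\<in>UNIV. ?I \<theta> (\<lambda>t. cls g \<bullet> cls (a2 j j t))) + (- (1 / hbar)) * ?I \<theta> (\<lambda>t. cls g \<bullet> cls (\<lambda>x. V x * a t x))"
  proof -
    have "?I \<theta> (\<lambda>t. cls g \<bullet> cls (db t)) = (LINT t:{0..<\<tau>}|lebesgue. hbar / (2 * m) * (\<Sum>j\<in>UNIV. \<theta> t * (cls g \<bullet> cls (a2 j j t)))
        + (- (1 / hbar)) * (\<theta> t * (cls g \<bullet> cls (\<lambda>x. V x * a t x))))"
      by (intro set_lebesgue_integral_cong)
         (simp_all add: cls_db inner_add_right inner_sum_right algebra_simps flip: sum_distrib_left)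
    also have "\<dots> = hbar / (2 * m) * (\<Sum>j\<in>UNIV. ?I \<theta> (\<lambda>t. cls g \<bullet> cls (a2 j j t))) + (- (1 / hbar)) * ?I \<theta> (\<lambda>t. cls g \<bullet> cls (\<lambda>x. V x * a t x))"
      by (intro set_integral_linear_combination int continuous_parts continuous_V_mult L2_parts) auto
    finally show ?thesis .
  qed
  have eq: "\<i> * of_real hbar * D_t \<tau> \<psi> ?\<phi> = - of_real (hbar\<^sup>2 / (2 * m)) * (\<Sum>j\<in>UNIV. D_x j (D_x j (distr_of \<tau> \<psi>)) ?\<phi>)
          + distr_of \<tau> (\<lambda>t x. of_real (V x) * \<psi> t x) ?\<phi>"
    using equation test_fun_tensor[OF \<theta> g] unfolding schroedinger_solution_def by blast
  have re: "hbar * ?I (dir_deriv 1 \<theta>) (\<lambda>t. cls g \<bullet> cls (b t)) =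
      - (hbar\<^sup>2 / (2 * m)) * (\<Sum>j\<in>UNIV. ?I \<theta> (\<lambda>t. cls g \<bullet> cls (a2 j j t))) + ?I \<theta> (\<lambda>t. cls g \<bullet> cls (\<lambda>x. V x * a t x))"
    using arg_cong[OF eq, of Re] unfolding D_t D_xx DV by simp
  have im: "- hbar * ?I (dir_deriv 1 \<theta>) (\<lambda>t. cls g \<bullet> cls (a t)) =
      - (hbar\<^sup>2 / (2 * m)) * (\<Sum>j\<in>UNIV. ?I \<theta> (\<lambda>t. cls g \<bullet> cls (b2 j j t))) + ?I \<theta> (\<lambda>t. cls g \<bullet> cls (\<lambda>x. V x * b t x))"
    using arg_cong[OF eq, of Im] unfolding D_t D_xx DV by simp
  show "?I (dir_deriv 1 \<theta>) (\<lambda>t. cls g \<bullet> cls (a t)) = - ?I \<theta> (\<lambda>t. cls g \<bullet> cls (da t))"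
    using im hbar m unfolding da_int by (simp add: field_simps power2_eq_square)
  show "?I (dir_deriv 1 \<theta>) (\<lambda>t. cls g \<bullet> cls (b t)) = - ?I \<theta> (\<lambda>t. cls g \<bullet> cls (db t))"
    using re hbar m unfolding db_int by (simp add: field_simps power2_eq_square)
qed

theorem time_derivatives:
  assumes s: "s \<in> {0<..<\<tau>}"
  shows "((\<lambda>t. cls (a t)) has_vector_derivative cls (da s)) (at s)"
    and "((\<lambda>t. cls (b t)) has_vector_derivative cls (db s)) (at s)"
proof -
  have c: "continuous_on {0<..<\<tau>} U \<Longrightarrow> continuous (at s) U" for U :: "real \<Rightarrow> (real^'n) l2"
    using s by (simp add: continuous_on_eq_continuous_at)
  have sub: "{0<..<\<tau>} \<subseteq> {0..<\<tau>}" by auto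
  have i: "continuous_on {0<..<\<tau>} (\<lambda>t. d \<bullet> U t)" if "continuous_on {0..<\<tau>} U" for U :: "real \<Rightarrow> (real^'n) l2" and d
    by (intro continuous_intros continuous_on_subset[OF that sub])
  show "((\<lambda>t. cls (a t)) has_vector_derivative cls (da s)) (at s)"
  proof (rule weak_imp_strong_vector_derivative[OF closure_test_classes _ s, where G = "\<lambda>t. cls (da t)"])
    show "continuous (at s) (\<lambda>t. cls (da t))"
      by (rule c[OF continuous_on_subset[OF continuous_da_db(1) sub]])
    show "((\<lambda>t. d \<bullet> cls (a t)) has_real_derivative d \<bullet> cls (da t)) (at t)"
      if "t \<in> {0<..<\<tau>}" "d \<in> test_classes" for t d
      using that(2) unfolding test_classes_def
      by (auto intro!: weak_derivative_imp_derivative[OF i i _ that(1)] weak_equation continuous_parts continuous_da_db)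
  qed simp
  show "((\<lambda>t. cls (b t)) has_vector_derivative cls (db s)) (at s)"
  proof (rule weak_imp_strong_vector_derivative[OF closure_test_classes _ s, where G = "\<lambda>t. cls (db t)"])
    show "continuous (at s) (\<lambda>t. cls (db t))"
      by (rule c[OF continuous_on_subset[OF continuous_da_db(2) sub]])
    show "((\<lambda>t. d \<bullet> cls (b t)) has_real_derivative d \<bullet> cls (db t)) (at t)"
      if "t \<in> {0<..<\<tau>}" "d \<in> test_classes" for t d
      using that(2) unfolding test_classes_def
      by (auto intro!: weak_derivative_imp_derivative[OF i i _ that(1)] weak_equation continuous_parts continuous_da_db)
  qed simp
qed

end

section \<open>Weighted inner products\<close>

text \<open>The bilinear form \<open>(f, h) \<mapsto> \<integral> g f h\<close> with a bounded continuous weight \<open>g\<close>; for other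
  weights the value is unspecified.\<close>

definition wip :: "('a::euclidean_space \<Rightarrow> real) \<Rightarrow> 'a l2 \<Rightarrow> 'a l2 \<Rightarrow> real" where
  "wip g F G = mulC (Bcontfun g) F \<bullet> G"

lemma test_fun_bcontfun:
  assumes "test_fun \<Omega> g" shows "g \<in> bcontfun"
proof -
  obtain C where "\<And>x. \<bar>g x\<bar> \<le> C" using test_fun_bounded[OF assms] by metis
  then have "bounded (range g)" unfolding bounded_iff by auto
  then show ?thesis using test_fun_continuous[OF assms] by (simp add: bcontfun_def)
qed

lemma apply_Bcontfun_test: "test_fun \<Omega> g \<Longrightarrow> apply_bcontfun (Bcontfun g) x = g x"
  using Bcontfun_inverse[OF test_fun_bcontfun] by metis

lemma mulC_test: "test_fun UNIV g \<Longrightarrow> L2fun f \<Longrightarrow> mulC (Bcontfun g) (cls f) = cls (\<lambda>x. g x * f x)"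
  by (simp add: mulC_cls apply_Bcontfun_test)

lemma wip_cls:
  assumes "test_fun UNIV g" "L2fun f" "L2fun h"
  shows "wip g (cls f) (cls h) = (LINT x|lebesgue. g x * (f x * h x))"
  unfolding wip_def mulC_test[OF assms(1,2)] inner_cls[OF test_fun_mult_L2fun[OF assms(1,2)] assms(3)]
  by (simp add: mult.assoc)

lemma wip_commute: "wip g F G = wip g G F"
proof -
  obtain f where f: "L2fun f" "F = cls f" by (rule cls_exhaust)
  obtain h where h: "L2fun h" "G = cls h" by (rule cls_exhaust)
  show ?thesis
    unfolding wip_def f(2) h(2) mulC_cls[OF f(1)] mulC_cls[OF h(1)]
      inner_cls[OF L2fun_bcontfun_mult[OF f(1)] h(1)] inner_cls[OF L2fun_bcontfun_mult[OF h(1)] f(1)]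
    by (simp add: mult_ac)
qed

interpretation mulC: bounded_bilinear mulC by (rule bounded_bilinear_mulC)

lemma wip_linear:
  "wip g (F + F') G = wip g F G + wip g F' G" "wip g F (G + G') = wip g F G + wip g F G'"
  "wip g (c *\<^sub>R F) G = c * wip g F G" "wip g F (c *\<^sub>R G) = c * wip g F G"
  "wip g (\<Sum>i\<in>I. H i) G = (\<Sum>i\<in>I. wip g (H i) G)" "wip g F (\<Sum>i\<in>I. H i) = (\<Sum>i\<in>I. wip g F (H i))"
  by (simp_all add: wip_def mulC.add_right mulC.scaleR_right mulC.sum_right inner_add_left
      inner_add_right inner_sum_left inner_sum_right)

lemma wip_integration_by_parts:
  assumes g: "test_fun UNIV g" and f: "wd v f f'" and h: "wd v h h'"
  shows "wip g (cls f') (cls h) + wip (dir_deriv v g) (cls f) (cls h) = - wip g (cls f) (cls h')"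
proof -
  note Lf = wd_L2fun[OF f] and dg = test_fun_dir_deriv[OF g, of v]
  have "cls (\<lambda>x. g x * f' x + dir_deriv v g x * f x) \<bullet> cls h = - (cls (\<lambda>x. g x * f x) \<bullet> cls h')"
    by (rule wd_integration_by_parts[OF wd_mult_test[OF g f] h])
  then show ?thesis
    unfolding wip_def mulC_test[OF g Lf(1)] mulC_test[OF g Lf(2)] mulC_test[OF dg Lf(1)]
      cls_add[OF test_fun_mult_L2fun[OF g Lf(2)] test_fun_mult_L2fun[OF dg Lf(1)]] inner_add_left .
qed

lemma wip_cong_AE:
  assumes "test_fun UNIV g" "test_fun UNIV g'" "cls g = cls g'"
  shows "wip g F G = wip g' F G"
proof -
  obtain f where f: "L2fun f" "F = cls f" by (rule cls_exhaust)
  have "AE x in lebesgue. g x = g' x"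
    using assms by (simp add: cls_eq_iff L2fun_test)
  then have "cls (\<lambda>x. g x * f x) = cls (\<lambda>x. g' x * f x)"
    by (subst cls_eq_iff) (auto intro: test_fun_mult_L2fun assms f elim: eventually_mono)
  then show ?thesis by (simp add: wip_def f mulC_test assms)
qed

lemma wd_unique:
  assumes "wd v f g" "wd v f' g'" "cls f = cls f'" shows "cls g = cls g'"
proof -
  have "norm (cls g - cls g') \<le> 0"
  proof (rule norm_le_if_inner_bound_on_dense[OF closure_test_classes])
    fix d :: "'a l2" assume "d \<in> test_classes"
    then obtain \<phi> where \<phi>: "test_fun UNIV \<phi>" "d = cls \<phi>" by (auto simp: test_classes_def)
    show "\<bar>d \<bullet> (cls g - cls g')\<bar> \<le> 0 * norm d"
      using wdD[OF assms(1) \<phi>(1)] wdD[OF assms(2) \<phi>(1)] assms(3) by (simp add: \<phi>(2) inner_diff_right)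
  qed simp
  then show ?thesis by simp
qed

text \<open>Second partial derivatives of test functions commute, by the corresponding fact for weak
  derivatives.\<close>

lemma test_dir_deriv_commute:
  assumes g: "test_fun UNIV g"
  shows "cls (dir_deriv j (dir_deriv k g)) = cls (dir_deriv k (dir_deriv j g))"
proof (rule wd_unique)
  show "wd k (dir_deriv j g) (dir_deriv j (dir_deriv k g))"
    by (rule wd_commute[OF wd_test wd_test wd_test]) (intro g test_fun_dir_deriv)+
  show "wd k (dir_deriv j g) (dir_deriv k (dir_deriv j g))"
    by (intro wd_test test_fun_dir_deriv g)
qed simp

lemma test_dir_deriv_commute_3:
  assumes g: "test_fun UNIV g"
  shows "cls (dir_deriv j (dir_deriv j (dir_deriv k g))) = cls (dir_deriv k (dir_deriv j (dir_deriv j g)))"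
proof -
  have "cls (dir_deriv j (dir_deriv j (dir_deriv k g))) = cls (dir_deriv j (dir_deriv k (dir_deriv j g)))"
    by (rule wd_unique[OF wd_test wd_test test_dir_deriv_commute]) (intro g test_fun_dir_deriv)+
  also have "\<dots> = cls (dir_deriv k (dir_deriv j (dir_deriv j g)))"
    by (intro test_dir_deriv_commute test_fun_dir_deriv g)
  finally show ?thesis .
qed

text \<open>The weak form of
  \<open>- f\<^sub>j\<^sub>j f\<^sub>k + \<partial>\<^sub>k (f f\<^sub>j\<^sub>j) / 2 = - \<partial>\<^sub>j (f\<^sub>j f\<^sub>k) + \<partial>\<^sub>j \<partial>\<^sub>j \<partial>\<^sub>k (f\<^sup>2) / 4\<close>.\<close>

lemma stress_identity:
  assumes g: "test_fun UNIV g" and fj: "wd j f fj" and fk: "wd k f fk"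
    and fjj: "wd j fj fjj" and fkj: "wd j fk fkj"
  shows "- wip g (cls fjj) (cls fk) - wip (dir_deriv k g) (cls f) (cls fjj) / 2
    = wip (dir_deriv j g) (cls fj) (cls fk) - wip (dir_deriv k (dir_deriv j (dir_deriv j g))) (cls f) (cls f) / 4"
proof -
  note dg = test_fun_dir_deriv[OF g]
  note ddg = test_fun_dir_deriv[OF dg]
  have 1: "wip g (cls fkj) (cls fj) + wip (dir_deriv j g) (cls fk) (cls fj) = - wip g (cls fk) (cls fjj)"
    by (rule wip_integration_by_parts[OF g fkj fjj])
  have c: "wd k fj fkj" by (rule wd_commute[OF fj fk fkj])
  have 2: "wip g (cls fkj) (cls fj) + wip (dir_deriv k g) (cls fj) (cls fj) = - wip g (cls fj) (cls fkj)"
    by (rule wip_integration_by_parts[OF g c c])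
  have 3: "wip (dir_deriv k g) (cls fj) (cls fj) + wip (dir_deriv j (dir_deriv k g)) (cls f) (cls fj)
      = - wip (dir_deriv k g) (cls f) (cls fjj)"
    by (rule wip_integration_by_parts[OF dg fj fjj])
  have 4: "wip (dir_deriv j (dir_deriv k g)) (cls fj) (cls f) + wip (dir_deriv j (dir_deriv j (dir_deriv k g))) (cls f) (cls f)
      = - wip (dir_deriv j (dir_deriv k g)) (cls f) (cls fj)"
    by (rule wip_integration_by_parts[OF ddg fj fj])
  have 5: "wip (dir_deriv j (dir_deriv j (dir_deriv k g))) (cls f) (cls f) = wip (dir_deriv k (dir_deriv j (dir_deriv j g))) (cls f) (cls f)"
    by (intro wip_cong_AE test_dir_deriv_commute_3 test_fun_dir_deriv g)
  show ?thesis
    using 1 2 3 4 5 wip_commute[of g "cls fj" "cls fkj"] wip_commute[of g "cls fjj" "cls fk"]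
      wip_commute[of "dir_deriv j g" "cls fk" "cls fj"]
      wip_commute[of "dir_deriv j (dir_deriv k g)" "cls fj" "cls f"] by linarith
qed

context schroedinger_flow
begin

text \<open>The weak form of \<open>2 V f f\<^sub>k - \<partial>\<^sub>k (V f\<^sup>2) = - V\<^sub>k f\<^sup>2\<close>.\<close>

lemma potential_identity:
  assumes g: "test_fun UNIV g" and f: "wd (axis k 1) f fk"
  shows "2 * wip g (cls (\<lambda>x. V x * f x)) (cls fk) + wip (dir_deriv (axis k 1) g) (cls f) (cls (\<lambda>x. V x * f x))
    = - wip g (cls (\<lambda>x. weak_deriv k V x * f x)) (cls f)"
proof -
  note L = wd_L2fun[OF f]
  note LV = L2_V_mult(1)[OF L(1)] L2_V_mult(1)[OF L(2)] L2_V_mult(2)[OF L(1), of k]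
  have "wip g (cls fk) (cls (\<lambda>x. V x * f x)) + wip (dir_deriv (axis k 1) g) (cls f) (cls (\<lambda>x. V x * f x))
    = - wip g (cls f) (cls (\<lambda>x. V x * fk x + weak_deriv k V x * f x))"
    by (rule wip_integration_by_parts[OF g f wd_V_mult[OF f]])
  moreover have "wip g (cls f) (cls (\<lambda>x. V x * fk x)) = wip g (cls (\<lambda>x. V x * f x)) (cls fk)"
    unfolding wip_cls[OF g L(1) LV(2)] wip_cls[OF g LV(1) L(2)] by (simp add: mult_ac)
  ultimately show ?thesis
    using wip_commute[of g "cls fk"] wip_commute[of g "cls f"]
    by (simp add: cls_add LV wip_linear)
qed

text \<open>The right-hand sides of the balance laws of mass and momentum, tested with \<open>g\<close>.\<close>

lemma mass_balance:
  assumes g: "test_fun UNIV g" and t: "t \<in> {0..<\<tau>}"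
  shows "2 * (wip g (cls (a t)) (cls (da t)) + wip g (cls (b t)) (cls (db t))) =
    (\<Sum>j\<in>UNIV. hbar / m * (wip (dir_deriv (axis j 1) g) (cls (a t)) (cls (b1 j t))
      - wip (dir_deriv (axis j 1) g) (cls (b t)) (cls (a1 j t))))"
proof -
  note L = L2_parts[OF t] and w = wd_parts[OF t]
  have V: "wip g (cls (a t)) (cls (\<lambda>x. V x * b t x)) = wip g (cls (b t)) (cls (\<lambda>x. V x * a t x))"
    unfolding wip_cls[OF g L(1) L2_V_mult(1)[OF L(2)]] wip_cls[OF g L(2) L2_V_mult(1)[OF L(1)]]
    by (simp add: mult_ac)
  have j: "wip g (cls (b t)) (cls (a2 j j t)) - wip g (cls (a t)) (cls (b2 j j t)) =
      wip (dir_deriv (axis j 1) g) (cls (a t)) (cls (b1 j t)) - wip (dir_deriv (axis j 1) g) (cls (b t)) (cls (a1 j t))" for j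
    using wip_integration_by_parts[OF g w(1)[of j] w(4)[of j j]] wip_integration_by_parts[OF g w(2)[of j] w(3)[of j j]]
      wip_commute[of g "cls (a1 j t)" "cls (b1 j t)"] by linarith
  have "2 * (wip g (cls (a t)) (cls (da t)) + wip g (cls (b t)) (cls (db t))) =
      hbar / m * (\<Sum>j\<in>UNIV. wip g (cls (b t)) (cls (a2 j j t)) - wip g (cls (a t)) (cls (b2 j j t)))"
    unfolding cls_da[OF t] cls_db[OF t] wip_linear V sum_subtractf using m hbar by (simp add: field_simps)
  then show ?thesis by (simp only: j sum_distrib_left)
qed

lemma momentum_balance:
  assumes g: "test_fun UNIV g" and t: "t \<in> {0..<\<tau>}"
  shows "hbar / m * (2 * wip g (cls (da t)) (cls (b1 k t)) - 2 * wip g (cls (db t)) (cls (a1 k t))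
      + wip (dir_deriv (axis k 1) g) (cls (b t)) (cls (da t)) - wip (dir_deriv (axis k 1) g) (cls (a t)) (cls (db t)))
    = (\<Sum>j\<in>UNIV. (hbar / m)\<^sup>2 * (wip (dir_deriv (axis j 1) g) (cls (a1 j t)) (cls (a1 k t))
        + wip (dir_deriv (axis j 1) g) (cls (b1 j t)) (cls (b1 k t))))
      - (\<Sum>j\<in>UNIV. hbar\<^sup>2 / (4 * m\<^sup>2) * (wip (dir_deriv (axis k 1) (dir_deriv (axis j 1) (dir_deriv (axis j 1) g))) (cls (a t)) (cls (a t))
        + wip (dir_deriv (axis k 1) (dir_deriv (axis j 1) (dir_deriv (axis j 1) g))) (cls (b t)) (cls (b t))))
      - 1 / m * (wip g (cls (\<lambda>x. weak_deriv k V x * a t x)) (cls (a t)) + wip g (cls (\<lambda>x. weak_deriv k V x * b t x)) (cls (b t)))"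
    (is "?L = (\<Sum>j\<in>UNIV. (hbar / m)\<^sup>2 * ?S j) - (\<Sum>j\<in>UNIV. hbar\<^sup>2 / (4 * m\<^sup>2) * ?T j) - 1 / m * ?F")
proof -
  note L = L2_parts[OF t] and w = wd_parts[OF t]
  let ?gk = "dir_deriv (axis k 1) g"
  have j: "(- wip g (cls (a2 j j t)) (cls (a1 k t)) - wip ?gk (cls (a t)) (cls (a2 j j t)) / 2)
      + (- wip g (cls (b2 j j t)) (cls (b1 k t)) - wip ?gk (cls (b t)) (cls (b2 j j t)) / 2)
      = ?S j - ?T j / 4" for j
    unfolding stress_identity[OF g w(1)[of j] w(1)[of k] w(3)[of j j] w(3)[of j k]]
      stress_identity[OF g w(2)[of j] w(2)[of k] w(4)[of j j] w(4)[of j k]]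
    by (simp add: add_divide_distrib)
  have V: "(2 * wip g (cls (\<lambda>x. V x * a t x)) (cls (a1 k t)) + wip ?gk (cls (a t)) (cls (\<lambda>x. V x * a t x)))
      + (2 * wip g (cls (\<lambda>x. V x * b t x)) (cls (b1 k t)) + wip ?gk (cls (b t)) (cls (\<lambda>x. V x * b t x))) = - ?F"
    unfolding potential_identity[OF g w(1)] potential_identity[OF g w(2)] by simp
  have "?L = hbar / m * (hbar / m * (\<Sum>j\<in>UNIV. ?S j - ?T j / 4) + 1 / hbar * (- ?F))"
    unfolding j[symmetric] V[symmetric]
    unfolding cls_da[OF t] cls_db[OF t] wip_linear sum.distrib sum_subtractf sum_negf sum_divide_distrib[symmetric]
    using hbar m by (simp add: field_simps)
  also have "\<dots> = (hbar / m)\<^sup>2 * (\<Sum>j\<in>UNIV. ?S j - ?T j / 4) - 1 / m * ?F"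
    using hbar m by (simp add: field_simps power2_eq_square)
  also have "(hbar / m)\<^sup>2 * (\<Sum>j\<in>UNIV. ?S j - ?T j / 4) = (\<Sum>j\<in>UNIV. (hbar / m)\<^sup>2 * ?S j) - (\<Sum>j\<in>UNIV. hbar\<^sup>2 / (4 * m\<^sup>2) * ?T j)"
    unfolding sum_distrib_left[symmetric] sum_subtractf sum_divide_distrib[symmetric]
    using m by (simp add: field_simps power2_eq_square)
  finally show ?thesis .
qed

end

section \<open>Test functions of time and space\<close>

text \<open>The function \<open>\<phi>\<close> of time and space at the fixed time \<open>t\<close>.\<close>

definition slice :: "(real \<times> 'a \<Rightarrow> real) \<Rightarrow> real \<Rightarrow> 'a \<Rightarrow> real" where
  "slice \<phi> t x = \<phi> (t, x)"

lemma test_fun_slice: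
  fixes \<phi> :: "real \<times> 'a::euclidean_space \<Rightarrow> real"
  assumes "test_fun \<Omega> \<phi>"
  shows "test_fun UNIV (slice \<phi> t)" and "dir_deriv w (slice \<phi> t) = slice (dir_deriv (0, w) \<phi>) t"
proof -
  have L: "bounded_linear (\<lambda>x::'a. (0::real, x))"
    by (intro bounded_linear_Pair bounded_linear_zero bounded_linear_ident)
  have s: "slice \<phi> t = (\<lambda>x. \<phi> ((0, x) + (t, 0)))" by (simp add: slice_def[abs_def])
  obtain K where K: "compact K" "\<And>z. z \<notin> K \<Longrightarrow> \<phi> z = 0" using test_fun_supportE[OF assms] by metis
  show "test_fun UNIV (slice \<phi> t)"
  proof (rule test_funI[of _ "snd ` K"])
    show "Ck k (slice \<phi> t)" for k
      unfolding s by (rule Ck_affine[OF L test_fun_Ck[OF assms]])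
    show "compact (snd ` K)" by (intro compact_continuous_image K continuous_intros)
    show "slice \<phi> t x = 0" if "x \<notin> snd ` K" for x
      using that K(2)[of "(t, x)"] by (force simp: slice_def)
  qed simp
  show "dir_deriv w (slice \<phi> t) = slice (dir_deriv (0, w) \<phi>) t"
  proof
    fix x
    have "dir_deriv w (\<lambda>x. \<phi> ((0, x) + (t, 0))) x = dir_deriv (0, w) \<phi> ((0, x) + (t, 0))"
      by (rule dir_deriv_affine(1)[OF L test_fun_differentiable[OF assms]])
    then show "dir_deriv w (slice \<phi> t) x = slice (dir_deriv (0, w) \<phi>) t x"
      by (simp add: slice_def[abs_def])
  qed
qed

lemma slice_time_derivative:
  fixes \<phi> :: "real \<times> 'a::euclidean_space \<Rightarrow> real"
  assumes "test_fun \<Omega> \<phi>"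
  shows "((\<lambda>t. slice \<phi> t x) has_real_derivative slice (dir_deriv (1, 0) \<phi>) t x) (at t)"
  using has_real_derivative_along[of \<phi> "(0, x)" t "(1, 0)"] test_fun_differentiable[OF assms]
  by (simp add: slice_def)

text \<open>In the supremum norm, a test function is a differentiable curve of functions of \<open>x\<close>: the remainder is
  quadratic with the bound of the second time derivative as constant.\<close>

lemma slice_has_vector_derivative:
  fixes \<phi> :: "real \<times> 'a::euclidean_space \<Rightarrow> real"
  assumes \<phi>: "test_fun \<Omega> \<phi>"
  shows "((\<lambda>t. Bcontfun (slice \<phi> t)) has_vector_derivative Bcontfun (slice (dir_deriv (1, 0) \<phi>) s)) (at s)"
proof -
  let ?d = "dir_deriv (1, 0) \<phi>"
  note d\<phi> = test_fun_dir_deriv[OF \<phi>, of "(1, 0)"]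
  note ap = apply_Bcontfun_test[OF test_fun_slice(1)[OF \<phi>]] apply_Bcontfun_test[OF test_fun_slice(1)[OF d\<phi>]]
  obtain C where C: "C \<ge> 0" "\<And>z. \<bar>dir_deriv (1, 0) ?d z\<bar> \<le> C"
    by (rule test_fun_bounded[OF test_fun_dir_deriv[OF d\<phi>, of "(1, 0)"]]) (rule that)
  have lip: "\<bar>slice ?d z x - slice ?d s x\<bar> \<le> C * \<bar>z - s\<bar>" for z x
  proof -
    have "norm (slice ?d z x - slice ?d s x) \<le> C * norm (z - s)"
    proof (rule field_differentiable_bound[of UNIV])
    show "((\<lambda>t. slice ?d t x) has_field_derivative slice (dir_deriv (1, 0) ?d) t x) (at t within UNIV)" for t
      by (rule slice_time_derivative[OF d\<phi>])
    show "norm (slice (dir_deriv (1, 0) ?d) t x) \<le> C" for t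
      unfolding slice_def real_norm_def by (rule C(2))
    qed auto
    then show ?thesis by simp
  qed
  have taylor: "\<bar>slice \<phi> t x - slice \<phi> s x - (t - s) * slice ?d s x\<bar> \<le> C * \<bar>t - s\<bar> * \<bar>t - s\<bar>" for t x
  proof -
    have "norm ((slice \<phi> t x - t * slice ?d s x) - (slice \<phi> s x - s * slice ?d s x)) \<le> C * \<bar>t - s\<bar> * norm (t - s)"
    proof (rule field_differentiable_bound[of "cball s \<bar>t - s\<bar>" _ "\<lambda>z. slice ?d z x - slice ?d s x"])
      fix z assume z: "z \<in> cball s \<bar>t - s\<bar>"
      show "((\<lambda>t. slice \<phi> t x - t * slice ?d s x) has_field_derivative slice ?d z x - slice ?d s x) (at z within cball s \<bar>t - s\<bar>)"
      proof (rule has_field_derivative_at_within, rule DERIV_diff[OF slice_time_derivative[OF \<phi>]])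
        show "((\<lambda>t. t * slice ?d s x) has_real_derivative slice ?d s x) (at z)"
          using DERIV_cmult_right[OF DERIV_ident, of "slice ?d s x"] by simp
      qed
      have "C * \<bar>z - s\<bar> \<le> C * \<bar>t - s\<bar>"
        using z C(1) by (intro mult_left_mono) (auto simp: dist_real_def abs_minus_commute)
      then show "norm (slice ?d z x - slice ?d s x) \<le> C * \<bar>t - s\<bar>" using lip[of z x] by simp
    qed (auto simp: dist_real_def abs_minus_commute)
    then show ?thesis by (simp add: algebra_simps)
  qed
  have bound: "norm (Bcontfun (slice \<phi> t) - Bcontfun (slice \<phi> s) - (t - s) *\<^sub>R Bcontfun (slice ?d s)) \<le> C * \<bar>t - s\<bar> * \<bar>t - s\<bar>" for t
    by (rule norm_bound) (use taylor in \<open>simp add: minus_bcontfun.rep_eq scaleR_bcontfun.rep_eq ap\<close>)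
  show ?thesis
    unfolding has_vector_derivative_def has_derivative_at_alt
  proof (intro conjI allI impI)
    show "bounded_linear (\<lambda>x. x *\<^sub>R Bcontfun (slice ?d s))" by (rule bounded_linear_scaleR_left)
    fix e :: real assume e: "e > 0"
    have "norm (Bcontfun (slice \<phi> t) - Bcontfun (slice \<phi> s) - (t - s) *\<^sub>R Bcontfun (slice ?d s)) \<le> e * norm (t - s)"
      if "norm (t - s) < e / (C + 1)" for t
    proof -
      have "C * \<bar>t - s\<bar> \<le> (C + 1) * \<bar>t - s\<bar>" by (intro mult_right_mono) auto
      also have "\<dots> \<le> e" using that C(1) by (simp add: pos_less_divide_eq mult.commute)
      finally have "C * \<bar>t - s\<bar> * \<bar>t - s\<bar> \<le> e * \<bar>t - s\<bar>" by (intro mult_right_mono) auto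
      then show ?thesis using bound[of t] by simp
    qed
    then show "\<exists>d>0. \<forall>t. norm (t - s) < d \<longrightarrow>
        norm (Bcontfun (slice \<phi> t) - Bcontfun (slice \<phi> s) - (t - s) *\<^sub>R Bcontfun (slice ?d s)) \<le> e * norm (t - s)"
      using e C(1) by (intro exI[of _ "e / (C + 1)"]) auto
  qed
qed

lemma slice_continuous:
  fixes \<phi> :: "real \<times> 'a::euclidean_space \<Rightarrow> real"
  shows "test_fun \<Omega> \<phi> \<Longrightarrow> continuous_on S (\<lambda>t. Bcontfun (slice \<phi> t))"
  by (intro continuous_at_imp_continuous_on ballI has_vector_derivative_continuous[OF slice_has_vector_derivative])

lemma slice_vanishes:
  fixes \<phi> :: "real \<times> 'a::euclidean_space \<Rightarrow> real"
  assumes \<phi>: "test_fun ({..<\<tau>} \<times> UNIV) \<phi>" and \<tau>: "\<tau> > 0"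
  obtains T where "0 \<le> T" "T < \<tau>" "\<And>t. t \<ge> T \<Longrightarrow> Bcontfun (slice \<phi> t) = 0"
proof -
  obtain K where K: "compact K" "K \<subseteq> {..<\<tau>} \<times> UNIV" "\<And>z. z \<notin> K \<Longrightarrow> \<phi> z = 0"
    using test_fun_supportE[OF \<phi>] by blast
  have "\<exists>M<\<tau>. \<forall>z\<in>K. fst z \<le> M"
  proof (cases "K = {}")
    case False
    have "compact (fst ` K)" by (intro compact_continuous_image K continuous_intros)
    then obtain M where "M \<in> fst ` K" "\<forall>y\<in>fst ` K. y \<le> M"
      using False compact_attains_sup[of "fst ` K"] by auto
    then show ?thesis using K(2) by (intro exI[of _ M]) auto
  qed (use lt_ex in auto)
  then obtain M where M: "M < \<tau>" "\<And>z. z \<in> K \<Longrightarrow> fst z \<le> M" by blast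
  define T where "T = max 0 ((M + \<tau>) / 2)"
  have "M < (M + \<tau>) / 2" "(M + \<tau>) / 2 < \<tau>" using M(1) by auto
  then have T: "0 \<le> T" "T < \<tau>" "M < T" unfolding T_def using \<tau> by linarith+
  have "Bcontfun (slice \<phi> t) = 0" if "t \<ge> T" for t
  proof (rule bcontfun_eqI)
    fix x
    have "(t, x) \<notin> K" using M(2)[of "(t, x)"] that T(3) by auto
    then show "apply_bcontfun (Bcontfun (slice \<phi> t)) x = apply_bcontfun 0 x"
      using K(3) by (simp add: apply_Bcontfun_test[OF test_fun_slice(1)[OF \<phi>]] slice_def)
  qed
  with T show ?thesis using that by blast
qed

section \<open>Integration in time\<close>

text \<open>Curves that are continuous on \<open>(0, \<tau>)\<close> and bounded up to every time before \<open>\<tau>\<close>. Continuity at time \<open>0\<close> is not required,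
  because the gradient of \<open>sqrt \<rho>\<close> may fail to be continuous there.\<close>

definition tame_curve :: "real \<Rightarrow> (real \<Rightarrow> 'h::real_normed_vector) \<Rightarrow> bool" where
  "tame_curve \<tau> F \<longleftrightarrow> continuous_on {0<..<\<tau>} F \<and> (\<forall>T<\<tau>. bounded (F ` {0..T}))"

lemma continuous_imp_tame:
  assumes "continuous_on {0..<\<tau>} F" shows "tame_curve \<tau> F"
  unfolding tame_curve_def
proof (intro conjI allI impI)
  show "continuous_on {0<..<\<tau>} F" by (rule continuous_on_subset[OF assms]) auto
  fix T assume "T < \<tau>"
  then have "continuous_on {0..T} F" by (intro continuous_on_subset[OF assms]) auto
  then show "bounded (F ` {0..T})" by (intro compact_imp_bounded compact_continuous_image) auto
qed

lemma set_integrable_wip: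
  fixes \<phi> :: "real \<times> 'a::euclidean_space \<Rightarrow> real"
  assumes \<phi>: "test_fun ({..<\<tau>} \<times> UNIV) \<phi>" and \<tau>: "\<tau> > 0" and F: "tame_curve \<tau> F" and G: "tame_curve \<tau> G"
  shows "set_integrable lebesgue {0..<\<tau>} (\<lambda>t. wip (slice \<phi> t) (F t) (G t))"
proof -
  let ?h = "\<lambda>t. wip (slice \<phi> t) (F t) (G t)"
  obtain T where T: "0 \<le> T" "T < \<tau>" "\<And>t. t \<ge> T \<Longrightarrow> Bcontfun (slice \<phi> t) = 0"
    by (rule slice_vanishes[OF \<phi> \<tau>]) (rule that)
  have cont: "continuous_on {0<..<\<tau>} ?h"
    unfolding wip_def using F G
    by (intro continuous_intros bounded_bilinear.continuous_on[OF bounded_bilinear_mulC] slice_continuous[OF \<phi>])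
       (auto simp: tame_curve_def)
  have "bounded ((\<lambda>t. Bcontfun (slice \<phi> t)) ` {0..T})"
    by (intro compact_imp_bounded compact_continuous_image slice_continuous[OF \<phi>]) auto
  moreover have "bounded (F ` {0..T})" "bounded (G ` {0..T})" using F G T(2) by (auto simp: tame_curve_def)
  ultimately obtain b f g where bfg: "\<forall>y\<in>(\<lambda>t. Bcontfun (slice \<phi> t)) ` {0..T}. norm y \<le> b"
    "\<forall>y\<in>F ` {0..T}. norm y \<le> f" "\<forall>y\<in>G ` {0..T}. norm y \<le> g"
    unfolding bounded_iff by blast
  have b: "norm (Bcontfun (slice \<phi> t)) \<le> b" and f: "norm (F t) \<le> f" and g: "norm (G t) \<le> g"
    if "t \<in> {0..T}" for t
    using bfg that by blast+
  obtain K where K: "K \<ge> 0" "\<And>B H. norm (mulC B H :: 'a l2) \<le> norm B * norm H * K"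
    using bounded_bilinear.nonneg_bounded[OF bounded_bilinear_mulC, where ?'a1 = 'a] by blast
  define C where "C = b * f * K * g"
  have hb: "\<bar>?h t\<bar> \<le> C * indicator {0..T} t" if "t \<in> {0<..<\<tau>}" for t
  proof (cases "t \<le> T")
    case True
    then have t: "t \<in> {0..T}" using that by auto
    have pos: "0 \<le> b" "0 \<le> f" "0 \<le> g"
      using b[OF t] f[OF t] g[OF t] norm_ge_zero order_trans by blast+
    have "\<bar>?h t\<bar> \<le> norm (mulC (Bcontfun (slice \<phi> t)) (F t)) * norm (G t)"
      unfolding wip_def by (rule Cauchy_Schwarz_ineq2)
    also have "\<dots> \<le> (norm (Bcontfun (slice \<phi> t)) * norm (F t) * K) * norm (G t)"
      by (intro mult_right_mono K norm_ge_zero)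
    also have "\<dots> \<le> C"
      unfolding C_def using b[OF t] f[OF t] g[OF t] K(1) pos by (intro mult_mono mult_nonneg_nonneg) auto
    finally show ?thesis using t by simp
  next
    case False
    then show ?thesis using T(3)[of t] by (simp add: wip_def mulC.zero_left)
  qed
  have "integrable lborel (\<lambda>t. indicator {0<..<\<tau>} t *\<^sub>R ?h t)"
  proof (rule Bochner_Integration.integrable_bound)
    show "integrable lborel (\<lambda>t. C * indicator {0..T} t)"
      using T(1) by (intro integrable_mult_right integrable_real_indicator) simp_all
    show "(\<lambda>t. indicator {0<..<\<tau>} t *\<^sub>R ?h t) \<in> borel_measurable lborel"
      using borel_measurable_continuous_on_indicator[OF _ cont] by simp
    have "norm (indicator {0<..<\<tau>} t *\<^sub>R ?h t) \<le> norm (C * indicator {0..T} t)" for t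
      using hb[of t] by (cases "t \<in> {0<..<\<tau>}") auto
    then show "AE t in lborel. norm (indicator {0<..<\<tau>} t *\<^sub>R ?h t) \<le> norm (C * indicator {0..T} t)" by simp
  qed
  then have "integrable lebesgue (\<lambda>t. indicator {0<..<\<tau>} t *\<^sub>R ?h t)"
    by (simp add: integrable_completion borel_measurable_integrable)
  moreover have "integrable lebesgue (\<lambda>t. ?h 0 * indicator {0::real} t)"
    by (intro integrable_mult_right integrable_real_indicator) auto
  ultimately have "integrable lebesgue (\<lambda>t. indicator {0<..<\<tau>} t *\<^sub>R ?h t + ?h 0 * indicator {0} t)"
    by (rule Bochner_Integration.integrable_add)
  also have "(\<lambda>t. indicator {0<..<\<tau>} t *\<^sub>R ?h t + ?h 0 * indicator {0} t) = (\<lambda>t. indicator {0..<\<tau>} t *\<^sub>R ?h t)"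
    using \<tau> by (auto simp: indicator_def fun_eq_iff)
  finally show ?thesis by (simp add: set_integrable_def)
qed

text \<open>The value at time \<open>0\<close> does not matter for integrability or the integral.\<close>

lemma set_integral_cong_interior:
  fixes f g :: "real \<Rightarrow> real"
  assumes g: "set_integrable lebesgue {0..<\<tau>} g" and eq: "\<And>t. t \<in> {0<..<\<tau>} \<Longrightarrow> f t = g t"
  shows "set_integrable lebesgue {0..<\<tau>} f"
    and "(LINT t:{0..<\<tau>}|lebesgue. f t) = (LINT t:{0..<\<tau>}|lebesgue. g t)"
proof -
  define c where "c = (if \<tau> > 0 then f 0 - g 0 else 0)"
  have e: "(\<lambda>t. indicator {0..<\<tau>} t *\<^sub>R f t) = (\<lambda>t. indicator {0..<\<tau>} t *\<^sub>R g t + c * indicator {0} t)"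
  proof
    fix t
    show "indicator {0..<\<tau>} t *\<^sub>R f t = indicator {0..<\<tau>} t *\<^sub>R g t + c * indicator {0} t"
      using eq[of t] by (cases "t = 0") (auto simp: c_def indicator_def)
  qed
  have i: "integrable lebesgue (\<lambda>t. c * indicator {0::real} t)"
    by (intro integrable_mult_right integrable_real_indicator) auto
  show "set_integrable lebesgue {0..<\<tau>} f"
    using g i unfolding set_integrable_def e by (rule Bochner_Integration.integrable_add)
  show "(LINT t:{0..<\<tau>}|lebesgue. f t) = (LINT t:{0..<\<tau>}|lebesgue. g t)"
    unfolding set_lebesgue_integral_def e
    using Bochner_Integration.integral_add[OF g[unfolded set_integrable_def] i] by simp
qed

text \<open>The fundamental theorem of calculus for a function that vanishes near the end of the time interval.\<close>

lemma time_integral_of_derivative: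
  fixes G g :: "real \<Rightarrow> real"
  assumes cont: "continuous_on {0..<\<tau>} G"
    and der: "\<And>t. t \<in> {0<..<\<tau>} \<Longrightarrow> (G has_real_derivative g t) (at t)"
    and T: "0 \<le> T" "T < \<tau>" "\<And>t. t \<ge> T \<Longrightarrow> G t = 0"
    and int: "set_integrable lebesgue {0..<\<tau>} g"
  shows "(LINT t:{0..<\<tau>}|lebesgue. g t) = - G 0"
proof -
  define T' where "T' = (T + \<tau>) / 2"
  have T': "T < T'" "T' < \<tau>" using T by (auto simp: T'_def)
  have g0: "g t = 0" if "t \<in> {T<..<\<tau>}" for t
  proof -
    have "((\<lambda>t. 0) has_real_derivative g t) (at t)"
      by (rule has_field_derivative_transform_within_open[OF der, of t "{T<..<\<tau>}"]) (use that T in auto)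
    then show ?thesis using DERIV_unique DERIV_const by blast
  qed
  have "(g has_integral G T' - G 0) {0..T'}"
  proof (rule fundamental_theorem_of_calculus_interior)
    show "continuous_on {0..T'} G" using T' by (intro continuous_on_subset[OF cont]) auto
    show "(G has_vector_derivative g t) (at t)" if "t \<in> {0<..<T'}" for t
      using der[of t] that T' by (simp add: has_real_derivative_iff_has_vector_derivative)
  qed (use T T' in auto)
  then have "(g has_integral - G 0) {0..T'}" using T(3)[of T'] T' by simp
  then have "((\<lambda>t. if t \<in> {0..T'} then g t else 0) has_integral - G 0) {0..<\<tau>}"
    using T' by (subst has_integral_restrict) auto
  then have "(g has_integral - G 0) {0..<\<tau>}"
    by (rule has_integral_eq[rotated]) (use g0 T' in auto)
  moreover have "(LINT t:{0..<\<tau>}|lebesgue. g t) = integral {0..<\<tau>} g"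
    by (rule set_lebesgue_integral_eq_integral(2)[OF int])
  ultimately show ?thesis using integral_unique by simp
qed

lemma wip_has_real_derivative:
  fixes \<phi> :: "real \<times> 'a::euclidean_space \<Rightarrow> real"
  assumes \<phi>: "test_fun \<Omega> \<phi>" and F: "(F has_vector_derivative F') (at s)" and G: "(G has_vector_derivative G') (at s)"
  shows "((\<lambda>t. wip (slice \<phi> t) (F t) (G t)) has_real_derivative
    wip (slice (dir_deriv (1, 0) \<phi>) s) (F s) (G s) + wip (slice \<phi> s) F' (G s) + wip (slice \<phi> s) (F s) G') (at s)"
  using bounded_bilinear.has_vector_derivative[OF bounded_bilinear_inner
      bounded_bilinear.has_vector_derivative[OF bounded_bilinear_mulC slice_has_vector_derivative[OF \<phi>] F] G]
  by (simp add: has_real_derivative_iff_has_vector_derivative wip_def inner_add_left algebra_simps)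

lemma vector_derivative_quotient_tendsto:
  assumes "(u has_vector_derivative W) (at s)"
  shows "((\<lambda>t. (u t - u s) /\<^sub>R (t - s)) \<longlongrightarrow> W) (at s)"
proof (rule LIM_zero_cancel, rule tendsto_norm_zero_cancel)
  have "((\<lambda>t. norm (u t - u s - (t - s) *\<^sub>R W) / norm (t - s)) \<longlongrightarrow> 0) (at s)"
    using assms by (simp add: has_vector_derivative_def has_derivative_iff_norm)
  moreover have "\<forall>\<^sub>F t in at s. norm (u t - u s - (t - s) *\<^sub>R W) / norm (t - s) = norm ((u t - u s) /\<^sub>R (t - s) - W)"
    unfolding eventually_at_filter
  proof (rule always_eventually, intro allI impI)
    fix t assume t: "t \<noteq> s"
    have "(u t - u s) /\<^sub>R (t - s) - W = (u t - u s - (t - s) *\<^sub>R W) /\<^sub>R (t - s)"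
      using t by (simp add: scaleR_diff_right)
    then show "norm (u t - u s - (t - s) *\<^sub>R W) / norm (t - s) = norm ((u t - u s) /\<^sub>R (t - s) - W)"
      by (simp add: divide_inverse mult.commute)
  qed
  ultimately show "((\<lambda>t. norm ((u t - u s) /\<^sub>R (t - s) - W)) \<longlongrightarrow> 0) (at s)"
    by (rule Lim_transform_eventually)
qed

text \<open>A product in which the second factor is merely continuous, but is the weak derivative of a
  differentiable curve: the spatial derivative is moved to the first factor.\<close>

lemma wip_weak_deriv_has_real_derivative:
  fixes \<phi> :: "real \<times> 'a::euclidean_space \<Rightarrow> real"
  assumes \<phi>: "test_fun \<Omega> \<phi>" and s: "s \<in> S" "open S"
    and F: "((\<lambda>t. cls (f t)) has_vector_derivative F') (at s)" and f1: "wd v (f s) (f1 s)"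
    and H: "((\<lambda>t. cls (h t)) has_vector_derivative H') (at s)"
    and h1: "\<And>t. t \<in> S \<Longrightarrow> wd v (h t) (h1 t)" and h1c: "continuous (at s) (\<lambda>t. cls (h1 t))"
  shows "((\<lambda>t. wip (slice \<phi> t) (cls (f t)) (cls (h1 t))) has_real_derivative
    wip (slice (dir_deriv (1, 0) \<phi>) s) (cls (f s)) (cls (h1 s)) + wip (slice \<phi> s) F' (cls (h1 s))
    - (wip (slice \<phi> s) (cls (f1 s)) H' + wip (slice (dir_deriv (0, v) \<phi>) s) (cls (f s)) H')) (at s)"
proof -
  define u where "u t = mulC (Bcontfun (slice \<phi> t)) (cls (f t))" for t
  define W where "W = mulC (Bcontfun (slice \<phi> s)) F' + mulC (Bcontfun (slice (dir_deriv (1, 0) \<phi>) s)) (cls (f s))"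
  have u: "(u has_vector_derivative W) (at s)"
    unfolding u_def[abs_def] W_def
    by (rule bounded_bilinear.has_vector_derivative[OF bounded_bilinear_mulC slice_has_vector_derivative[OF \<phi>] F])
  have 1: "((\<lambda>t. (u t - u s) \<bullet> cls (h1 t)) has_real_derivative W \<bullet> cls (h1 s)) (at s)"
    unfolding has_field_derivative_iff
  proof -
    have "((\<lambda>t. ((u t - u s) /\<^sub>R (t - s)) \<bullet> cls (h1 t)) \<longlongrightarrow> W \<bullet> cls (h1 s)) (at s)"
      by (intro tendsto_inner vector_derivative_quotient_tendsto[OF u])
         (use h1c in \<open>simp add: continuous_at\<close>)
    then show "((\<lambda>t. ((u t - u s) \<bullet> cls (h1 t) - (u s - u s) \<bullet> cls (h1 s)) / (t - s)) \<longlongrightarrow> W \<bullet> cls (h1 s)) (at s)"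
      by (simp add: divide_inverse mult.commute)
  qed
  have w2: "((\<lambda>t. wip g K (cls (h t))) has_real_derivative wip g K H') (at s)" for g K
    unfolding wip_def has_real_derivative_iff_has_vector_derivative
    by (rule bounded_linear.has_vector_derivative[OF bounded_linear_inner_right H])
  have 2: "((\<lambda>t. (u t - u s) \<bullet> cls (h1 t) - (wip (slice \<phi> s) (cls (f1 s)) (cls (h t)) + wip (slice (dir_deriv (0, v) \<phi>) s) (cls (f s)) (cls (h t))))
     has_real_derivative W \<bullet> cls (h1 s) - (wip (slice \<phi> s) (cls (f1 s)) H' + wip (slice (dir_deriv (0, v) \<phi>) s) (cls (f s)) H')) (at s)"
    by (intro DERIV_diff DERIV_add 1 w2)
  have eq: "(u t - u s) \<bullet> cls (h1 t) - (wip (slice \<phi> s) (cls (f1 s)) (cls (h t)) + wip (slice (dir_deriv (0, v) \<phi>) s) (cls (f s)) (cls (h t)))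
      = wip (slice \<phi> t) (cls (f t)) (cls (h1 t))" if "t \<in> S" for t
    using wip_integration_by_parts[OF test_fun_slice(1)[OF \<phi>, of s] f1 h1[OF that]]
    unfolding test_fun_slice(2)[OF \<phi>] by (simp add: u_def wip_def inner_diff_left)
  have "((\<lambda>t. wip (slice \<phi> t) (cls (f t)) (cls (h1 t))) has_real_derivative
     W \<bullet> cls (h1 s) - (wip (slice \<phi> s) (cls (f1 s)) H' + wip (slice (dir_deriv (0, v) \<phi>) s) (cls (f s)) H')) (at s)"
    by (rule has_field_derivative_transform_within_open[OF 2 s(2,1) eq])
  then show ?thesis by (simp add: W_def wip_def inner_add_left algebra_simps)
qed

text \<open>A function equal almost everywhere to a combination of two products, tested with \<open>\<phi>\<close> at time \<open>t\<close>.\<close>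

lemma slice_integral:
  fixes F :: "'a::euclidean_space \<Rightarrow> real"
  assumes F: "AE x in lebesgue. F x = c1 * (f1 x * f2 x) + c2 * (f3 x * f4 x)"
    and L: "L2fun f1" "L2fun f2" "L2fun f3" "L2fun f4"
  shows "loc_integrable F"
    and "test_fun \<Omega> \<phi> \<Longrightarrow> (LINT x|lebesgue. \<phi> (t, x) *\<^sub>R F x) =
      c1 * wip (slice \<phi> t) (cls f1) (cls f2) + c2 * wip (slice \<phi> t) (cls f3) (cls f4)"
proof -
  let ?G = "\<lambda>x. c1 * (f1 x * f2 x) + c2 * (f3 x * f4 x)"
  have Gm: "?G \<in> borel_measurable lebesgue"
    using L[THEN L2fun_measurable] by measurable
  have Fm: "F \<in> borel_measurable lebesgue"
    by (rule borel_measurable_AE[OF Gm]) (use F in \<open>auto elim: eventually_mono\<close>)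
  have Gi: "integrable lebesgue ?G"
    using L2fun_mult_integrable[OF L(1,2)] L2fun_mult_integrable[OF L(3,4)] by simp
  have Fi: "integrable lebesgue F"
    by (rule integrable_cong_AE_imp[OF Gi Fm]) (use F in \<open>auto elim: eventually_mono\<close>)
  show "loc_integrable F"
    unfolding loc_integrable_def set_integrable_def
    using integrable_mult_indicator[OF _ Fi]
    by (auto dest!: compact_imp_closed intro: borel_closed sets_completionI_sets)
  assume \<phi>: "test_fun \<Omega> \<phi>"
  note g = test_fun_slice(1)[OF \<phi>, of t]
  have gm: "slice \<phi> t \<in> borel_measurable lebesgue"
    by (rule continuous_lebesgue_measurable[OF test_fun_continuous[OF g]])
  have i: "integrable lebesgue (\<lambda>x. slice \<phi> t x * (f1 x * f2 x))" "integrable lebesgue (\<lambda>x. slice \<phi> t x * (f3 x * f4 x))"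
    using L2fun_mult_integrable[OF test_fun_mult_L2fun[OF g L(1)] L(2)]
      L2fun_mult_integrable[OF test_fun_mult_L2fun[OF g L(3)] L(4)] by (simp_all add: mult.assoc)
  have "(LINT x|lebesgue. \<phi> (t, x) *\<^sub>R F x) = (LINT x|lebesgue. slice \<phi> t x * ?G x)"
  proof (rule integral_cong_AE)
    show "AE x in lebesgue. \<phi> (t, x) *\<^sub>R F x = slice \<phi> t x * ?G x"
      using F by eventually_elim (simp add: slice_def)
    show "(\<lambda>x. \<phi> (t, x) *\<^sub>R F x) \<in> borel_measurable lebesgue"
      using borel_measurable_times[OF gm Fm] by (simp add: slice_def)
  qed (use gm Gm in measurable)
  also have "\<dots> = (LINT x|lebesgue. c1 * (slice \<phi> t x * (f1 x * f2 x)) + c2 * (slice \<phi> t x * (f3 x * f4 x)))"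
    by (simp add: algebra_simps)
  also have "\<dots> = c1 * wip (slice \<phi> t) (cls f1) (cls f2) + c2 * wip (slice \<phi> t) (cls f3) (cls f4)"
    using i by (simp add: wip_cls[OF g] L)
  finally show "(LINT x|lebesgue. \<phi> (t, x) *\<^sub>R F x) =
      c1 * wip (slice \<phi> t) (cls f1) (cls f2) + c2 * wip (slice \<phi> t) (cls f3) (cls f4)" .
qed

section \<open>Density, velocity and the two balance laws\<close>

context schroedinger_flow
begin

text \<open>The components of \<open>norm \<psi>\<close> times the logarithmic derivative of \<open>\<psi>\<close>: the gradient of \<open>sqrt \<rho>\<close>, and
  \<open>(m / hbar) sqrt \<rho> u\<close>.\<close>

definition "r j t x = (a t x * a1 j t x + b t x * b1 j t x) / norm (\<psi> t x)"
definition "w j t x = (a t x * b1 j t x - b t x * a1 j t x) / norm (\<psi> t x)"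

lemma norm_psi: "norm (\<psi> t x) = sqrt ((a t x)\<^sup>2 + (b t x)\<^sup>2)" "mass_density \<psi> t x = (a t x)\<^sup>2 + (b t x)\<^sup>2"
  "sqrt (mass_density \<psi> t x) = sqrt ((a t x)\<^sup>2 + (b t x)\<^sup>2)"
  by (simp_all add: cmod_def mass_density_def cmod_power2 a_def b_def)

lemma wd_sqrt_density:
  "t \<in> {0..<\<tau>} \<Longrightarrow> wd (axis j 1) (\<lambda>x. sqrt (mass_density \<psi> t x)) (r j t)"
  using wd_modulus[OF wd_parts(1) wd_parts(2), of t t j]
  by (simp add: norm_psi r_def[abs_def])

lemma norm_parts_le: "\<bar>a t x\<bar> \<le> norm (\<psi> t x)" "\<bar>b t x\<bar> \<le> norm (\<psi> t x)"
  by (simp_all add: a_def b_def abs_Re_le_cmod abs_Im_le_cmod)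

lemma quotient_bound:
  fixes p q c d n :: real
  assumes "\<bar>p\<bar> \<le> n" "\<bar>q\<bar> \<le> n" shows "\<bar>(p * c + q * d) / n\<bar> \<le> \<bar>c\<bar> + \<bar>d\<bar>"
proof (cases "n = 0")
  case False
  have n: "n > 0" using assms(1) False by linarith
  have "\<bar>p * c + q * d\<bar> \<le> \<bar>p\<bar> * \<bar>c\<bar> + \<bar>q\<bar> * \<bar>d\<bar>"
    using abs_triangle_ineq[of "p * c" "q * d"] by (simp add: abs_mult)
  also have "\<dots> \<le> n * \<bar>c\<bar> + n * \<bar>d\<bar>" using assms by (intro add_mono mult_right_mono) auto
  finally show ?thesis using n by (simp add: abs_divide pos_divide_le_eq algebra_simps)
qed simp

lemma r_w_bound: "\<bar>r j t x\<bar> \<le> \<bar>a1 j t x\<bar> + \<bar>b1 j t x\<bar>" "\<bar>w j t x\<bar> \<le> \<bar>a1 j t x\<bar> + \<bar>b1 j t x\<bar>"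
  using quotient_bound[OF norm_parts_le(1) norm_parts_le(2), of t x "a1 j t x" "b1 j t x"]
    quotient_bound[of "a t x" "norm (\<psi> t x)" "- b t x" "b1 j t x" "a1 j t x"] norm_parts_le[of t x]
  by (simp_all add: r_def w_def)

lemma L2_r_w:
  assumes t: "t \<in> {0..<\<tau>}" shows "L2fun (r j t)" "L2fun (w j t)"
    and "norm (cls (r j t)) \<le> norm (cls (a1 j t)) + norm (cls (b1 j t))"
proof -
  note L = L2_parts[OF t]
  show r: "L2fun (r j t)" using wd_L2fun(2)[OF wd_sqrt_density[OF t]] .
  have abs: "L2fun (\<lambda>x. \<bar>f x\<bar>)" if "L2fun f" for f :: "real^'n \<Rightarrow> real"
    by (rule L2fun_dominated[OF that, of _ 1]) (use L2fun_measurable[OF that] in auto)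
  have nabs: "norm (cls (\<lambda>x. \<bar>f x\<bar>)) \<le> norm (cls f)" if "L2fun f" for f :: "real^'n \<Rightarrow> real"
    using norm_cls_mono[OF abs[OF that] that, of 1] by simp
  have s: "L2fun (\<lambda>x. \<bar>a1 j t x\<bar> + \<bar>b1 j t x\<bar>)" by (intro L2fun_add abs L)
  have "w j t \<in> borel_measurable lebesgue"
    unfolding w_def[abs_def] norm_psi(1) using L[THEN L2fun_measurable] by measurable
  then show "L2fun (w j t)"
    by (rule L2fun_dominated[OF s, of _ 1]) (use r_w_bound(2) in auto)
  have "norm (cls (r j t)) \<le> 1 * norm (cls (\<lambda>x. \<bar>a1 j t x\<bar> + \<bar>b1 j t x\<bar>))"
    by (rule norm_cls_mono[OF r s]) (use r_w_bound(1) in auto)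
  also have "cls (\<lambda>x. \<bar>a1 j t x\<bar> + \<bar>b1 j t x\<bar>) = cls (\<lambda>x. \<bar>a1 j t x\<bar>) + cls (\<lambda>x. \<bar>b1 j t x\<bar>)"
    by (intro cls_add abs L)
  also have "1 * norm \<dots> \<le> norm (cls (a1 j t)) + norm (cls (b1 j t))"
    using norm_triangle_ineq[of "cls (\<lambda>x. \<bar>a1 j t x\<bar>)" "cls (\<lambda>x. \<bar>b1 j t x\<bar>)"] nabs[OF L(3), of j] nabs[OF L(4), of j]
    by linarith
  finally show "norm (cls (r j t)) \<le> norm (cls (a1 j t)) + norm (cls (b1 j t))" .
qed

lemma tame_parts:
  "tame_curve \<tau> (\<lambda>t. cls (a t))" "tame_curve \<tau> (\<lambda>t. cls (b t))"
  "tame_curve \<tau> (\<lambda>t. cls (a1 j t))" "tame_curve \<tau> (\<lambda>t. cls (b1 j t))"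
  "tame_curve \<tau> (\<lambda>t. cls (\<lambda>x. weak_deriv k V x * a t x))" "tame_curve \<tau> (\<lambda>t. cls (\<lambda>x. weak_deriv k V x * b t x))"
  using continuous_V_mult(2)[OF L2_parts(1) continuous_parts(1)] continuous_V_mult(2)[OF L2_parts(2) continuous_parts(2)]
  by (auto intro!: continuous_imp_tame continuous_parts)

text \<open>At positive times the wave function vanishes almost nowhere, so that the gradient of \<open>sqrt \<rho>\<close>
  varies continuously.\<close>

lemma tame_r: "tame_curve \<tau> (\<lambda>t. cls (r j t))"
  unfolding tame_curve_def
proof (intro conjI allI impI)
  have eq: "r j t = (\<lambda>x. Re (cnj (sgn (\<psi> t x)) * weak_deriv j (\<psi> t) x))" for t
    by (auto simp: r_def a_def b_def a1_def b1_def sgn_eq fun_eq_iff add_divide_distrib)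
  show "continuous_on {0<..<\<tau>} (\<lambda>t. cls (r j t))"
    unfolding continuous_on_def eq
  proof
    fix t assume t: "t \<in> {0<..<\<tau>}"
    then have t': "t \<in> {0..<\<tau>}" by simp
    show "((\<lambda>t. cls (\<lambda>x. Re (cnj (sgn (\<psi> t x)) * weak_deriv j (\<psi> t) x))) \<longlongrightarrow>
        cls (\<lambda>x. Re (cnj (sgn (\<psi> t x)) * weak_deriv j (\<psi> t) x))) (at t within {0<..<\<tau>})"
      by (rule sgn_pairing_tendsto[OF _ _ t tendsto_within_subset[OF continuous_curve_sq_dist(1)[OF curve t']]
            tendsto_within_subset[OF continuous_curve_sq_dist(2)[OF curve t']] nonzero[OF t]])
         (auto intro!: in_H_2D in_H)
  qed
  fix T assume T: "T < \<tau>"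
  have "bounded ((\<lambda>t. cls (a1 j t)) ` {0..T})" "bounded ((\<lambda>t. cls (b1 j t)) ` {0..T})"
    using tame_parts(3,4) T by (auto simp: tame_curve_def)
  then obtain A B where AB: "\<forall>y\<in>(\<lambda>t. cls (a1 j t)) ` {0..T}. norm y \<le> A" "\<forall>y\<in>(\<lambda>t. cls (b1 j t)) ` {0..T}. norm y \<le> B"
    unfolding bounded_iff by blast
  have "norm (cls (r j t)) \<le> A + B" if t: "t \<in> {0..T}" for t
  proof -
    have "norm (cls (a1 j t)) \<le> A" "norm (cls (b1 j t)) \<le> B" using AB t by blast+
    moreover have "t \<in> {0..<\<tau>}" using t T by simp
    ultimately show ?thesis using L2_r_w(3)[of t j] by linarith
  qed
  then show "bounded ((\<lambda>t. cls (r j t)) ` {0..T})"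
    unfolding bounded_iff by blast
qed

lemma velocity_eq:
  assumes pos: "mass_density \<psi> t x > 0"
    and cnj: "weak_deriv k (\<lambda>z. cnj (\<psi> t z)) x = cnj (weak_deriv k (\<psi> t) x)"
  shows "velocity hbar m \<psi> t x $ k = hbar * (a t x * b1 k t x - b t x * a1 k t x) / (m * mass_density \<psi> t x)"
proof -
  let ?z = "\<psi> t x" and ?p = "weak_deriv k (\<psi> t) x"
  have R: "R_tilde hbar \<psi> t x 0 = of_real (mass_density \<psi> t x)"
    unfolding R_tilde_def mass_density_def complex_norm_square by simp
  have "- \<i> * (grad_y_R_tilde_0 hbar \<psi> t x $ k) = of_real (hbar * (a t x * b1 k t x - b t x * a1 k t x))"
    by (simp add: grad_y_R_tilde_0_def cnj a_def b_def a1_def b1_def complex_eq_iff field_simps)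
  then have "Re (- \<i> * (grad_y_R_tilde_0 hbar \<psi> t x $ k) / (of_real m * R_tilde hbar \<psi> t x 0))
      = hbar * (a t x * b1 k t x - b t x * a1 k t x) / (m * mass_density \<psi> t x)"
    unfolding R by (simp only: of_real_mult[symmetric] of_real_divide[symmetric] Re_complex_of_real)
  then show ?thesis using pos by (simp add: velocity_def)
qed

lemma weak_deriv_cnj:
  assumes "t \<in> {0..<\<tau>}"
  shows "AE x in lebesgue. weak_deriv k (\<lambda>z. cnj (\<psi> t z)) x = cnj (weak_deriv k (\<psi> t) x)"
  by (rule weak_deriv_eq_complex[OF has_weak_deriv_bounded_linear[OF bounded_linear_cnj in_H_2D(4)[OF in_H[OF assms]]]])

text \<open>Where \<open>\<rho> = 0\<close> both sides vanish, since then \<open>a = b = 0\<close>.\<close>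

lemma momentum_eq:
  assumes "t \<in> {0..<\<tau>}"
  shows "AE x in lebesgue. mass_density \<psi> t x * velocity hbar m \<psi> t x $ k
    = hbar / m * (a t x * b1 k t x) + (- (hbar / m)) * (b t x * a1 k t x)"
  using weak_deriv_cnj[OF assms, of k]
proof eventually_elim
  case (elim x)
  show ?case
  proof (cases "mass_density \<psi> t x > 0")
    case True
    then show ?thesis using m by (simp add: velocity_eq[OF True elim] field_simps)
  next
    case False
    then have "a t x = 0" "b t x = 0" "mass_density \<psi> t x = 0"
      by (auto simp: mass_density_def a_def b_def)
    then show ?thesis by simp
  qed
qed

lemma momentum_flux_eq:
  assumes "t \<in> {0..<\<tau>}"
  shows "AE x in lebesgue. mass_density \<psi> t x * (velocity hbar m \<psi> t x $ j * velocity hbar m \<psi> t x $ k)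
    = (hbar / m)\<^sup>2 * (w j t x * w k t x) + 0 * (w j t x * w k t x)"
  using weak_deriv_cnj[OF assms, of j] weak_deriv_cnj[OF assms, of k]
proof eventually_elim
  case (elim x)
  show ?case
  proof (cases "mass_density \<psi> t x > 0")
    case True
    have n: "norm (\<psi> t x) * norm (\<psi> t x) = mass_density \<psi> t x" by (simp add: mass_density_def power2_eq_square)
    have eq: "w j t x * w k t x = (a t x * b1 j t x - b t x * a1 j t x) * (a t x * b1 k t x - b t x * a1 k t x) / mass_density \<psi> t x"
      unfolding w_def times_divide_times_eq n ..
    show ?thesis
      unfolding velocity_eq[OF True elim(1)] velocity_eq[OF True elim(2)] eq
      using True m by (simp add: field_simps power2_eq_square)
  next
    case False
    then have "mass_density \<psi> t x = 0" "norm (\<psi> t x) = 0" by (auto simp: mass_density_def)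
    then show ?thesis by (simp add: w_def)
  qed
qed

text \<open>The identity that trades \<open>\<rho> u\<^sub>j u\<^sub>k\<close> for products of gradients; it needs \<open>\<psi> \<noteq> 0\<close> almost everywhere.\<close>

lemma wip_w:
  assumes t: "t \<in> {0<..<\<tau>}" and g: "test_fun UNIV g"
  shows "wip g (cls (w j t)) (cls (w k t)) =
    wip g (cls (a1 j t)) (cls (a1 k t)) + wip g (cls (b1 j t)) (cls (b1 k t)) - wip g (cls (r j t)) (cls (r k t))"
proof -
  have t': "t \<in> {0..<\<tau>}" using t by simp
  note L = L2_parts[OF t'] and L' = L2_r_w(1,2)[OF t']
  have i: "integrable lebesgue (\<lambda>x. g x * (f x * h x))" if "L2fun f" "L2fun h" for f h
    using L2fun_mult_integrable[OF test_fun_mult_L2fun[OF g that(1)] that(2)] by (simp add: mult.assoc)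
  have "wip g (cls (w j t)) (cls (w k t)) = (LINT x|lebesgue. g x * (a1 j t x * a1 k t x) + g x * (b1 j t x * b1 k t x) - g x * (r j t x * r k t x))"
    unfolding wip_cls[OF g L'(2) L'(2)]
  proof (rule integral_cong_AE)
    show "AE x in lebesgue. g x * (w j t x * w k t x) = g x * (a1 j t x * a1 k t x) + g x * (b1 j t x * b1 k t x) - g x * (r j t x * r k t x)"
      using nonzero[OF t]
    proof eventually_elim
      case (elim x)
      have n: "norm (\<psi> t x) * norm (\<psi> t x) = a t x * a t x + b t x * b t x"
        using norm_psi(2)[of t x] by (simp add: mass_density_def power2_eq_square)
      then have n0: "a t x * a t x + b t x * b t x \<noteq> 0" using elim by auto
      have "w j t x * w k t x + r j t x * r k t x = a1 j t x * a1 k t x + b1 j t x * b1 k t x"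
        unfolding w_def r_def times_divide_times_eq n add_divide_distrib[symmetric]
        using n0 by (simp add: divide_eq_eq) (simp add: algebra_simps)
      then have eq: "w j t x * w k t x = a1 j t x * a1 k t x + b1 j t x * b1 k t x - r j t x * r k t x" by linarith
      show ?case unfolding eq by (simp add: algebra_simps)
    qed
  qed (use i L L' in \<open>auto intro!: borel_measurable_integrable Bochner_Integration.integrable_add
      Bochner_Integration.integrable_diff\<close>)
  also have "\<dots> = wip g (cls (a1 j t)) (cls (a1 k t)) + wip g (cls (b1 j t)) (cls (b1 k t)) - wip g (cls (r j t)) (cls (r k t))"
    using i L L' by (simp add: wip_cls[OF g])
  finally show ?thesis .
qed

abbreviation "\<rho> \<equiv> mass_density \<psi>"
abbreviation "u \<equiv> velocity hbar m \<psi>"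

text \<open>The products in Madelung's system, as weighted inner products: \<open>P \<phi> F G t\<close> is
  \<open>\<integral> \<phi>(t,x) F(t,x) G(t,x) dx\<close>, and \<open>J\<close> integrates over \<open>[0, \<tau>)\<close>. The test functions \<open>TT\<close> need not vanish at
  time \<open>0\<close>.\<close>

abbreviation TT where "TT \<equiv> test_fun ({..<\<tau>} \<times> (UNIV :: (real^'n) set))"
abbreviation P where "P \<phi> F G t \<equiv> wip (slice \<phi> t) (cls (F t)) (cls (G t))"
abbreviation J where "J f \<equiv> (LINT t:{0..<\<tau>}|lebesgue. f t)"

lemma density_integral:
  assumes "t \<in> {0..<\<tau>}"
  shows "loc_integrable (\<rho> t)" "TT \<phi> \<Longrightarrow> (LINT x|lebesgue. \<phi> (t, x) *\<^sub>R \<rho> t x) = P \<phi> a a t + P \<phi> b b t"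
proof -
  have *: "AE x in lebesgue. \<rho> t x = 1 * (a t x * a t x) + 1 * (b t x * b t x)"
    by (simp add: norm_psi(2) power2_eq_square)
  show "loc_integrable (\<rho> t)" "TT \<phi> \<Longrightarrow> (LINT x|lebesgue. \<phi> (t, x) *\<^sub>R \<rho> t x) = P \<phi> a a t + P \<phi> b b t"
    using slice_integral[OF *] L2_parts[OF assms] by simp_all
qed

lemma momentum_integral:
  assumes "t \<in> {0..<\<tau>}"
  shows "loc_integrable (\<lambda>x. \<rho> t x * u t x $ k)"
    "TT \<phi> \<Longrightarrow> (LINT x|lebesgue. \<phi> (t, x) *\<^sub>R (\<rho> t x * u t x $ k)) = hbar / m * (P \<phi> a (b1 k) t - P \<phi> b (a1 k) t)"
proof -
  note L = L2_parts[OF assms]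
  note s = slice_integral[OF momentum_eq[OF assms] L(1) L(4) L(2) L(3)]
  show "loc_integrable (\<lambda>x. \<rho> t x * u t x $ k)" by (rule s(1))
  assume \<phi>: "TT \<phi>"
  show "(LINT x|lebesgue. \<phi> (t, x) *\<^sub>R (\<rho> t x * u t x $ k)) = hbar / m * (P \<phi> a (b1 k) t - P \<phi> b (a1 k) t)"
    unfolding s(2)[OF \<phi>] by (simp add: right_diff_distrib)
qed

lemma momentum_flux_integral:
  assumes "t \<in> {0..<\<tau>}"
  shows "loc_integrable (\<lambda>x. \<rho> t x * (u t x $ j * u t x $ k))"
    "TT \<phi> \<Longrightarrow> (LINT x|lebesgue. \<phi> (t, x) *\<^sub>R (\<rho> t x * (u t x $ j * u t x $ k))) = (hbar / m)\<^sup>2 * P \<phi> (w j) (w k) t"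
  using slice_integral[OF momentum_flux_eq[OF assms]] L2_r_w[OF assms] by simp_all

lemma force_integral:
  assumes "t \<in> {0..<\<tau>}"
  shows "loc_integrable (\<lambda>x. \<rho> t x * weak_deriv k V x)"
    "TT \<phi> \<Longrightarrow> (LINT x|lebesgue. \<phi> (t, x) *\<^sub>R (\<rho> t x * weak_deriv k V x)) =
      P \<phi> (\<lambda>t x. weak_deriv k V x * a t x) a t + P \<phi> (\<lambda>t x. weak_deriv k V x * b t x) b t"
proof -
  have *: "AE x in lebesgue. \<rho> t x * weak_deriv k V x =
      1 * ((weak_deriv k V x * a t x) * a t x) + 1 * ((weak_deriv k V x * b t x) * b t x)"
    by (simp add: norm_psi(2) power2_eq_square algebra_simps)
  show "loc_integrable (\<lambda>x. \<rho> t x * weak_deriv k V x)"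
    "TT \<phi> \<Longrightarrow> (LINT x|lebesgue. \<phi> (t, x) *\<^sub>R (\<rho> t x * weak_deriv k V x)) =
      P \<phi> (\<lambda>t x. weak_deriv k V x * a t x) a t + P \<phi> (\<lambda>t x. weak_deriv k V x * b t x) b t"
    using slice_integral[OF *] L2_parts[OF assms] L2_V_mult(2) by simp_all
qed

lemma sqrt_gradient_integral:
  fixes j k
  defines "s \<equiv> \<lambda>j t. weak_deriv j (\<lambda>x. sqrt (\<rho> t x))"
  assumes "t \<in> {0..<\<tau>}"
  shows "loc_integrable (\<lambda>x. s j t x * s k t x)"
    "TT \<phi> \<Longrightarrow> (LINT x|lebesgue. \<phi> (t, x) *\<^sub>R (s j t x * s k t x)) = P \<phi> (r j) (r k) t"
proof -
  have "AE x in lebesgue. s j t x = r j t x" for j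
    unfolding s_def by (rule weak_deriv_eq_real[OF wd_imp_has_weak_deriv[OF wd_sqrt_density[OF assms(2)]]])
  from this[of j] this[of k]
  have *: "AE x in lebesgue. s j t x * s k t x = 1 * (r j t x * r k t x) + 0 * (r j t x * r k t x)"
    by eventually_elim simp
  show "loc_integrable (\<lambda>x. s j t x * s k t x)"
    "TT \<phi> \<Longrightarrow> (LINT x|lebesgue. \<phi> (t, x) *\<^sub>R (s j t x * s k t x)) = P \<phi> (r j) (r k) t"
    using slice_integral[OF *] L2_r_w(1)[OF assms(2)] by simp_all
qed

lemma interior: "t \<in> {0<..<\<tau>} \<Longrightarrow> t \<in> {0..<\<tau>}"
  by simp

lemma integrable_P:
  assumes "TT \<phi>"
  shows "set_integrable lebesgue {0..<\<tau>} (P \<phi> a a)" "set_integrable lebesgue {0..<\<tau>} (P \<phi> b b)"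
    "set_integrable lebesgue {0..<\<tau>} (P \<phi> a (b1 k))" "set_integrable lebesgue {0..<\<tau>} (P \<phi> b (a1 k))"
    "set_integrable lebesgue {0..<\<tau>} (P \<phi> (a1 j) (a1 k))" "set_integrable lebesgue {0..<\<tau>} (P \<phi> (b1 j) (b1 k))"
    "set_integrable lebesgue {0..<\<tau>} (P \<phi> (r j) (r k))"
    "set_integrable lebesgue {0..<\<tau>} (P \<phi> (\<lambda>t x. weak_deriv k V x * a t x) a)"
    "set_integrable lebesgue {0..<\<tau>} (P \<phi> (\<lambda>t x. weak_deriv k V x * b t x) b)"
  by (intro set_integrable_wip[OF assms \<tau>] tame_parts tame_r)+

lemma distr_density:
  assumes \<phi>: "TT \<phi>"
  shows "set_integrable lebesgue {0..<\<tau>} (\<lambda>t. LINT x|lebesgue. \<phi> (t, x) *\<^sub>R \<rho> t x)"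
    and "distr_of \<tau> \<rho> \<phi> = J (P \<phi> a a) + J (P \<phi> b b)"
proof -
  note i = integrable_P[OF \<phi>]
  note * = set_integral_cong_interior[OF set_integral_add(1)[OF i(1,2)], of "\<lambda>t. LINT x|lebesgue. \<phi> (t, x) *\<^sub>R \<rho> t x",
      OF density_integral(2)[OF interior \<phi>]]
  show "set_integrable lebesgue {0..<\<tau>} (\<lambda>t. LINT x|lebesgue. \<phi> (t, x) *\<^sub>R \<rho> t x)" by (rule *(1))
  show "distr_of \<tau> \<rho> \<phi> = J (P \<phi> a a) + J (P \<phi> b b)"
    unfolding distr_of_def by (rule trans[OF *(2) set_integral_add(2)[OF i(1,2)]])
qed

lemma distr_momentum:
  assumes \<phi>: "TT \<phi>"
  shows "set_integrable lebesgue {0..<\<tau>} (\<lambda>t. LINT x|lebesgue. \<phi> (t, x) *\<^sub>R (\<rho> t x * u t x $ k))"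
    and "distr_of \<tau> (\<lambda>t x. \<rho> t x * u t x $ k) \<phi> = hbar / m * (J (P \<phi> a (b1 k)) - J (P \<phi> b (a1 k)))"
proof -
  note i = integrable_P[OF \<phi>]
  note d = set_integral_diff[OF i(3)[of k] i(4)[of k]]
  have c: "set_integrable lebesgue {0..<\<tau>} (\<lambda>t. hbar / m * (P \<phi> a (b1 k) t - P \<phi> b (a1 k) t))"
    using d(1) by (rule set_integrable_mult_right)
  note * = set_integral_cong_interior[OF c, of "\<lambda>t. LINT x|lebesgue. \<phi> (t, x) *\<^sub>R (\<rho> t x * u t x $ k)",
      OF momentum_integral(2)[OF interior \<phi>]]
  show "set_integrable lebesgue {0..<\<tau>} (\<lambda>t. LINT x|lebesgue. \<phi> (t, x) *\<^sub>R (\<rho> t x * u t x $ k))" by (rule *(1))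
  show "distr_of \<tau> (\<lambda>t x. \<rho> t x * u t x $ k) \<phi> = hbar / m * (J (P \<phi> a (b1 k)) - J (P \<phi> b (a1 k)))"
    unfolding distr_of_def using *(2) unfolding set_integral_mult_right d(2) .
qed

lemma distr_momentum_flux:
  assumes \<phi>: "TT \<phi>"
  shows "set_integrable lebesgue {0..<\<tau>} (\<lambda>t. LINT x|lebesgue. \<phi> (t, x) *\<^sub>R (\<rho> t x * (u t x $ j * u t x $ k)))"
    and "distr_of \<tau> (\<lambda>t x. \<rho> t x * (u t x $ j * u t x $ k)) \<phi> =
      (hbar / m)\<^sup>2 * (J (P \<phi> (a1 j) (a1 k)) + J (P \<phi> (b1 j) (b1 k)) - J (P \<phi> (r j) (r k)))"
proof -
  note i = integrable_P[OF \<phi>]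
  note s = set_integral_add[OF i(5)[of j k] i(6)[of j k]]
  note d = set_integral_diff[OF s(1) i(7)[of j k]]
  have c: "set_integrable lebesgue {0..<\<tau>} (\<lambda>t. (hbar / m)\<^sup>2 * (P \<phi> (a1 j) (a1 k) t + P \<phi> (b1 j) (b1 k) t - P \<phi> (r j) (r k) t))"
    using d(1) by (rule set_integrable_mult_right)
  have e: "(LINT x|lebesgue. \<phi> (t, x) *\<^sub>R (\<rho> t x * (u t x $ j * u t x $ k))) =
      (hbar / m)\<^sup>2 * (P \<phi> (a1 j) (a1 k) t + P \<phi> (b1 j) (b1 k) t - P \<phi> (r j) (r k) t)" if "t \<in> {0<..<\<tau>}" for t
    unfolding momentum_flux_integral(2)[OF interior[OF that] \<phi>] wip_w[OF that test_fun_slice(1)[OF \<phi>]] ..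
  note * = set_integral_cong_interior[OF c, of "\<lambda>t. LINT x|lebesgue. \<phi> (t, x) *\<^sub>R (\<rho> t x * (u t x $ j * u t x $ k))", OF e]
  show "set_integrable lebesgue {0..<\<tau>} (\<lambda>t. LINT x|lebesgue. \<phi> (t, x) *\<^sub>R (\<rho> t x * (u t x $ j * u t x $ k)))" by (rule *(1))
  show "distr_of \<tau> (\<lambda>t x. \<rho> t x * (u t x $ j * u t x $ k)) \<phi> =
      (hbar / m)\<^sup>2 * (J (P \<phi> (a1 j) (a1 k)) + J (P \<phi> (b1 j) (b1 k)) - J (P \<phi> (r j) (r k)))"
    unfolding distr_of_def using *(2) unfolding set_integral_mult_right d(2) s(2) .
qed

lemma distr_force:
  assumes \<phi>: "TT \<phi>"
  shows "set_integrable lebesgue {0..<\<tau>} (\<lambda>t. LINT x|lebesgue. \<phi> (t, x) *\<^sub>R (\<rho> t x * weak_deriv k V x))"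
    and "distr_of \<tau> (\<lambda>t x. \<rho> t x * weak_deriv k V x) \<phi> =
      J (P \<phi> (\<lambda>t x. weak_deriv k V x * a t x) a) + J (P \<phi> (\<lambda>t x. weak_deriv k V x * b t x) b)"
proof -
  note i = integrable_P[OF \<phi>]
  note s = set_integral_add[OF i(8)[of k] i(9)[of k]]
  note * = set_integral_cong_interior[OF s(1), of "\<lambda>t. LINT x|lebesgue. \<phi> (t, x) *\<^sub>R (\<rho> t x * weak_deriv k V x)",
      OF force_integral(2)[OF interior \<phi>]]
  show "set_integrable lebesgue {0..<\<tau>} (\<lambda>t. LINT x|lebesgue. \<phi> (t, x) *\<^sub>R (\<rho> t x * weak_deriv k V x))" by (rule *(1))
  show "distr_of \<tau> (\<lambda>t x. \<rho> t x * weak_deriv k V x) \<phi> =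
      J (P \<phi> (\<lambda>t x. weak_deriv k V x * a t x) a) + J (P \<phi> (\<lambda>t x. weak_deriv k V x * b t x) b)"
    unfolding distr_of_def by (rule trans[OF *(2) s(2)])
qed

lemma distr_sqrt_gradient:
  fixes j k
  defines "s \<equiv> \<lambda>j t. weak_deriv j (\<lambda>x. sqrt (\<rho> t x))"
  assumes \<phi>: "TT \<phi>"
  shows "set_integrable lebesgue {0..<\<tau>} (\<lambda>t. LINT x|lebesgue. \<phi> (t, x) *\<^sub>R (s j t x * s k t x))"
    and "distr_of \<tau> (\<lambda>t x. s j t x * s k t x) \<phi> = J (P \<phi> (r j) (r k))"
proof -
  note * = set_integral_cong_interior[OF integrable_P(7)[OF \<phi>, of j k], of "\<lambda>t. LINT x|lebesgue. \<phi> (t, x) *\<^sub>R (s j t x * s k t x)",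
      unfolded s_def, OF sqrt_gradient_integral(2)[OF interior \<phi>]]
  show "set_integrable lebesgue {0..<\<tau>} (\<lambda>t. LINT x|lebesgue. \<phi> (t, x) *\<^sub>R (s j t x * s k t x))"
    unfolding s_def by (rule *(1))
  show "distr_of \<tau> (\<lambda>t x. s j t x * s k t x) \<phi> = J (P \<phi> (r j) (r k))"
    unfolding distr_of_def s_def by (rule *(2))
qed

lemma continuous_P:
  fixes F G :: "real \<Rightarrow> real^'n \<Rightarrow> real"
  assumes "TT \<phi>" "continuous_on S (\<lambda>t. cls (F t))" "continuous_on S (\<lambda>t. cls (G t))"
  shows "continuous_on S (P \<phi> F G)"
  unfolding wip_def
  by (intro continuous_on_inner bounded_bilinear.continuous_on[OF bounded_bilinear_mulC] slice_continuous[OF assms(1)] assms(2,3))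

abbreviation Dt where "Dt \<phi> \<equiv> dir_deriv (1, 0 :: real^'n) \<phi>"
abbreviation Dx where "Dx j \<phi> \<equiv> dir_deriv (0 :: real, axis j 1 :: real^'n) \<phi>"

text \<open>Both equations integrate the time derivative of the tested density or momentum; the initial value is the
  boundary term of the distributional time derivative.\<close>

lemma continuity_equation:
  assumes \<phi>: "TT \<phi>"
  shows "D_t \<tau> \<rho> \<phi> + (\<Sum>j\<in>UNIV. D_x j (distr_of \<tau> (\<lambda>t x. \<rho> t x * u t x $ j)) \<phi>) = 0"
proof -
  note d\<phi> = test_fun_dir_deriv[OF \<phi>]
  define G where "G t = P \<phi> a a t + P \<phi> b b t" for t
  define g where "g t = 1 * (\<Sum>j\<in>UNIV. hbar / m * (P (Dx j \<phi>) a (b1 j) t - P (Dx j \<phi>) b (a1 j) t))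
      + 1 * (P (Dt \<phi>) a a t + P (Dt \<phi>) b b t)" for t
  obtain T where T: "0 \<le> T" "T < \<tau>" "\<And>t. t \<ge> T \<Longrightarrow> Bcontfun (slice \<phi> t) = 0"
    by (rule slice_vanishes[OF \<phi> \<tau>]) (rule that)
  have int1: "set_integrable lebesgue {0..<\<tau>} (\<lambda>t. hbar / m * (P (Dx j \<phi>) a (b1 j) t - P (Dx j \<phi>) b (a1 j) t))" for j
    by (intro set_integrable_mult_right set_integral_diff(1) integrable_P d\<phi>)
  have int2: "set_integrable lebesgue {0..<\<tau>} (\<lambda>t. P (Dt \<phi>) a a t + P (Dt \<phi>) b b t)"
    by (intro set_integral_add(1) integrable_P d\<phi>)
  have "J g = - G 0"
  proof (rule time_integral_of_derivative[OF _ _ T(1,2)])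
    show "continuous_on {0..<\<tau>} G"
      unfolding G_def by (intro continuous_on_add continuous_P \<phi> continuous_parts)
    show "G t = 0" if "t \<ge> T" for t
      using T(3)[OF that] by (simp add: G_def wip_def mulC.zero_left)
    show "set_integrable lebesgue {0..<\<tau>} g"
      unfolding g_def
      by (intro set_integral_add(1) set_integrable_mult_right[of 1] int2)
         (rule set_integrable_sum, rule int1)
    fix t assume t: "t \<in> {0<..<\<tau>}"
    note d = time_derivatives[OF t]
    have mb: "2 * (wip (slice \<phi> t) (cls (a t)) (cls (da t)) + wip (slice \<phi> t) (cls (b t)) (cls (db t))) =
        (\<Sum>j\<in>UNIV. hbar / m * (P (Dx j \<phi>) a (b1 j) t - P (Dx j \<phi>) b (a1 j) t))"
      using mass_balance[OF test_fun_slice(1)[OF \<phi>, of t] interior[OF t]] unfolding test_fun_slice(2)[OF \<phi>] .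
    have "g t = (P (Dt \<phi>) a a t + wip (slice \<phi> t) (cls (da t)) (cls (a t)) + wip (slice \<phi> t) (cls (a t)) (cls (da t)))
        + (P (Dt \<phi>) b b t + wip (slice \<phi> t) (cls (db t)) (cls (b t)) + wip (slice \<phi> t) (cls (b t)) (cls (db t)))"
      unfolding g_def mb[symmetric] using wip_commute[of "slice \<phi> t" "cls (da t)"] wip_commute[of "slice \<phi> t" "cls (db t)"] by simp
    then show "(G has_real_derivative g t) (at t)"
      unfolding G_def[abs_def] by (auto intro!: DERIV_add wip_has_real_derivative[OF \<phi>] d)
  qed
  moreover have "J g = (\<Sum>j\<in>UNIV. distr_of \<tau> (\<lambda>t x. \<rho> t x * u t x $ j) (Dx j \<phi>)) + distr_of \<tau> \<rho> (Dt \<phi>)"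
  proof -
    have "J g = 1 * (\<Sum>j\<in>UNIV. J (\<lambda>t. hbar / m * (P (Dx j \<phi>) a (b1 j) t - P (Dx j \<phi>) b (a1 j) t))) + 1 * J (\<lambda>t. P (Dt \<phi>) a a t + P (Dt \<phi>) b b t)"
      unfolding g_def by (intro set_integral_linear_combination int1 int2) simp
    then show ?thesis
      unfolding distr_momentum(2)[OF d\<phi>] distr_density(2)[OF d\<phi>]
      by (simp add: set_integral_mult_right set_integral_diff(2)[OF integrable_P(3,4)[OF d\<phi>]]
          set_integral_add(2)[OF integrable_P(1,2)[OF d\<phi>]] del: times_divide_eq_left)
  qed
  moreover have "(LINT x|lebesgue. \<phi> (0, x) *\<^sub>R \<rho> 0 x) = G 0"
    unfolding G_def by (rule density_integral(2)[OF _ \<phi>]) (simp add: \<tau>)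
  ultimately show ?thesis
    unfolding D_t_def D_x_def by (simp add: sum_negf)
qed

lemma momentum_equation:
  fixes k
  defines "s \<equiv> \<lambda>j t. weak_deriv j (\<lambda>x. sqrt (\<rho> t x))"
  assumes \<phi>: "TT \<phi>"
  shows "D_t \<tau> (\<lambda>t x. \<rho> t x * u t x $ k) \<phi> + (\<Sum>j\<in>UNIV. D_x j (distr_of \<tau> (\<lambda>t x. \<rho> t x * (u t x $ j * u t x $ k))) \<phi>) =
     hbar\<^sup>2 / (4 * m\<^sup>2) * (\<Sum>j\<in>UNIV. D_x j (\<lambda>\<eta>. D_x j (D_x k (distr_of \<tau> \<rho>)) \<eta>
        - 4 * distr_of \<tau> (\<lambda>t x. s j t x * s k t x) \<eta>) \<phi>)
     - 1 / m * distr_of \<tau> (\<lambda>t x. \<rho> t x * weak_deriv k V x) \<phi>"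
proof -
  note d\<phi> = test_fun_dir_deriv[OF \<phi>]
  note d3 = test_fun_dir_deriv[OF test_fun_dir_deriv[OF d\<phi>]]
  let ?c = "hbar\<^sup>2 / (4 * m\<^sup>2)"
  let ?S = "\<lambda>j t. P (Dx j \<phi>) (a1 j) (a1 k) t + P (Dx j \<phi>) (b1 j) (b1 k) t"
  let ?T = "\<lambda>j t. P (Dx k (Dx j (Dx j \<phi>))) a a t + P (Dx k (Dx j (Dx j \<phi>))) b b t"
  let ?F = "\<lambda>t. P \<phi> (\<lambda>t x. weak_deriv k V x * a t x) a t + P \<phi> (\<lambda>t x. weak_deriv k V x * b t x) b t"
  let ?M = "\<lambda>\<phi> t. hbar / m * (P \<phi> a (b1 k) t - P \<phi> b (a1 k) t)"
  define G where "G = ?M \<phi>"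
  define g where "g t = 1 * (\<Sum>j\<in>UNIV. (hbar / m)\<^sup>2 * ?S j t - ?c * ?T j t) + 1 * (?M (Dt \<phi>) t - 1 / m * ?F t)" for t
  obtain T where T: "0 \<le> T" "T < \<tau>" "\<And>t. t \<ge> T \<Longrightarrow> Bcontfun (slice \<phi> t) = 0"
    by (rule slice_vanishes[OF \<phi> \<tau>]) (rule that)
  have iS: "set_integrable lebesgue {0..<\<tau>} (?S j)" for j
    by (intro set_integral_add(1) integrable_P d\<phi>)
  have iT: "set_integrable lebesgue {0..<\<tau>} (?T j)" for j
    by (intro set_integral_add(1) integrable_P d3)
  have iF: "set_integrable lebesgue {0..<\<tau>} ?F"
    by (intro set_integral_add(1) integrable_P \<phi>)
  have iM: "set_integrable lebesgue {0..<\<tau>} (?M (Dt \<phi>))"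
    by (intro set_integrable_mult_right set_integral_diff(1) integrable_P d\<phi>)
  have int1: "set_integrable lebesgue {0..<\<tau>} (\<lambda>t. (hbar / m)\<^sup>2 * ?S j t - ?c * ?T j t)" for j
    by (intro set_integral_diff(1) set_integrable_mult_right iS iT)
  have int2: "set_integrable lebesgue {0..<\<tau>} (\<lambda>t. ?M (Dt \<phi>) t - 1 / m * ?F t)"
    by (intro set_integral_diff(1) set_integrable_mult_right iM iF)
  have "J g = - G 0"
  proof (rule time_integral_of_derivative[OF _ _ T(1,2)])
    show "continuous_on {0..<\<tau>} G"
      unfolding G_def by (intro continuous_on_mult continuous_on_const continuous_on_diff continuous_P \<phi> continuous_parts)
    show "G t = 0" if "t \<ge> T" for t
      using T(3)[OF that] by (simp add: G_def wip_def mulC.zero_left)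
    show "set_integrable lebesgue {0..<\<tau>} g"
      unfolding g_def
      by (intro set_integral_add(1) set_integrable_mult_right[of 1] int2)
         (rule set_integrable_sum, rule int1)
    fix t assume t: "t \<in> {0<..<\<tau>}"
    note t' = interior[OF t]
    note d = time_derivatives[OF t]
    have c: "continuous (at t) (\<lambda>t. cls (a1 k t))" "continuous (at t) (\<lambda>t. cls (b1 k t))"
      using continuous_on_subset[OF continuous_parts(3)] continuous_on_subset[OF continuous_parts(4)] t
      by (metis continuous_on_eq_continuous_at greaterThanLessThan_subseteq_atLeastLessThan_iff open_greaterThanLessThan order_refl)+
    let ?g = "slice \<phi> t" and ?gk = "slice (Dx k \<phi>) t"
    have mb: "hbar / m * (2 * wip ?g (cls (da t)) (cls (b1 k t)) - 2 * wip ?g (cls (db t)) (cls (a1 k t))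
        + wip ?gk (cls (b t)) (cls (da t)) - wip ?gk (cls (a t)) (cls (db t)))
      = (\<Sum>j\<in>UNIV. (hbar / m)\<^sup>2 * ?S j t) - (\<Sum>j\<in>UNIV. ?c * ?T j t) - 1 / m * ?F t"
      using momentum_balance[OF test_fun_slice(1)[OF \<phi>, of t] t', of k]
      unfolding test_fun_slice(2)[OF \<phi>] test_fun_slice(2)[OF d\<phi>] test_fun_slice(2)[OF test_fun_dir_deriv[OF d\<phi>]] .
    have D1: "(P \<phi> a (b1 k) has_real_derivative P (Dt \<phi>) a (b1 k) t + wip ?g (cls (da t)) (cls (b1 k t))
        - (wip ?g (cls (a1 k t)) (cls (db t)) + wip ?gk (cls (a t)) (cls (db t)))) (at t)"
      by (rule wip_weak_deriv_has_real_derivative[where f = a and ?f1.0 = "a1 k" and h = b and ?h1.0 = "b1 k", OF \<phi> t open_greaterThanLessThan d(1) wd_parts(1)[OF t'] d(2) wd_parts(2)[OF interior] c(2)])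
    have D2: "(P \<phi> b (a1 k) has_real_derivative P (Dt \<phi>) b (a1 k) t + wip ?g (cls (db t)) (cls (a1 k t))
        - (wip ?g (cls (b1 k t)) (cls (da t)) + wip ?gk (cls (b t)) (cls (da t)))) (at t)"
      by (rule wip_weak_deriv_has_real_derivative[where f = b and ?f1.0 = "b1 k" and h = a and ?h1.0 = "a1 k", OF \<phi> t open_greaterThanLessThan d(2) wd_parts(2)[OF t'] d(1) wd_parts(1)[OF interior] c(1)])
    have "g t = hbar / m * ((P (Dt \<phi>) a (b1 k) t + wip ?g (cls (da t)) (cls (b1 k t))
        - (wip ?g (cls (a1 k t)) (cls (db t)) + wip ?gk (cls (a t)) (cls (db t))))
        - (P (Dt \<phi>) b (a1 k) t + wip ?g (cls (db t)) (cls (a1 k t))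
        - (wip ?g (cls (b1 k t)) (cls (da t)) + wip ?gk (cls (b t)) (cls (da t)))))"
    proof -
      have "g t = ?M (Dt \<phi>) t + hbar / m * (2 * wip ?g (cls (da t)) (cls (b1 k t)) - 2 * wip ?g (cls (db t)) (cls (a1 k t))
        + wip ?gk (cls (b t)) (cls (da t)) - wip ?gk (cls (a t)) (cls (db t)))"
        unfolding mb g_def sum_subtractf by simp
      then show ?thesis
        unfolding wip_commute[of ?g "cls (a1 k t)" "cls (db t)"] wip_commute[of ?g "cls (b1 k t)" "cls (da t)"]
          distrib_left[symmetric] by (simp add: algebra_simps)
    qed
    then show "(G has_real_derivative g t) (at t)"
      unfolding G_def using DERIV_cmult[OF DERIV_diff[OF D1 D2], of "hbar / m"] by simp
  qed
  moreover have "J g = (\<Sum>j\<in>UNIV. (hbar / m)\<^sup>2 * (J (P (Dx j \<phi>) (a1 j) (a1 k)) + J (P (Dx j \<phi>) (b1 j) (b1 k)))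
        - ?c * distr_of \<tau> \<rho> (Dx k (Dx j (Dx j \<phi>))))
      + (distr_of \<tau> (\<lambda>t x. \<rho> t x * u t x $ k) (Dt \<phi>) - 1 / m * distr_of \<tau> (\<lambda>t x. \<rho> t x * weak_deriv k V x) \<phi>)"
  proof -
    have "J g = 1 * (\<Sum>j\<in>UNIV. J (\<lambda>t. (hbar / m)\<^sup>2 * ?S j t - ?c * ?T j t)) + 1 * J (\<lambda>t. ?M (Dt \<phi>) t - 1 / m * ?F t)"
      unfolding g_def by (intro set_integral_linear_combination int1 int2) simp
    moreover have "J (\<lambda>t. (hbar / m)\<^sup>2 * ?S j t - ?c * ?T j t) =
        (hbar / m)\<^sup>2 * (J (P (Dx j \<phi>) (a1 j) (a1 k)) + J (P (Dx j \<phi>) (b1 j) (b1 k))) - ?c * distr_of \<tau> \<rho> (Dx k (Dx j (Dx j \<phi>)))" for j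
      unfolding distr_density(2)[OF d3] set_integral_diff(2)[OF set_integrable_mult_right[OF iS] set_integrable_mult_right[OF iT]]
        set_integral_mult_right set_integral_add(2)[OF integrable_P(5,6)[OF d\<phi>]] set_integral_add(2)[OF integrable_P(1,2)[OF d3]] ..
    moreover have "J (\<lambda>t. ?M (Dt \<phi>) t - 1 / m * ?F t) = distr_of \<tau> (\<lambda>t x. \<rho> t x * u t x $ k) (Dt \<phi>) - 1 / m * distr_of \<tau> (\<lambda>t x. \<rho> t x * weak_deriv k V x) \<phi>"
      unfolding distr_momentum(2)[OF d\<phi>] distr_force(2)[OF \<phi>] set_integral_diff(2)[OF iM set_integrable_mult_right[OF iF]]
        set_integral_mult_right set_integral_diff(2)[OF integrable_P(3,4)[OF d\<phi>]] set_integral_add(2)[OF integrable_P(8,9)[OF \<phi>]] ..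
    ultimately show ?thesis by simp
  qed
  moreover have "(LINT x|lebesgue. \<phi> (0, x) *\<^sub>R (\<rho> 0 x * u 0 x $ k)) = G 0"
    unfolding G_def by (rule momentum_integral(2)[OF _ \<phi>]) (simp add: \<tau>)
  ultimately show ?thesis
    unfolding D_t_def D_x_def distr_momentum_flux(2)[OF d\<phi>] s_def distr_sqrt_gradient(2)[OF d\<phi>]
    using m by (simp add: sum_negf sum_subtractf sum.distrib sum_distrib_left power_divide algebra_simps)
qed

theorem madelung: "madelung_system hbar m \<tau> V \<rho> u"
  unfolding madelung_system_def Let_def distr_defined_def
  using wd_imp_has_weak_deriv[OF wd_sqrt_density] density_integral(1) momentum_integral(1) momentum_flux_integral(1)
    force_integral(1) sqrt_gradient_integral(1) distr_density(1) distr_momentum(1) distr_momentum_flux(1) distr_force(1)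
    distr_sqrt_gradient(1) continuity_equation momentum_equation
  by (intro conjI allI ballI impI) (auto simp: weakly_diff_def)

end

theorem theorem7:
  fixes hbar m \<tau> :: real
    and V :: "real^'n::finite \<Rightarrow> real"
    and \<psi> :: "real \<Rightarrow> real^'n \<Rightarrow> complex"
  assumes "hbar > 0" and "m > 0" and "\<tau> > 0"
    and "in_W1inf V"
    and "continuous_curve_H 2 \<tau> \<psi>"
    and "schroedinger_solution hbar m \<tau> V \<psi>"
    and "\<forall>t\<in>{0<..<\<tau>}. AE x in lebesgue. \<psi> t x \<noteq> 0"
  shows "madelung_system hbar m \<tau> V (mass_density \<psi>) (velocity hbar m \<psi>)"
proof -
  interpret schroedinger_flow hbar m \<tau> V \<psi>
    using assms by unfold_locales auto
  show ?thesis by (rule madelung)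
qed

end
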